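(* In the associative plane model on $n$ variables, for the literal function $x$ (where $x$ is one of the variables), as $n\to\infty$, \[\lim_{m\to\infty}\mathbb{P}^a_{m,n}(x)=\frac{546-386\sqrt2}{n^2}+O\!\left(\frac{1}{n^3}\right).\]
   Context: A labelled associative tree on $n$ variables is a plane rooted tree in which every internal node has out-degree at least $2$, every internal node is labelled $\land$ or $\lor$ with no internal node carrying the same label as its parent, and every leaf is labelled by a literal from $\{x_1,\bar x_1,\dots,x_n,\bar x_n\}$; size is the number of leaves. $\mathbb{P}^a_{m,n}$ is the distribution on Boolean functions of $n$ variables induced by the uniform distribution on such trees of size $m$. *)

theory Defs
  imports "HOL-Probability.Probability" "HOL-Library.Landau_Symbols"
begin

datatype literal = Pos nat | Neg nat

fun lit_var :: "literal \<Rightarrow> nat" where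
  "lit_var (Pos i) = i"
| "lit_var (Neg i) = i"

fun lit_eval :: "(nat \<Rightarrow> bool) \<Rightarrow> literal \<Rightarrow> bool" where
  "lit_eval a (Pos i) \<longleftrightarrow> a i"
| "lit_eval a (Neg i) \<longleftrightarrow> \<not> a i"

datatype connective = Conj | Disj

text \<open>The children of a node form a list, so trees are plane.\<close>

datatype atree = Leaf literal | Node connective "atree list"

fun root_label :: "atree \<Rightarrow> connective option" where
  "root_label (Leaf l) = None"
| "root_label (Node c ts) = Some c"

fun assoc_tree :: "nat \<Rightarrow> atree \<Rightarrow> bool" where
  "assoc_tree n (Leaf l) \<longleftrightarrow> lit_var l \<in> {1..n}"
| "assoc_tree n (Node c ts) \<longleftrightarrow>
     length ts \<ge> 2 \<and> (\<forall>t\<in>set ts. assoc_tree n t \<and> root_label t \<noteq> Some c)"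

fun leaves :: "atree \<Rightarrow> nat" where
  "leaves (Leaf l) = 1"
| "leaves (Node c ts) = sum_list (map leaves ts)"

fun tree_eval :: "(nat \<Rightarrow> bool) \<Rightarrow> atree \<Rightarrow> bool" where
  "tree_eval a (Leaf l) \<longleftrightarrow> lit_eval a l"
| "tree_eval a (Node Conj ts) \<longleftrightarrow> (\<forall>t\<in>set ts. tree_eval a t)"
| "tree_eval a (Node Disj ts) \<longleftrightarrow> (\<exists>t\<in>set ts. tree_eval a t)"

definition assoc_trees :: "nat \<Rightarrow> nat \<Rightarrow> atree set" where
  "assoc_trees m n = {t. assoc_tree n t \<and> leaves t = m}"

text \<open>Boolean functions of \<open>n\<close> variables are extensional functions on the set
  of assignments to \<open>{1..n}\<close>, so that equality of such functions is HOL equality.\<close>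

definition assignments :: "nat \<Rightarrow> (nat \<Rightarrow> bool) set" where
  "assignments n = ({1..n} \<rightarrow>\<^sub>E UNIV)"

definition tree_fun :: "nat \<Rightarrow> atree \<Rightarrow> (nat \<Rightarrow> bool) \<Rightarrow> bool" where
  "tree_fun n t = (\<lambda>a\<in>assignments n. tree_eval a t)"

definition var_fun :: "nat \<Rightarrow> nat \<Rightarrow> (nat \<Rightarrow> bool) \<Rightarrow> bool" where
  "var_fun n i = (\<lambda>a\<in>assignments n. a i)"

text \<open>The set \<open>assoc_trees m n\<close> is always finite, and it is nonempty for \<open>m, n \<ge> 1\<close>;
  in the remaining cases the following distribution is unspecified.\<close>

definition assoc_pmf :: "nat \<Rightarrow> nat \<Rightarrow> ((nat \<Rightarrow> bool) \<Rightarrow> bool) pmf" where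
  "assoc_pmf m n = map_pmf (tree_fun n) (pmf_of_set (assoc_trees m n))"

end

theory Submission
  imports Defs "HOL-Computational_Algebra.Formal_Power_Series" "HOL-Combinatorics.Permutations"
    "HOL-Real_Asymp.Real_Asymp"
begin

text \<open>
  Let \<open>s m\<close> be the number of trees of size \<open>m\<close> whose root does not carry a given connective, divided by
  \<open>(2 n) ^ m\<close>.  Its generating function \<open>S\<close> satisfies \<open>2 S\<^sup>2 = S (1 + X) - X\<close>; it is singular at
  \<open>w0 = 3 - 2 sqrt 2\<close>, where it takes the value \<open>s0 = 1 - sqrt 2 / 2\<close>.

  Existence of the limits: for sets \<open>G1\<close>, \<open>G0\<close> of assignments, count the trees that are true on \<open>G1\<close> and
  false on \<open>G0\<close>.  By induction on \<open>G1 \<union> G0\<close> and De Morgan duality these counts reduce to a single scalar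
  equation \<open>R = a (a + R)\<close> in which \<open>a\<close> is \<open>R\<close> or \<open>- R\<close> up to known terms.  Since \<open>a\<close> misses some literal,
  \<open>3 a(w0) + R(w0) < 1\<close>, and this makes the oscillation of \<open>R m / s m\<close> vanish.

  Value of the limit: a tree with root \<open>c\<close> that computes the literal \<open>l\<close> typically has exactly two children,
  the leaf \<open>l\<close> and a node whose leaf children contain \<open>l\<close> or two complementary literals.  The limit
  ratio of these trees is explicit.  All others contain three independent coincidences among few pattern literals and
  have limit ratio \<open>O(1 / n ^ 3)\<close>; this is proved by a submultiplicative weight that combines the value of
  a generating function with its derivative close to the singularity.  The number of pattern literals has exponential
  moments, and the distribution of the pattern is invariant under all permutations of the literals.
\<close>

section \<open>Schroeder numbers near their singularity\<close>

text \<open>The generating function has a square root singularity: its value at \<open>w0\<close> is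
  finite, its derivative is not. Finiteness lets a convolution be controlled by its two ends.
  Divergence of the derivative lets a limit ratio be bounded from sums alone: if
  \<open>e m / s m\<close> converges, the limit is governed by comparing the partial sums of
  \<open>m * e m * w0^m\<close> with those of \<open>m * s m * w0^m\<close>. This says nothing about
  existence, which is why existence gets a separate argument, without a rate and without uniformity
  in \<open>n\<close>. The derivative of a product is a sum over its factors. A weight of the form
  \<open>\<omega>^m * (1 + m / \<Lambda>)\<close> replaces that rule by plain multiplication, so
  tree decompositions are estimated factor by factor. The constant is
  \<open>w0^2 * (2 * sqrt 2 + 6 * w0)\<close>. One factor \<open>w0 / n\<close> is the leaf
  \<open>l\<close> in two positions. Lists of at least two children have generating function
  \<open>t^2 / (1 - t)\<close>, and removing \<open>k\<close> leaf literals lowers \<open>t\<close>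
  by \<open>k * w0 / (2 n)\<close>. A first difference of its derivative at \<open>s0\<close> yields
  the witness \<open>l\<close>, and \<open>n\<close> second differences yield the complementary
  pairs.\<close>

definition w0 :: real where "w0 = 3 - 2 * sqrt 2"
definition s0 :: real where "s0 = 1 - sqrt 2 / 2"

definition conv :: "(nat \<Rightarrow> real) \<Rightarrow> (nat \<Rightarrow> real) \<Rightarrow> nat \<Rightarrow> real" where
  "conv x y m = (\<Sum>i\<le>m. x i * y (m - i))"

abbreviation tau :: "(nat \<Rightarrow> real) \<Rightarrow> real" where "tau x \<equiv> \<Sum>i. x i * w0^i"

lemma conv_fps: "conv x y m = fps_nth (Abs_fps x * Abs_fps y) m"
  by (simp add: conv_def fps_mult_nth atMost_atLeast0)

lemma conv_weighted: "conv x y m * (w::real)^m = (\<Sum>i\<le>m. (x i * w^i) * (y (m-i) * w^(m-i)))"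
  unfolding conv_def sum_distrib_right
proof (intro sum.cong refl)
  fix i assume "i \<in> {..m}"
  hence "w^m = w^i * w^(m-i)" by (simp add: power_add[symmetric])
  thus "x i * y (m - i) * w^m = (x i * w^i) * (y (m-i) * w^(m-i))" by simp
qed

lemma w0_pos: "0 < w0" and w0_less: "w0 < 18/100" and s0_bounds: "29/100 < s0" "s0 < 293/1000"
  and w0_upper: "w0 < 1716/10000"
  and s0_w0: "4 * s0 = 1 + w0" and w0_eq: "w0 * w0 = 6 * w0 - 1" and s0_eq: "2 * s0 * s0 = s0 * (1 + w0) - w0"
proof -
  have "sqrt 2 * sqrt 2 = (2::real)" by simp
  moreover have a: "sqrt 2 < 14143/10000" "sqrt 2 > 14142/10000"
    by (rule real_less_lsqrt real_less_rsqrt; simp add: power2_eq_square)+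
  ultimately show "0 < w0" "w0 < 18/100" "29/100 < s0" "s0 < 293/1000" "4 * s0 = 1 + w0"
    "w0 * w0 = 6 * w0 - 1" "2 * s0 * s0 = s0 * (1 + w0) - w0" "w0 < 1716/10000"
    by (auto simp: w0_def s0_def algebra_simps diff_divide_distrib)
qed

text \<open>\<open>s\<close> models normalised counts of trees and \<open>r\<close> those of lists
  of at least two trees. \<open>r_conv\<close> splits off the first tree and leaves one more tree or
  again such a list; \<open>s_r\<close> says that a tree is a leaf or has a list of children, the
  leaves having total weight 1.\<close>

locale schroeder =
  fixes s r :: "nat \<Rightarrow> real"
  assumes s_zero: "s 0 = 0" and s_r: "s m = (if m = 1 then 1 else 0) + r m"
    and r_conv: "r m = conv s (\<lambda>k. s k + r k) m"
    and s_nonneg: "0 \<le> s m" and r_nonneg: "0 \<le> r m"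
begin

section \<open>Monotonicity, quadratic equation, recurrence and ratio limit\<close>

lemma r_zero: "r 0 = 0" using s_r[of 0] s_zero by simp

lemma s_one: "s 1 = 1"
proof -
  have "r 1 = 0" using r_conv[of 1] by (simp add: conv_def s_zero r_zero)
  thus ?thesis using s_r[of 1] by simp
qed

lemma r_ge: assumes "m \<ge> 2" shows "s (m - 1) \<le> r m"
proof -
  have "(\<Sum>i\<in>{1}. s i * (s (m - i) + r (m - i))) \<le> r m"
    unfolding r_conv[of m] conv_def using assms
    by (intro sum_mono2) (auto intro!: mult_nonneg_nonneg add_nonneg_nonneg s_nonneg r_nonneg)
  thus ?thesis using s_one r_nonneg[of "m - 1"] by simp
qed

lemma s_ge_one: "m \<ge> 1 \<Longrightarrow> s m \<ge> 1"
proof (induction m rule: dec_induct)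
  case base thus ?case using s_one by simp
next
  case (step m)
  have "s (Suc m) = r (Suc m)" using s_r[of "Suc m"] step by simp
  also have "r (Suc m) \<ge> s m" using r_ge[of "Suc m"] step by simp
  finally show ?case using step by simp
qed

lemma s_pos: "m \<ge> 1 \<Longrightarrow> s m > 0" using s_ge_one[of m] by simp

definition S :: "real fps" where "S = Abs_fps s"

lemma S_quadratic: "2 * S^2 = S * (1 + fps_X) - fps_X"
proof -
  define R where "R = Abs_fps r"
  have 1: "S = fps_X + R" by (rule fps_ext) (auto simp: S_def R_def s_r)
  have 2: "R = S * (S + R)"
  proof (rule fps_ext)
    fix m
    have "S + R = Abs_fps (\<lambda>k. s k + r k)" by (rule fps_ext) (simp add: S_def R_def)
    thus "fps_nth R m = fps_nth (S * (S + R)) m"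
      using r_conv[of m] by (simp add: conv_fps S_def R_def)
  qed
  from 1 have "R = S - fps_X" by simp
  with 2 have "S - fps_X = S * (S + (S - fps_X))" by simp
  thus ?thesis by (simp add: algebra_simps power2_eq_square)
qed

lemma conv_s_s: assumes "m \<ge> 2" shows "conv s s m = (s m + s (m - 1)) / 2"
proof -
  have "fps_nth (2 * S^2) m = s m + s (m - 1)"
    unfolding S_quadratic using assms
    by (simp add: S_def algebra_simps fps_mult_fps_X_commute[symmetric] fps_X_mult_nth fps_X_nth)
  moreover have "fps_nth (2 * S^2) m = 2 * conv s s m"
    by (simp add: conv_fps S_def power2_eq_square numeral_fps_const)
  ultimately show ?thesis by simp
qed

text \<open>\<open>1 + X - 4 S\<close> is a square root of the discriminant
  \<open>1 - 6 X + X^2\<close>, hence satisfies a first order linear differential equation with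
  polynomial coefficients. Its coefficients are \<open>- 4 * s k\<close> from degree 2 on, which is
  why \<open>m\<close> starts at 3.\<close>

lemma s_recurrence:
  assumes "m \<ge> 3"
  shows "real (m + 1) * s (m + 1) = (6 * real m - 3) * s m - (real m - 2) * s (m - 1)"
proof -
  define T where "T = 1 + fps_X - 4 * S"
  have T2: "T^2 = 1 - 6 * fps_X + fps_X^2"
  proof -
    have "T^2 = (1 + fps_X)^2 - 8 * (S * (1 + fps_X)) + 8 * (2 * S^2)"
      by (simp add: T_def power2_eq_square algebra_simps)
    thus ?thesis unfolding S_quadratic by (simp add: power2_eq_square algebra_simps)
  qed
  have "fps_deriv (T^2) = 2 * T * fps_deriv T"
    by (simp add: power2_eq_square algebra_simps)
  hence "2 * T * fps_deriv T = 2 * (fps_X - 3)"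
    unfolding T2 by (simp add: power2_eq_square algebra_simps)
  hence "2 * (T * fps_deriv T) = 2 * (fps_X - 3)" by (simp only: mult.assoc)
  hence "T * fps_deriv T = fps_X - 3" by (subst (asm) mult_cancel_left) simp
  hence "T * (T * fps_deriv T) = T * (fps_X - 3)" by simp
  hence "T^2 * fps_deriv T = (fps_X - 3) * T" by (simp only: power2_eq_square mult.assoc mult.commute[of T "fps_X - 3"])
  hence "(1 - 6 * fps_X + fps_X^2) * fps_deriv T = (fps_X - 3) * T" unfolding T2 .
  hence "fps_nth (fps_deriv T) m - 6 * fps_nth (fps_X * fps_deriv T) m + fps_nth (fps_X^2 * fps_deriv T) m
     = fps_nth (fps_X * T) m - 3 * fps_nth T m"
    by (simp add: fps_eq_iff left_diff_distrib distrib_right mult.assoc numeral_fps_const)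
  moreover have t: "fps_nth T k = - 4 * s k" if "k \<ge> 2" for k
    using that by (simp add: T_def S_def numeral_fps_const fps_X_nth)
  ultimately have "real (m+1) * (- 4 * s (m+1)) - 6 * (real m * (-4 * s m)) + real (m-1) * (-4 * s (m-1))
     = -4 * s (m-1) - 3 * (-4 * s m)"

    using assms by (cases m rule: nat.exhaust; cases "m - 1") (simp_all add: fps_X_power_mult_nth)
  moreover have "real (m-1) = real m - 1" using assms by (simp add: of_nat_diff)
  ultimately have "real (m+1) * (- 4 * s (m+1)) - 6 * (real m * (-4 * s m)) + (real m-1) * (-4 * s (m-1))
     = -4 * s (m-1) - 3 * (-4 * s m)" by simp
  thus ?thesis by (simp only: left_diff_distrib right_diff_distrib)
qed

text \<open>The recurrence turns the ratio \<open>x\<close> at \<open>m\<close> into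
  \<open>(m + 1) / (6 m - 3 - (m - 2) x)\<close>, close to \<open>1 / (6 - x)\<close>, which has the
  fixed point \<open>w0\<close>. Because \<open>x\<close> is at most 1 the denominator is at least
  \<open>4 m\<close>, and this contraction is strong enough for the bound \<open>4 / (m - 1)\<close>
  to reproduce itself.\<close>

lemma ratio_bound:
  assumes "m \<ge> 3" shows "\<bar>s (m-1) / s m - w0\<bar> \<le> 4 / real (m-1)"
  using assms
proof (induction m rule: dec_induct)
  case base
  have "s 2 \<le> s 3" using s_r[of 3] r_ge[of 3] by simp
  hence "s 2 / s 3 \<le> 1" "s 2 / s 3 \<ge> 0" using s_pos[of 3] s_nonneg[of 2] by auto
  thus ?case using w0_pos w0_less by (simp add: abs_le_iff)
next
  case (step m)
  define x where "x = s (m-1) / s m"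
  have sm: "s m > 0" using s_pos step by simp
  have "s (m - 1) \<le> s m" using r_ge[of m] s_r[of m] step by simp
  hence x1: "0 \<le> x" "x \<le> 1" using sm s_nonneg by (auto simp: x_def)
  define d where "d = (6 * real m - 3) - (real m - 2) * x"
  have m3: "real m \<ge> 3" using step by simp
  have "(real m - 2) * x \<le> (real m - 2) * 1" using x1 m3 by (intro mult_left_mono) auto
  hence d: "d \<ge> 4 * real m" using m3 unfolding d_def by (simp add: algebra_simps)
  have "real (m+1) * s (m+1) = d * s m"
  proof -
    have "s (m-1) = x * s m" using sm by (simp add: x_def)
    thus ?thesis using s_recurrence[OF step(1)] by (simp add: d_def algebra_simps)
  qed
  hence eq: "s m / s (m+1) = (real m + 1) / d"
    using d m3 s_pos[of "m+1"] by (simp add: field_simps)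
  \<comment> \<open>The terms of order \<open>m\<close> without the factor \<open>x - w0\<close>
    cancel because \<open>w0 * w0 = 6 * w0 - 1\<close>.\<close>
  have e: "(real m + 1) / d - w0 = (w0 * real m * (x - w0) + (1 + 3 * w0 - 2 * w0 * x)) / d"
  proof -
    have "real m + 1 - w0 * d = w0 * real m * (x - w0) + (1 + 3 * w0 - 2 * w0 * x)"
      using w0_eq unfolding d_def by algebra
    thus ?thesis using d m3 by (simp add: field_simps)
  qed
  have b1: "\<bar>w0 * real m * (x - w0)\<bar> \<le> real m * (4 / real (m - 1))"
  proof -
    have "\<bar>w0 * real m * (x - w0)\<bar> = w0 * (real m * \<bar>x - w0\<bar>)" using w0_pos by (simp add: abs_mult)
    also have "\<dots> \<le> 1 * (real m * (4 / real (m - 1)))"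
      using step w0_pos w0_less unfolding x_def by (intro mult_mono mult_left_mono) auto
    finally show ?thesis by simp
  qed
  have b2: "\<bar>1 + 3 * w0 - 2 * w0 * x\<bar> \<le> 2"
  proof -
    have "w0 * x \<le> w0" "0 \<le> w0 * x" using x1 w0_pos by (auto intro: mult_left_le)
    thus ?thesis using w0_pos w0_less by linarith
  qed
  have "\<bar>(real m + 1) / d - w0\<bar> \<le> (real m * (4 / real (m - 1)) + 2) / d"
  proof -
    have "\<bar>w0 * real m * (x - w0) + (1 + 3 * w0 - 2 * w0 * x)\<bar> \<le> real m * (4 / real (m - 1)) + 2"
      by (rule order_trans[OF abs_triangle_ineq add_mono[OF b1 b2]])
    moreover have "\<bar>d\<bar> = d" "d > 0" using d m3 by auto
    ultimately show ?thesis unfolding e abs_divide by (simp add: divide_right_mono)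
  qed
  also have "\<dots> \<le> (real m * (4 / real (m - 1)) + 2) / (4 * real m)"
    using d m3 by (intro divide_left_mono add_nonneg_nonneg mult_nonneg_nonneg) auto
  also have "\<dots> \<le> 4 / real m"
  proof -
    have "real (m-1) = real m - 1" using step by (simp add: of_nat_diff)
    thus ?thesis using m3 by (simp add: field_simps)
  qed
  finally show ?case using eq by simp
qed

lemma ratio_step: "(\<lambda>m. s (m-1) / s m) \<longlonglongrightarrow> w0"
proof -
  have "(\<lambda>m. 4 / real (m-1)) \<longlonglongrightarrow> 0"
    by (rule filterlim_compose[OF lim_const_over_n]) (rule filterlim_minus_const_nat_at_top)
  hence "(\<lambda>m. s (m-1) / s m - w0) \<longlonglongrightarrow> 0"
  proof (rule Lim_null_comparison[rotated])
    show "\<forall>\<^sub>F m in sequentially. norm (s (m-1) / s m - w0) \<le> 4 / real (m-1)"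
      unfolding eventually_at_top_linorder using ratio_bound by (auto intro!: exI[of _ 3] simp del: of_nat_diff)
  qed
  thus ?thesis by (simp add: LIM_zero_iff)
qed

lemma ratio_shift: "(\<lambda>m. s (m-i) / s m) \<longlonglongrightarrow> w0 ^ i"
proof (induction i)
  case 0
  have "eventually (\<lambda>m. s (m-0) / s m = 1) sequentially"
    unfolding eventually_at_top_linorder
    by (intro exI[of _ 1] allI impI, drule s_pos) simp
  thus ?case by (simp add: tendsto_eventually)
next
  case (Suc i)
  have "(\<lambda>m. s ((m - i) - 1) / s (m - i)) \<longlonglongrightarrow> w0"
    by (rule filterlim_compose[OF ratio_step]) (rule filterlim_minus_const_nat_at_top)
  from tendsto_mult[OF this Suc]
  have "(\<lambda>m. s (m - i - 1) / s (m - i) * (s (m - i) / s m)) \<longlonglongrightarrow> w0 ^ Suc i" by simp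
  thus ?case
  proof (rule Lim_transform_eventually)
    show "\<forall>\<^sub>F m in sequentially. s (m - i - 1) / s (m - i) * (s (m - i) / s m) = s (m - Suc i) / s m"
      unfolding eventually_at_top_linorder
    proof (intro exI[of _ "Suc i"] allI impI)
      fix m assume "Suc i \<le> m"
      hence "s (m - i) > 0" by (intro s_pos) simp
      thus "s (m - i - 1) / s (m - i) * (s (m - i) / s m) = s (m - Suc i) / s m" by simp
    qed
  qed
qed

text \<open>The pair \<open>(s0, s0 - w0)\<close> solves the equations \<open>R = S (S + R)\<close>
  and \<open>S = w0 + R\<close>, so by induction on the truncation it bounds all truncated sums from
  above.\<close>

lemma partial_sums: "(\<Sum>i\<le>N. s i * w0^i) \<le> s0 \<and> (\<Sum>i\<le>N. r i * w0^i) \<le> s0 - w0"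
proof (induction N)
  case 0
  show ?case using s_zero r_zero s0_bounds w0_less by simp
next
  case (Suc N)
  define e where "e = (\<lambda>k. s k + r k)"
  have e0: "e 0 = 0" by (simp add: e_def s_zero r_zero)
  have en: "e i \<ge> 0" for i by (simp add: e_def s_nonneg r_nonneg)
  have "(\<Sum>k\<le>Suc N. r k * w0^k) = (\<Sum>k\<le>Suc N. \<Sum>i\<le>k. (s i * w0^i) * (e (k-i) * w0^(k-i)))"
  proof (intro sum.cong refl)
    fix k
    have "r k * w0^k = conv s e k * w0^k" unfolding e_def r_conv[of k, symmetric] ..
    thus "r k * w0^k = (\<Sum>i\<le>k. (s i * w0^i) * (e (k-i) * w0^(k-i)))" by (simp add: conv_weighted)
  qed
  also have "\<dots> = (\<Sum>(k,i)\<in>(SIGMA k:{..Suc N}. {..k}). (s i * w0^i) * (e (k-i) * w0^(k-i)))"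
    by (rule sum.Sigma) auto
  also have "\<dots> = (\<Sum>(i,j)\<in>{(i,j). i + j \<le> Suc N}. (s i * w0^i) * (e j * w0^j))"
    by (rule sum.reindex_bij_witness[of _ "\<lambda>(i,j). (i+j,i)" "\<lambda>(k,i). (i,k-i)"]) auto
  \<comment> \<open>Both sequences vanish at 0, so in total degree \<open>Suc N\<close> each factor
    has index at most \<open>N\<close> and the induction hypothesis covers both.\<close>
  also have "\<dots> = (\<Sum>(i,j)\<in>{(i,j). i + j \<le> Suc N \<and> i \<noteq> 0 \<and> j \<noteq> 0}. (s i * w0^i) * (e j * w0^j))"
  proof (rule sum.mono_neutral_right)
    have "{(i, j). i + j \<le> Suc N} \<subseteq> {..Suc N} \<times> {..Suc N}" by auto
    thus "finite {(i, j). i + j \<le> Suc N}" by (rule finite_subset) auto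
    show "{(i, j). i + j \<le> Suc N \<and> i \<noteq> 0 \<and> j \<noteq> 0} \<subseteq> {(i, j). i + j \<le> Suc N}" by auto
  next
    show "\<forall>i\<in>{(i, j). i + j \<le> Suc N} - {(i, j). i + j \<le> Suc N \<and> i \<noteq> 0 \<and> j \<noteq> 0}.
       (case i of (i, j) \<Rightarrow> s i * w0 ^ i * (e j * w0 ^ j)) = 0"
    proof
      fix p assume p: "p \<in> {(i, j). i + j \<le> Suc N} - {(i, j). i + j \<le> Suc N \<and> i \<noteq> 0 \<and> j \<noteq> 0}"
      obtain a b where ab: "p = (a, b)" by (cases p)
      have "a = 0 \<or> b = 0" using p unfolding ab by blast
      thus "(case p of (i, j) \<Rightarrow> s i * w0 ^ i * (e j * w0 ^ j)) = 0" unfolding ab using s_zero e0 by (elim disjE) simp_all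
    qed
  qed
  also have "\<dots> \<le> (\<Sum>(i,j)\<in>{..N} \<times> {..N}. (s i * w0^i) * (e j * w0^j))"
    using w0_pos s_nonneg en by (intro sum_mono2) (auto intro!: mult_nonneg_nonneg)
  also have "\<dots> = (\<Sum>i\<le>N. s i * w0^i) * (\<Sum>j\<le>N. e j * w0^j)"
    by (simp add: sum_product sum.cartesian_product)
  also have "\<dots> \<le> s0 * (s0 + (s0 - w0))"
  proof (rule mult_mono)
    show "(\<Sum>j\<le>N. e j * w0^j) \<le> s0 + (s0 - w0)"
      using Suc by (simp add: e_def distrib_right sum.distrib)
  qed (use Suc s0_bounds w0_pos en in \<open>auto intro!: sum_nonneg mult_nonneg_nonneg\<close>)
  also have "\<dots> = s0 - w0" using s0_eq by (simp add: algebra_simps)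
  finally have 1: "(\<Sum>k\<le>Suc N. r k * w0^k) \<le> s0 - w0" .
  have "(\<Sum>i\<le>Suc N. s i * w0^i) = (\<Sum>i\<le>Suc N. (if i = 1 then w0 else 0) + r i * w0^i)"
    by (intro sum.cong) (auto simp: s_r[of _] distrib_right)
  also have "\<dots> = w0 + (\<Sum>i\<le>Suc N. r i * w0^i)" unfolding sum.distrib by (simp add: sum.delta)
  finally show ?case using 1 by simp
qed

lemma partial_sums_less: "(\<Sum>i<N. s i * w0^i) \<le> s0" "(\<Sum>i<N. r i * w0^i) \<le> s0 - w0"
proof -
  have "(\<Sum>i<N. s i * w0^i) \<le> (\<Sum>i\<le>N. s i * w0^i)" "(\<Sum>i<N. r i * w0^i) \<le> (\<Sum>i\<le>N. r i * w0^i)"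
    using w0_pos s_nonneg r_nonneg by (auto intro!: sum_mono2)
  with partial_sums[of N] show "(\<Sum>i<N. s i * w0^i) \<le> s0" "(\<Sum>i<N. r i * w0^i) \<le> s0 - w0" by auto
qed

lemma summable_s: "summable (\<lambda>i. s i * w0^i)"
  by (rule summableI_nonneg_bounded[OF _ partial_sums_less(1)]) (use s_nonneg w0_pos in simp)

lemma summable_r: "summable (\<lambda>i. r i * w0^i)"
  by (rule summableI_nonneg_bounded[OF _ partial_sums_less(2)]) (use r_nonneg w0_pos in simp)

lemma suminf_r_le: "(tau r) \<le> s0 - w0"
  by (rule suminf_le_const[OF summable_r partial_sums_less(2)])

end

lemma conv_sums:
  assumes "summable (\<lambda>i. x i * w^i)" "summable (\<lambda>i. y i * w^i)"
    "\<And>i. 0 \<le> x i" "\<And>i. 0 \<le> y i" "0 \<le> (w::real)"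
  shows "(\<lambda>m. conv x y m * w^m) sums ((\<Sum>i. x i * w^i) * (\<Sum>i. y i * w^i))"
  unfolding conv_weighted
  by (rule Cauchy_product_sums) (use assms in \<open>simp_all add: abs_mult\<close>)

context schroeder
begin

text \<open>The partial sums only give \<open>s0\<close> as an upper bound. Equality holds because
  the quadratic equation has a double root at \<open>w0\<close>, so any sum that satisfies it must
  be \<open>s0\<close>.\<close>

lemma suminf_s: "(tau s) = s0"
proof -
  let ?T = "\<Sum>i. s i * w0^i" and ?R = "\<Sum>i. r i * w0^i"
  have "(\<lambda>m. conv s (\<lambda>k. s k + r k) m * w0^m) sums (?T * (\<Sum>i. (s i + r i) * w0^i))"
    using summable_add[OF summable_s summable_r] s_nonneg r_nonneg w0_pos summable_s
    by (intro conv_sums) (auto simp: distrib_right)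
  hence "?R = ?T * (\<Sum>i. (s i + r i) * w0^i)"
    unfolding r_conv[symmetric] by (simp add: sums_iff)
  also have "(\<Sum>i. (s i + r i) * w0^i) = ?T + ?R"
    using suminf_add[OF summable_s summable_r] by (simp add: distrib_right)
  finally have R: "?R = ?T * (?T + ?R)" .
  have "(\<lambda>i. (if i = 1 then w0 else 0) + r i * w0^i) sums (w0 + ?R)"
    using sums_single[of 1 "\<lambda>_. w0"] summable_sums[OF summable_r] by (intro sums_add) auto
  moreover have "(\<lambda>i. (if i = 1 then w0 else 0) + r i * w0^i) = (\<lambda>i. s i * w0^i)"
    by (intro ext) (auto simp: s_r[of _] distrib_right)
  ultimately have T: "?T = w0 + ?R" by (simp add: sums_iff)
  have "2 * (?T - s0)^2 = 0"
  proof -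
    have "2 * ?T * ?T = ?T * (1 + w0) - w0" using R T by algebra
    thus ?thesis using s0_eq s0_w0 by (simp add: power2_eq_square) algebra
  qed
  thus ?thesis by simp
qed

text \<open>Differentiating the quadratic equation gives \<open>S' (4 S - 1 - X) = S - 1\<close>, whose left factor
  vanishes at the critical point while the right-hand side does not.\<close>

lemma weighted_sum_unbounded: "\<not> summable (\<lambda>m. real m * s m * w0^m)"
proof
  assume a: "summable (\<lambda>m. real m * s m * w0^m)"
  define d where "d = (\<lambda>m. real m * s m)"
  have eq: "4 * conv s d m - (d m + (if m = 0 then 0 else d (m-1))) = (if m = 1 then - 1 else 0) + (if m = 0 then 0 else s (m-1))" for m
  proof -
    have D: "Abs_fps d = fps_X * fps_deriv S"
    proof (rule fps_ext)
      fix k show "fps_nth (Abs_fps d) k = fps_nth (fps_X * fps_deriv S) k"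
        by (cases k) (simp_all add: d_def S_def)
    qed
    have "fps_deriv (2 * S^2) = fps_deriv (S * (1 + fps_X) - fps_X)" by (simp add: S_quadratic)
    hence "4 * (S * fps_deriv S) = fps_deriv S * (1 + fps_X) + S - 1"
      by (simp add: power2_eq_square algebra_simps numeral_fps_const)
    hence "fps_X * (4 * (S * fps_deriv S)) = fps_X * (fps_deriv S * (1 + fps_X) + S - 1)" by simp
    hence "4 * (S * Abs_fps d) = Abs_fps d + fps_X * Abs_fps d + fps_X * S - fps_X"
      unfolding D by (simp add: algebra_simps)
    hence "fps_nth (4 * (S * Abs_fps d)) m = fps_nth (Abs_fps d + fps_X * Abs_fps d + fps_X * S - fps_X) m"
      by simp
    thus ?thesis by (cases m) (auto simp: numeral_fps_const conv_fps S_def d_def fps_X_nth split: if_splits)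
  qed
  let ?D = "\<Sum>m. d m * w0^m"
  have sd: "summable (\<lambda>m. d m * w0^m)" using a by (simp add: d_def)
  have shift: "(\<lambda>m. (if m = 0 then 0 else f (m-1)) * w0^m) sums (w0 * (\<Sum>m. f m * w0^m))"
    if "summable (\<lambda>m. f m * w0^m)" for f :: "nat \<Rightarrow> real"
  proof -
    have "(\<lambda>m. w0 * (f m * w0^m)) sums (w0 * (\<Sum>m. f m * w0^m))"
      using that by (intro sums_mult) (simp add: summable_sums)
    hence "(\<lambda>m. (if Suc m = 0 then 0 else f (Suc m - 1)) * w0^Suc m) sums (w0 * (\<Sum>m. f m * w0^m))"
      by (simp add: algebra_simps)
    from sums_Suc[OF this] show ?thesis by simp
  qed
  have 1: "(\<lambda>m. conv s d m * w0^m) sums (s0 * ?D)"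
    using conv_sums[OF summable_s sd] s_nonneg w0_pos by (simp add: suminf_s d_def)
  have 2: "(\<lambda>m. (4 * conv s d m - (d m + (if m = 0 then 0 else d (m-1)))) * w0^m) sums (4 * (s0 * ?D) - (?D + w0 * ?D))"
    using sums_diff[OF sums_mult[OF 1, of 4] sums_add[OF summable_sums[OF sd] shift[OF sd]]]
    by (simp add: algebra_simps)
  have 3: "(\<lambda>m. (if m = 1 then - 1 else 0) * w0^m + (if m = 0 then 0 else s (m-1)) * w0^m) sums (- w0 + w0 * s0)"
    using sums_add[OF _ shift[OF summable_s], of "\<lambda>m. (if m = 1 then - 1 else 0) * w0^m" "-w0"] sums_single[of 1 "\<lambda>_. -w0"]
    by (simp add: suminf_s if_distrib[of "\<lambda>x. x * _"] cong: if_cong)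
  have "(\<lambda>m. (4 * conv s d m - (d m + (if m = 0 then 0 else d (m-1)))) * w0^m)
      = (\<lambda>m. (if m = 1 then - 1 else 0) * w0^m + (if m = 0 then 0 else s (m-1)) * w0^m)"
    unfolding eq by (intro ext) (rule distrib_right)
  note eq' = this
  have "4 * (s0 * ?D) - (?D + w0 * ?D) = - w0 + w0 * s0" by (rule sums_unique2[OF 2 3[folded eq']])
  moreover have "4 * (s0 * ?D) - (?D + w0 * ?D) = (4 * s0 - (1 + w0)) * ?D" by (simp add: algebra_simps)
  moreover have "4 * s0 - (1 + w0) = 0" using s0_w0 by simp
  ultimately have "w0 * (1 - s0) = 0" by algebra
  thus False using w0_pos s0_bounds by simp
qed

lemma weighted_sum_at_top: "filterlim (\<lambda>M. \<Sum>m\<le>M. real m * s m * w0^m) at_top sequentially"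
proof -
  let ?f = "\<lambda>m. real m * s m * w0^m"
  have nn: "?f m \<ge> 0" for m using s_nonneg w0_pos by simp
  show ?thesis unfolding filterlim_at_top eventually_at_top_linorder
  proof
    fix Z :: real
    have "\<exists>N. (\<Sum>m<N. ?f m) > Z"
    proof (rule ccontr)
      assume "\<not> ?thesis"
      hence "summable ?f" using nn by (intro summableI_nonneg_bounded[of _ Z]) (auto simp: not_less)
      thus False using weighted_sum_unbounded by simp
    qed
    then obtain N where N: "(\<Sum>m<N. ?f m) > Z" by auto
    show "\<exists>N. \<forall>M\<ge>N. Z \<le> (\<Sum>m\<le>M. ?f m)"
    proof (intro exI[of _ N] allI impI)
      fix M assume "M \<ge> N"
      hence "(\<Sum>m<N. ?f m) \<le> (\<Sum>m\<le>M. ?f m)" using nn by (intro sum_mono2) auto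
      thus "Z \<le> (\<Sum>m\<le>M. ?f m)" using N by simp
    qed
  qed
qed

end

section \<open>Ratio limits of convolutions\<close>

context schroeder
begin

lemma conv_split:
  assumes "2 * K \<le> m"
  shows "conv x y m = (\<Sum>i<K. x i * y (m - i)) + (\<Sum>i<K. y i * x (m - i)) + (\<Sum>i\<in>{K..m-K}. x i * y (m - i))"
proof -
  have "{..m} = {..<K} \<union> ({K..m-K} \<union> {m-K<..m})" using assms by auto
  hence "conv x y m = (\<Sum>i<K. x i * y (m - i)) + ((\<Sum>i\<in>{K..m-K}. x i * y (m - i)) + (\<Sum>i\<in>{m-K<..m}. x i * y (m - i)))"
    unfolding conv_def using assms by (simp only:) (subst sum.union_disjoint; (subst sum.union_disjoint)?; force)
  also have "(\<Sum>i\<in>{m-K<..m}. x i * y (m - i)) = (\<Sum>i<K. y i * x (m - i))"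
    using assms by (intro sum.reindex_bij_witness[of _ "\<lambda>i. m - i" "\<lambda>i. m - i"]) auto
  finally show ?thesis by simp
qed

text \<open>By the quadratic equation \<open>conv s s m / s m\<close> tends to
  \<open>(1 + w0) / 2 = 2 * s0\<close>. By \<open>ratio_shift\<close> the two ends of the
  convolution contribute twice a partial sum of \<open>tau s = s0\<close>, so they exhaust this
  limit as \<open>K\<close> grows and nothing remains for the middle.\<close>

lemma tail_small:
  assumes "\<epsilon> > 0"
  shows "\<exists>K0. \<forall>K\<ge>K0. \<forall>\<^sub>F m in sequentially. (\<Sum>i\<in>{K..m-K}. s i * s (m - i)) / s m \<le> \<epsilon>"
proof -
  have "(\<lambda>K. \<Sum>i<K. s i * w0^i) \<longlonglongrightarrow> s0"
    using summable_LIMSEQ[OF summable_s] by (simp add: suminf_s)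
  hence "\<forall>\<^sub>F K in sequentially. (\<Sum>i<K. s i * w0^i) > s0 - \<epsilon> / 4"
    using assms by (intro order_tendstoD) auto
  then obtain K0 where K0: "\<And>K. K \<ge> K0 \<Longrightarrow> (\<Sum>i<K. s i * w0^i) > s0 - \<epsilon> / 4"
    by (auto simp: eventually_at_top_linorder)
  show ?thesis
  proof (intro exI[of _ K0] allI impI)
    fix K assume K: "K \<ge> K0"
    have 1: "(\<lambda>m. conv s s m / s m) \<longlonglongrightarrow> 2 * s0"
    proof -
      have "(\<lambda>m. (1 + s (m-1) / s m) / 2) \<longlonglongrightarrow> (1 + w0) / 2" by (intro tendsto_intros ratio_step) auto
      moreover have "(1 + w0) / 2 = 2 * s0" using s0_w0 by simp
      moreover have "\<forall>\<^sub>F m in sequentially. (1 + s (m-1) / s m) / 2 = conv s s m / s m"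
        unfolding eventually_at_top_linorder
      proof (intro exI[of _ 2] allI impI)
        fix m :: nat assume m: "m \<ge> 2"
        hence "s m > 0" using s_pos by simp
        thus "(1 + s (m-1) / s m) / 2 = conv s s m / s m" using conv_s_s[OF m] by (simp add: field_simps)
      qed
      ultimately show ?thesis by (simp add: Lim_transform_eventually)
    qed
    have 2: "(\<lambda>m. conv s s m / s m - 2 * (\<Sum>i<K. s i * (s (m - i) / s m))) \<longlonglongrightarrow> 2 * s0 - 2 * (\<Sum>i<K. s i * w0^i)"
      by (intro tendsto_intros 1 ratio_shift)
    moreover have "2 * s0 - 2 * (\<Sum>i<K. s i * w0^i) < \<epsilon>" using K0[OF K] assms by simp
    ultimately have "\<forall>\<^sub>F m in sequentially. conv s s m / s m - 2 * (\<Sum>i<K. s i * (s (m - i) / s m)) < \<epsilon>"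
      by (rule order_tendstoD)
    moreover have "\<forall>\<^sub>F m in sequentially. m \<ge> 2 * K" by (rule eventually_ge_at_top)
    ultimately show "\<forall>\<^sub>F m in sequentially. (\<Sum>i\<in>{K..m-K}. s i * s (m - i)) / s m \<le> \<epsilon>"
    proof eventually_elim
      case (elim m)
      have "conv s s m / s m - 2 * (\<Sum>i<K. s i * (s (m - i) / s m)) = (\<Sum>i\<in>{K..m-K}. s i * s (m - i)) / s m"
        unfolding conv_split[OF elim(2)] by (simp add: add_divide_distrib sum_divide_distrib[symmetric])
      thus ?case using elim(1) by simp
    qed
  qed
qed

lemma quotient_bounds:
  assumes "\<And>m. 0 \<le> x m" "\<And>m. x m \<le> 2 * s m" shows "0 \<le> x m / s m" "x m / s m \<le> 2"
  using assms[of m] s_nonneg[of m] by (auto simp: divide_le_eq)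

text \<open>The bound \<open>2 * s m\<close> is made for sums of two sequences dominated by
  \<open>s\<close>, such as \<open>a + R\<close> in the fixed point equation. The middle is at most
  four times that of \<open>conv s s\<close>; in the two ends \<open>s (m - i) / s m\<close> is
  replaced by its limit \<open>w0 ^ i\<close>.\<close>

lemma conv_approx:
  assumes x: "\<And>m. 0 \<le> x m" "\<And>m. x m \<le> 2 * s m" and y: "\<And>m. 0 \<le> y m" "\<And>m. y m \<le> 2 * s m" and "\<epsilon> > 0"
  shows "\<exists>K0. \<forall>K\<ge>K0. \<forall>\<^sub>F m in sequentially. \<bar>conv x y m / s m -
      (\<Sum>i<K. x i * w0^i * (y (m-i) / s (m-i)) + y i * w0^i * (x (m-i) / s (m-i)))\<bar> \<le> \<epsilon>"
proof -
  obtain K0 where K0: "\<And>K. K \<ge> K0 \<Longrightarrow> \<forall>\<^sub>F m in sequentially. (\<Sum>i\<in>{K..m-K}. s i * s (m - i)) / s m \<le> \<epsilon> / 8"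
    using tail_small[of "\<epsilon>/8"] assms(5) by auto
  show ?thesis
  proof (intro exI[of _ K0] allI impI)
    fix K assume K: "K \<ge> K0"
    have "(\<lambda>m. \<Sum>i<K. (2 * x i + 2 * y i) * \<bar>s (m-i) / s m - w0^i\<bar>) \<longlonglongrightarrow> (\<Sum>i<K. (2 * x i + 2 * y i) * \<bar>w0^i - w0^i\<bar>)"
      by (intro tendsto_intros ratio_shift)
    hence "\<forall>\<^sub>F m in sequentially. (\<Sum>i<K. (2 * x i + 2 * y i) * \<bar>s (m-i) / s m - w0^i\<bar>) < \<epsilon> / 2"
      using assms(5) by (intro order_tendstoD) auto
    moreover have "\<forall>\<^sub>F m in sequentially. m \<ge> 2 * K + 1" by (rule eventually_ge_at_top)
    ultimately show "\<forall>\<^sub>F m in sequentially. \<bar>conv x y m / s m -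
      (\<Sum>i<K. x i * w0^i * (y (m-i) / s (m-i)) + y i * w0^i * (x (m-i) / s (m-i)))\<bar> \<le> \<epsilon>"
      using K0[OF K]
    proof eventually_elim
      case (elim m)
      have sm: "s m > 0" using elim s_pos by simp
      have mK: "2 * K \<le> m" using elim by simp
      define T where "T = (\<Sum>i\<in>{K..m-K}. x i * y (m - i)) / s m"
      define u where "u = (\<lambda>i. x i * (y (m-i) / s (m-i)) + y i * (x (m-i) / s (m-i)))"
      have "conv x y m / s m = (\<Sum>i<K. u i * (s (m-i) / s m)) + T"
      proof -
        have "(\<Sum>i<K. u i * (s (m-i) / s m)) = (\<Sum>i<K. x i * y (m-i) / s m + y i * x (m-i) / s m)"
        proof (intro sum.cong refl)
          fix i assume "i \<in> {..<K}"
          hence "s (m-i) > 0" using mK elim by (intro s_pos) auto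
          thus "u i * (s (m-i) / s m) = x i * y (m-i) / s m + y i * x (m-i) / s m"
            by (simp add: u_def distrib_right add_divide_distrib)
        qed
        thus ?thesis unfolding conv_split[OF mK] T_def by (simp add: add_divide_distrib sum_divide_distrib sum.distrib)
      qed
      moreover have "(\<Sum>i<K. x i * w0^i * (y (m-i) / s (m-i)) + y i * w0^i * (x (m-i) / s (m-i))) = (\<Sum>i<K. u i * w0^i)"
        by (simp add: u_def algebra_simps)
      ultimately have "conv x y m / s m - (\<Sum>i<K. x i * w0^i * (y (m-i) / s (m-i)) + y i * w0^i * (x (m-i) / s (m-i)))
         = (\<Sum>i<K. u i * (s (m-i) / s m - w0^i)) + T" by (simp add: right_diff_distrib sum_subtractf)
      moreover have "\<bar>\<Sum>i<K. u i * (s (m-i) / s m - w0^i)\<bar> \<le> \<epsilon> / 2"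
      proof -
        have "\<bar>\<Sum>i<K. u i * (s (m-i) / s m - w0^i)\<bar> \<le> (\<Sum>i<K. \<bar>u i * (s (m-i) / s m - w0^i)\<bar>)" by (rule sum_abs)
        also have "\<dots> \<le> (\<Sum>i<K. (2 * x i + 2 * y i) * \<bar>s (m-i) / s m - w0^i\<bar>)"
        proof (intro sum_mono)
          fix i
          have "x i * (y (m-i) / s (m-i)) \<le> x i * 2" "y i * (x (m-i) / s (m-i)) \<le> y i * 2"
            by (intro mult_left_mono quotient_bounds x y)+
          moreover have "u i \<ge> 0" unfolding u_def by (intro add_nonneg_nonneg mult_nonneg_nonneg quotient_bounds x y)
          ultimately have "\<bar>u i\<bar> \<le> 2 * x i + 2 * y i" by (simp add: u_def)
          thus "\<bar>u i * (s (m-i) / s m - w0^i)\<bar> \<le> (2 * x i + 2 * y i) * \<bar>s (m-i) / s m - w0^i\<bar>"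
            unfolding abs_mult by (rule mult_right_mono) simp
        qed
        finally show ?thesis using elim by simp
      qed
      moreover have "\<bar>T\<bar> \<le> \<epsilon> / 2"
      proof -
        have "(\<Sum>i\<in>{K..m-K}. x i * y (m - i)) \<le> (\<Sum>i\<in>{K..m-K}. (2 * s i) * (2 * s (m - i)))"
          using s_nonneg by (intro sum_mono mult_mono x y) auto
        also have "\<dots> = 4 * (\<Sum>i\<in>{K..m-K}. s i * s (m - i))" by (simp add: sum_distrib_left)
        finally have "T \<le> 4 * ((\<Sum>i\<in>{K..m-K}. s i * s (m - i)) / s m)" using sm by (simp add: T_def divide_right_mono)
        moreover have "T \<ge> 0" using x y sm unfolding T_def by (auto intro!: divide_nonneg_nonneg sum_nonneg)
        ultimately show ?thesis using elim(3) by linarith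
      qed
      ultimately show ?case by linarith
    qed
  qed
qed

section \<open>Oscillation of ratios and the fixed point equation\<close>

definition osc :: "(nat \<Rightarrow> real) \<Rightarrow> real \<Rightarrow> bool" where
  "osc x D \<longleftrightarrow> (\<exists>N. \<forall>m\<ge>N. \<forall>k\<ge>N. \<bar>x m / s m - x k / s k\<bar> \<le> D)"

lemma osc_mono: "osc x D \<Longrightarrow> D \<le> D' \<Longrightarrow> osc x D'"
  unfolding osc_def by (meson order_trans)

lemma summable_le_s:
  assumes x: "\<And>m. 0 \<le> x m" "\<And>m. x m \<le> 2 * s m"
  shows "summable (\<lambda>i. x i * w0^i)"
proof (rule summable_comparison_test')
  show "summable (\<lambda>i. 2 * (s i * w0^i))" by (intro summable_mult summable_s)
  show "norm (x i * w0^i) \<le> 2 * (s i * w0^i)" if "i \<ge> 0" for i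
    using x[of i] w0_pos by (simp add: mult_right_mono)
qed

text \<open>Up to a small error the ratio of the convolution is a combination of shifted ratios of
  its factors: those of \<open>y\<close> enter with total weight at most \<open>tau x\<close>, those
  of \<open>x\<close> with total weight at most \<open>tau y\<close>.\<close>

lemma osc_conv:
  assumes x: "\<And>m. 0 \<le> x m" "\<And>m. x m \<le> 2 * s m" and y: "\<And>m. 0 \<le> y m" "\<And>m. y m \<le> 2 * s m"
    and "osc x Dx" "osc y Dy" "\<epsilon> > 0"
  shows "osc (conv x y) ((tau x) * Dy + (tau y) * Dx + \<epsilon>)"
proof -
  define A where "A = (\<lambda>K m. \<Sum>i<K. x i * w0^i * (y (m-i) / s (m-i)) + y i * w0^i * (x (m-i) / s (m-i)))"
  obtain K where "\<forall>\<^sub>F m in sequentially. \<bar>conv x y m / s m - A K m\<bar> \<le> \<epsilon> / 2"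
    using conv_approx[of x y "\<epsilon>/2", OF x y] assms(7) unfolding A_def by auto
  then obtain N1 where N1: "\<And>m. m \<ge> N1 \<Longrightarrow> \<bar>conv x y m / s m - A K m\<bar> \<le> \<epsilon> / 2"
    by (auto simp: eventually_at_top_linorder)
  obtain N2 where N2: "\<And>m k. m \<ge> N2 \<Longrightarrow> k \<ge> N2 \<Longrightarrow> \<bar>x m / s m - x k / s k\<bar> \<le> Dx" using assms(5) by (auto simp: osc_def)
  obtain N3 where N3: "\<And>m k. m \<ge> N3 \<Longrightarrow> k \<ge> N3 \<Longrightarrow> \<bar>y m / s m - y k / s k\<bar> \<le> Dy" using assms(6) by (auto simp: osc_def)
  have D: "Dx \<ge> 0" "Dy \<ge> 0" using N2[of N2 N2] N3[of N3 N3] by auto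
  show ?thesis unfolding osc_def
  proof (intro exI[of _ "N1 + N2 + N3 + K"] allI impI)
    fix m k assume mk: "m \<ge> N1 + N2 + N3 + K" "k \<ge> N1 + N2 + N3 + K"
    define ax where "ax = (\<lambda>i. x i * w0^i)" define ay where "ay = (\<lambda>i. y i * w0^i)"
    have axy: "ax i \<ge> 0" "ay i \<ge> 0" for i using x y w0_pos by (auto simp: ax_def ay_def)
    have "A K m - A K k = (\<Sum>i<K. ax i * (y (m-i) / s (m-i) - y (k-i) / s (k-i)) + ay i * (x (m-i) / s (m-i) - x (k-i) / s (k-i)))"
      unfolding A_def ax_def ay_def sum_subtractf[symmetric] by (intro sum.cong) (auto simp: algebra_simps)
    also have "\<bar>\<dots>\<bar> \<le> (\<Sum>i<K. ax i * Dy + ay i * Dx)"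
    proof (rule order_trans[OF sum_abs sum_mono])
      fix i assume i: "i \<in> {..<K}"
      have "\<bar>ax i * (y (m-i) / s (m-i) - y (k-i) / s (k-i))\<bar> \<le> ax i * Dy"
        unfolding abs_mult using axy[of i] N3[of "m-i" "k-i"] mk i by (auto intro!: mult_left_mono)
      moreover have "\<bar>ay i * (x (m-i) / s (m-i) - x (k-i) / s (k-i))\<bar> \<le> ay i * Dx"
        unfolding abs_mult using axy[of i] N2[of "m-i" "k-i"] mk i by (auto intro!: mult_left_mono)
      ultimately show "\<bar>ax i * (y (m-i) / s (m-i) - y (k-i) / s (k-i)) + ay i * (x (m-i) / s (m-i) - x (k-i) / s (k-i))\<bar>
          \<le> ax i * Dy + ay i * Dx" by linarith
    qed
    also have "\<dots> = (\<Sum>i<K. ax i) * Dy + (\<Sum>i<K. ay i) * Dx" by (simp add: sum.distrib sum_distrib_right)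
    also have "\<dots> \<le> (\<Sum>i. ax i) * Dy + (\<Sum>i. ay i) * Dx"
      using summable_le_s[of x, OF x] summable_le_s[of y, OF y] axy D unfolding ax_def[symmetric] ay_def[symmetric]
      by (intro add_mono mult_right_mono sum_le_suminf) auto
    finally have "\<bar>A K m - A K k\<bar> \<le> (\<Sum>i. ax i) * Dy + (\<Sum>i. ay i) * Dx" .
    moreover have "\<bar>conv x y m / s m - A K m\<bar> \<le> \<epsilon> / 2" "\<bar>conv x y k / s k - A K k\<bar> \<le> \<epsilon> / 2" using N1 mk by auto
    ultimately show "\<bar>conv x y m / s m - conv x y k / s k\<bar> \<le> (tau x) * Dy + (tau y) * Dx + \<epsilon>"
      unfolding ax_def ay_def by linarith
  qed
qed

lemma conv_limit:
  assumes x: "\<And>m. 0 \<le> x m" "\<And>m. x m \<le> 2 * s m" and y: "\<And>m. 0 \<le> y m" "\<And>m. y m \<le> 2 * s m"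
    and lx: "(\<lambda>m. x m / s m) \<longlonglongrightarrow> lx" and ly: "(\<lambda>m. y m / s m) \<longlonglongrightarrow> ly"
  shows "(\<lambda>m. conv x y m / s m) \<longlonglongrightarrow> (tau x) * ly + (tau y) * lx"
proof (rule tendstoI)
  fix \<epsilon> :: real assume \<epsilon>: "\<epsilon> > 0"
  define A where "A = (\<lambda>K m. \<Sum>i<K. x i * w0^i * (y (m-i) / s (m-i)) + y i * w0^i * (x (m-i) / s (m-i)))"
  define l where "l = (tau x) * ly + (tau y) * lx"
  have "\<exists>K0. \<forall>K\<ge>K0. \<forall>\<^sub>F m in sequentially. \<bar>conv x y m / s m - A K m\<bar> \<le> \<epsilon> / 4"
    using conv_approx[of x y "\<epsilon>/4", OF x y] \<epsilon> unfolding A_def by auto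
  then obtain K0 where K0: "\<And>K. K \<ge> K0 \<Longrightarrow> \<forall>\<^sub>F m in sequentially. \<bar>conv x y m / s m - A K m\<bar> \<le> \<epsilon> / 4" by auto
  define B where "B = (\<lambda>K. \<Sum>i<K. x i * w0^i * ly + y i * w0^i * lx)"
  have "(\<lambda>K. (\<Sum>i<K. x i * w0^i) * ly + (\<Sum>i<K. y i * w0^i) * lx) \<longlonglongrightarrow> l"
    unfolding l_def by (intro tendsto_intros summable_LIMSEQ summable_le_s x y)
  hence "B \<longlonglongrightarrow> l" by (simp add: B_def sum.distrib sum_distrib_right)
  hence "\<forall>\<^sub>F K in sequentially. dist (B K) l < \<epsilon> / 4" using \<epsilon> by (intro tendstoD) auto
  then obtain K1 where K1: "\<And>K. K \<ge> K1 \<Longrightarrow> dist (B K) l < \<epsilon> / 4"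
    unfolding eventually_at_top_linorder by blast
  define K where "K = max K0 K1"
  have K: "K \<ge> K0" "dist (B K) l < \<epsilon> / 4" using K1 by (auto simp: K_def)
  have "(\<lambda>m. A K m) \<longlonglongrightarrow> B K" unfolding A_def B_def
    by (intro tendsto_intros filterlim_compose[OF lx] filterlim_compose[OF ly] filterlim_minus_const_nat_at_top)
  hence "\<forall>\<^sub>F m in sequentially. dist (A K m) (B K) < \<epsilon> / 4" using \<epsilon> by (intro tendstoD) auto
  with K0[OF K(1)] show "\<forall>\<^sub>F m in sequentially. dist (conv x y m / s m) ((tau x) * ly + (tau y) * lx) < \<epsilon>"
  proof eventually_elim
    case (elim m)
    thus ?case using K(2) \<epsilon> unfolding l_def[symmetric] dist_real_def by linarith
  qed
qed

text \<open>The recursion for \<open>R\<close> contracts oscillations by the factor \<open>3 tau a + tau R\<close>.\<close>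

lemma fixpoint_convergent:
  assumes a: "\<And>m. 0 \<le> a m" "\<And>m. a m \<le> s m" and R: "\<And>m. 0 \<le> R m" "\<And>m. R m \<le> s m"
    and rec: "\<And>m. R m = conv a (\<lambda>k. a k + R k) m"
    and k: "(\<lambda>m. k m / s m) \<longlonglongrightarrow> \<kappa>" and ak: "\<forall>\<^sub>F m in sequentially. a m = k m + \<sigma> * R m" and \<sigma>: "\<bar>\<sigma>\<bar> \<le> 1"
    and q: "3 * (tau a) + (tau R) < 1"
  shows "convergent (\<lambda>m. R m / s m)"
proof -
  define ta tr where "ta = (tau a)" and "tr = (tau R)"
  have a2: "a m \<le> 2 * s m" "R m \<le> 2 * s m" "a m + R m \<le> 2 * s m" for m
    using a(2)[of m] R(2)[of m] s_nonneg[of m] by auto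
  have sa: "summable (\<lambda>i. a i * w0^i)" "summable (\<lambda>i. R i * w0^i)"
    using a R a2 by (auto intro!: summable_le_s)
  have ge: "ta \<ge> 0" "tr \<ge> 0" unfolding ta_def tr_def using a R w0_pos by (auto intro!: suminf_nonneg sa)
  have tar: "(tau (\<lambda>i. a i + R i)) = ta + tr"
    using suminf_add[OF sa] by (simp add: ta_def tr_def distrib_right)
  define q where "q = 3 * ta + tr"
  have q: "0 \<le> q" "q < 1" using ge assms(9) by (auto simp: q_def ta_def tr_def)
  have step: "osc R (q * D + \<epsilon>)" if D: "osc R D" and \<epsilon>: "\<epsilon> > 0" for D \<epsilon>
  proof -
    define \<delta> where "\<delta> = \<epsilon> / 2"
    have \<delta>: "\<delta> > 0" using \<epsilon> by (simp add: \<delta>_def)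
    obtain N1 where N1: "\<And>m k. m \<ge> N1 \<Longrightarrow> k \<ge> N1 \<Longrightarrow> \<bar>R m / s m - R k / s k\<bar> \<le> D" using D by (auto simp: osc_def)
    from tendstoD[OF k, of "\<delta>/2"] \<delta> obtain N2 where N2: "\<And>m. m \<ge> N2 \<Longrightarrow> \<bar>k m / s m - \<kappa>\<bar> < \<delta>/2"
      by (auto simp: eventually_at_top_linorder dist_real_def)
    from ak obtain N3 where N3: "\<And>m. m \<ge> N3 \<Longrightarrow> a m = k m + \<sigma> * R m" by (auto simp: eventually_at_top_linorder)
    have oa: "\<bar>a m / s m - a l / s l\<bar> \<le> D + \<delta>" if "m \<ge> N1 + N2 + N3" "l \<ge> N1 + N2 + N3" for m l
    proof -
      have "a m / s m - a l / s l = (k m / s m - \<kappa>) - (k l / s l - \<kappa>) + \<sigma> * (R m / s m - R l / s l)"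
        using N3 that by (simp add: add_divide_distrib right_diff_distrib)
      moreover have "\<bar>\<sigma> * (R m / s m - R l / s l)\<bar> \<le> 1 * D"
        unfolding abs_mult using N1[of m l] \<sigma> that by (intro mult_mono) auto
      moreover have "\<bar>k m / s m - \<kappa>\<bar> < \<delta>/2" "\<bar>k l / s l - \<kappa>\<bar> < \<delta>/2" using N2 that by auto
      ultimately show ?thesis by linarith
    qed
    have "osc a (D + \<delta>)" unfolding osc_def using oa by blast
    \<comment> \<open>Origin of the factor 3: \<open>a\<close> is a convergent term plus
      \<open>\<sigma>\<close> times \<open>R\<close>, so it oscillates by \<open>D\<close> and
      \<open>a + R\<close> by \<open>2 * D\<close>. The latter is weighted by \<open>ta\<close>, the
      former by \<open>ta + tr\<close>.\<close>
    moreover have "osc (\<lambda>k. a k + R k) (2 * D + \<delta>)" unfolding osc_def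
    proof (intro exI[of _ "N1 + N2 + N3"] allI impI)
      fix m l assume ml: "m \<ge> N1 + N2 + N3" "l \<ge> N1 + N2 + N3"
      have "\<bar>R m / s m - R l / s l\<bar> \<le> D" using N1 ml by simp
      thus "\<bar>(a m + R m) / s m - (a l + R l) / s l\<bar> \<le> 2 * D + \<delta>"
        using oa[OF ml] unfolding add_divide_distrib by linarith
    qed
    ultimately have "osc (conv a (\<lambda>k. a k + R k)) ((tau a) * (2 * D + \<delta>) + (tau (\<lambda>i. a i + R i)) * (D + \<delta>) + \<delta>)"
      by (intro osc_conv a a2 add_nonneg_nonneg R \<delta>)
    hence "osc (conv a (\<lambda>k. a k + R k)) (ta * (2 * D + \<delta>) + (ta + tr) * (D + \<delta>) + \<delta>)"
      by (simp only: tar ta_def[symmetric])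
    moreover have "conv a (\<lambda>k. a k + R k) = R" by (intro ext rec[symmetric])
    moreover have "ta * (2 * D + \<delta>) + (ta + tr) * (D + \<delta>) + \<delta> \<le> q * D + \<epsilon>"
    proof -
      have "(2 * ta + tr) * \<delta> \<le> 1 * \<delta>" using q ge \<delta> by (intro mult_right_mono) (auto simp: q_def)
      moreover have "ta * (2 * D + \<delta>) + (ta + tr) * (D + \<delta>) + \<delta> = q * D + ((2 * ta + tr) * \<delta> + \<delta>)"
        by (simp add: q_def algebra_simps)
      ultimately show ?thesis by (simp add: \<delta>_def)
    qed
    ultimately show ?thesis using osc_mono by simp
  qed
  \<comment> \<open>For \<open>p\<close> strictly between \<open>q\<close> and 1 the gap
    \<open>(p - q) * p^j\<close> pays for the error term in each round.\<close>
  define p where "p = (1 + q) / 2"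
  have p: "0 < p" "p < 1" "q < p" using q by (auto simp: p_def)
  have "osc R (p^j)" for j
  proof (induction j)
    case 0
    show ?case unfolding osc_def
    proof (intro exI allI impI)
      fix m l
      have *: "0 \<le> R m / s m \<and> R m / s m \<le> 1" for m
        using R(1)[of m] R(2)[of m] s_nonneg[of m] by (cases "s m = 0") (auto simp: divide_le_eq_1)
      have "0 \<le> R m / s m" "R m / s m \<le> 1" "0 \<le> R l / s l" "R l / s l \<le> 1" using *[of m] *[of l] by auto
      thus "\<bar>R m / s m - R l / s l\<bar> \<le> p^0" by simp
    qed
  next
    case (Suc j)
    from step[OF this, of "(p - q) * p^j"] p show ?case by (simp add: algebra_simps)
  qed
  hence osc: "osc R (p^j)" for j .
  have "Cauchy (\<lambda>m. R m / s m)"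
  proof (rule metric_CauchyI)
    fix e :: real assume "e > 0"
    then obtain j where j: "p^j < e" using p real_arch_pow_inv by blast
    from osc[of j] obtain N where "\<And>m k. m \<ge> N \<Longrightarrow> k \<ge> N \<Longrightarrow> \<bar>R m / s m - R k / s k\<bar> \<le> p^j" by (auto simp: osc_def)
    thus "\<exists>M. \<forall>m\<ge>M. \<forall>n\<ge>M. dist (R m / s m) (R n / s n) < e" using j by (auto simp: dist_real_def intro: le_less_trans)
  qed
  thus ?thesis by (simp add: Cauchy_convergent_iff)
qed

lemma suminf_fixpoint:
  assumes a: "\<And>m. 0 \<le> a m" "\<And>m. a m \<le> s m" and R: "\<And>m. 0 \<le> R m" "\<And>m. R m \<le> s m"
    and rec: "\<And>m. R m = conv a (\<lambda>k. a k + R k) m"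
  shows "(tau R) = (tau a) * ((tau a) + (tau R))"
proof -
  have a2: "a m \<le> 2 * s m" "R m \<le> 2 * s m" "a m + R m \<le> 2 * s m" for m
    using a(2)[of m] R(2)[of m] s_nonneg[of m] by auto
  have sa: "summable (\<lambda>i. a i * w0^i)" "summable (\<lambda>i. R i * w0^i)" "summable (\<lambda>i. (a i + R i) * w0^i)"
    using a R a2 by (auto intro!: summable_le_s)
  have "(\<lambda>m. conv a (\<lambda>k. a k + R k) m * w0^m) sums ((tau a) * (tau (\<lambda>i. a i + R i)))"
    using a R w0_pos sa by (intro conv_sums) auto
  hence "(\<lambda>m. R m * w0^m) sums ((tau a) * (tau (\<lambda>i. a i + R i)))"
    by (simp only: rec[symmetric])
  thus ?thesis using suminf_add[OF sa(1,2)] by (simp add: sums_iff distrib_right)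
qed

text \<open>The limit is \<open>\<alpha>\<close> times the derivative of
  \<open>t^2 / (1 - t)\<close>, the sum of \<open>t^k\<close> over \<open>k \<ge> 2\<close>. The
  condition \<open>t < s0\<close> makes the contraction apply, with \<open>\<sigma> = 0\<close>
  because the ratios of \<open>a\<close> converge by themselves.\<close>

lemma fixpoint_limit:
  assumes a: "\<And>m. 0 \<le> a m" "\<And>m. a m \<le> s m" and R: "\<And>m. 0 \<le> R m" "\<And>m. R m \<le> s m"
    and rec: "\<And>m. R m = conv a (\<lambda>k. a k + R k) m"
    and la: "(\<lambda>m. a m / s m) \<longlonglongrightarrow> \<alpha>"
    and ta: "(tau a) = t" "t < s0"
  shows "(\<lambda>m. R m / s m) \<longlonglongrightarrow> \<alpha> * (1 / (1 - t)^2 - 1)"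
proof -
  define tr where "tr = (tau R)"
  have a2: "a m \<le> 2 * s m" "R m \<le> 2 * s m" "a m + R m \<le> 2 * s m" for m
    using a(2)[of m] R(2)[of m] s_nonneg[of m] by auto
  have sa: "summable (\<lambda>i. a i * w0^i)" "summable (\<lambda>i. R i * w0^i)"
    using a R a2 by (auto intro!: summable_le_s)
  have t0: "t \<ge> 0" unfolding ta(1)[symmetric] using a w0_pos by (auto intro!: suminf_nonneg sa)
  have tr: "tr = t * (t + tr)" using suminf_fixpoint[of a R, OF a R rec] by (simp add: ta tr_def)
  have t1: "t < 3/10" using ta s0_bounds by simp
  have trt: "tr = t^2 / (1 - t)" using tr t1 by (simp add: field_simps power2_eq_square)
  \<comment> \<open>\<open>s0\<close> and \<open>2 - s0\<close> are the roots of
    \<open>1 - 4 * t + 2 * t^2\<close>, whose positivity is equivalent to the contraction condition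
    \<open>3 * t + t^2 / (1 - t) < 1\<close>.\<close>
  have "0 < 2 * ((s0 - t) * ((2 - s0) - t))" using ta t1 s0_bounds by simp
  also have "\<dots> = 1 - 4 * t + 2 * t^2"
  proof -
    have "2 * (s0 * (2 - s0)) = 1" using s0_eq s0_w0 by algebra
    thus ?thesis by (simp add: power2_eq_square algebra_simps)
  qed
  finally have "t^2 < (1 - 3 * t) * (1 - t)" by (simp add: power2_eq_square algebra_simps)
  hence "t^2 / (1 - t) < 1 - 3 * t" using t1 by (simp add: divide_less_eq)
  hence q: "3 * (tau a) + (tau R) < 1" using trt by (simp add: ta(1) tr_def)
  have "convergent (\<lambda>m. R m / s m)"
    by (rule fixpoint_convergent[of a R a \<alpha> 0, OF a R rec la _ _ q]) auto
  then obtain \<rho> where \<rho>: "(\<lambda>m. R m / s m) \<longlonglongrightarrow> \<rho>" by (auto simp: convergent_def)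
  have "(\<lambda>m. conv a (\<lambda>k. a k + R k) m / s m) \<longlonglongrightarrow> (tau a) * (\<alpha> + \<rho>) + (tau (\<lambda>i. a i + R i)) * \<alpha>"
    using a R a2 by (intro conv_limit la) (auto simp: add_divide_distrib intro!: tendsto_add la \<rho>)
  moreover have "(tau (\<lambda>i. a i + R i)) = t + tr"
    using suminf_add[OF sa] by (simp add: ta tr_def distrib_right)
  ultimately have "(\<lambda>m. R m / s m) \<longlonglongrightarrow> t * (\<alpha> + \<rho>) + (t + tr) * \<alpha>"
    unfolding rec[symmetric] by (simp add: ta(1))
  with \<rho> have e: "\<rho> = t * (\<alpha> + \<rho>) + (t + tr) * \<alpha>" by (rule LIMSEQ_unique)
  have "\<rho> = \<alpha> * (1 / (1 - t)^2 - 1)"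
  proof -
    define v where "v = 1 - t"
    have v: "v > 0" "t = 1 - v" using t1 by (auto simp: v_def)
    have "tr * v = t * t" using tr unfolding v_def by (simp add: algebra_simps)
    moreover have "\<rho> * v = (2 * t + tr) * \<alpha>" using e unfolding v_def by (simp add: algebra_simps)
    ultimately have "\<rho> * v * v = (2 * t * v + t * t) * \<alpha>" by algebra
    also have "2 * t * v + t * t = 1 - v * v" unfolding v(2) by (simp add: algebra_simps)
    finally have "\<rho> = (1 - v * v) * \<alpha> / (v * v)" using v(1) by (simp add: field_simps)
    thus ?thesis using v(1) unfolding v_def[symmetric] by (simp add: field_simps power2_eq_square)
  qed
  thus ?thesis using \<rho> by simp
qed

text \<open>The sums of \<open>m * s m * w0^m\<close> diverge, so finitely many indices do not
  count: if the ratio tends to \<open>l\<close>, the sums built from \<open>g\<close> eventually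
  exceed those built from \<open>s\<close> times any number below the absolute value of
  \<open>l\<close>. Only averages of \<open>g\<close> are controlled, hence the assumption that the
  limit exists.\<close>

lemma abel_comparison:
  assumes l: "(\<lambda>m. e m / s m) \<longlonglongrightarrow> l"
    and er: "\<And>m. m \<ge> 3 \<Longrightarrow> \<bar>e m\<bar> \<le> g m" and g: "\<And>m. 0 \<le> g m"
    and bnd: "\<forall>\<^sub>F M in sequentially. (\<Sum>m\<le>M. real m * g m * w0^m) \<le> c * (\<Sum>m\<le>M. real m * s m * w0^m)"
  shows "\<bar>l\<bar> \<le> c"
proof (rule field_le_epsilon)
  fix \<delta> :: real assume \<delta>: "\<delta> > 0"
  define D where "D = (\<lambda>M. \<Sum>m\<le>M. real m * s m * w0^m)"
  from tendstoD[OF l, of "\<delta>/2"] \<delta> obtain N where N: "\<And>m. m \<ge> N \<Longrightarrow> \<bar>e m / s m - l\<bar> < \<delta>/2"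
    by (auto simp: eventually_at_top_linorder dist_real_def)
  define N' where "N' = N + 3"
  define b where "b = \<bar>l\<bar> - \<delta>/2"
  have rb: "g m \<ge> b * s m" if "m \<ge> N'" for m
  proof -
    have sm: "s m > 0" using that s_pos by (simp add: N'_def)
    have "b \<le> \<bar>e m / s m\<bar>" using N[of m] that unfolding b_def N'_def by linarith
    hence "b * s m \<le> \<bar>e m\<bar>" using sm by (simp add: field_simps)
    thus ?thesis using er[of m] that by (simp add: N'_def)
  qed
  have lim: "filterlim D at_top sequentially" unfolding D_def by (rule weighted_sum_at_top)
  have "\<forall>\<^sub>F M in sequentially. D M \<ge> max 1 (2 * \<bar>b\<bar> * D N' / \<delta>)"
    using lim unfolding filterlim_at_top by blast
  moreover have "\<forall>\<^sub>F M in sequentially. M \<ge> N'" by (rule eventually_ge_at_top)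
  ultimately have "\<forall>\<^sub>F M in sequentially. b - c \<le> \<delta>/2" using bnd
  proof eventually_elim
    case (elim M)
    have D1: "D M \<ge> 1" "\<bar>b\<bar> * D N' \<le> \<delta>/2 * D M" using elim \<delta> by (auto simp: field_simps)
    have D0: "D N' \<ge> 0" unfolding D_def using s_nonneg w0_pos by (auto intro!: sum_nonneg)
    have "b * (D M - D N') = (\<Sum>m\<in>{N'<..M}. real m * (b * s m) * w0^m)"
    proof -
      have "{..M} = {..N'} \<union> {N'<..M}" using elim by auto
      hence "D M = D N' + (\<Sum>m\<in>{N'<..M}. real m * s m * w0^m)"
        unfolding D_def by (simp only:) (subst sum.union_disjoint; auto)
      thus ?thesis by (simp add: sum_distrib_left mult.assoc mult.left_commute)
    qed
    also have "\<dots> \<le> (\<Sum>m\<in>{N'<..M}. real m * g m * w0^m)"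
      using rb w0_pos by (intro sum_mono mult_right_mono mult_left_mono) auto
    also have "\<dots> \<le> (\<Sum>m\<le>M. real m * g m * w0^m)" using g w0_pos by (intro sum_mono2) auto
    also have "\<dots> \<le> c * D M" using elim by (simp add: D_def)
    finally have "(b - c) * D M \<le> b * D N'" by (simp add: algebra_simps)
    also have "\<dots> \<le> \<bar>b\<bar> * D N'" using D0 by (intro mult_right_mono) auto
    also have "\<dots> \<le> \<delta>/2 * D M" by (fact D1)
    finally show ?case using D1(1) by (simp add: mult_le_cancel_right)
  qed
  hence "b - c \<le> \<delta>/2" by simp
  thus "\<bar>l\<bar> \<le> c + \<delta>" by (simp add: b_def)
qed

end

section \<open>Counting trees, and existence of the limits\<close>

fun opp :: "connective \<Rightarrow> connective" where
  "opp Conj = Disj" | "opp Disj = Conj"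

text \<open>The neutral value of \<open>c\<close>, in terms of which \<open>eval_Node\<close> treats
  both connectives alike.\<close>

definition val :: "connective \<Rightarrow> bool" where "val c \<longleftrightarrow> c = Conj"

lemma opp_opp [simp]: "opp (opp c) = c" by (cases c) auto
lemma opp_neq [simp]: "opp c \<noteq> c" "c \<noteq> opp c" by (cases c; simp)+
lemma neq_iff_opp: "c \<noteq> d \<longleftrightarrow> c = opp d" by (cases c; cases d) auto
lemma val_opp [simp]: "val (opp c) \<longleftrightarrow> \<not> val c" by (cases c) (auto simp: val_def)

lemma eval_Node: "tree_eval a (Node c ts) = val c \<longleftrightarrow> (\<forall>t\<in>set ts. tree_eval a t = val c)"
  by (cases c) (auto simp: val_def)

fun negl :: "literal \<Rightarrow> literal" where
  "negl (Pos i) = Neg i" | "negl (Neg i) = Pos i"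

lemma negl_negl [simp]: "negl (negl l) = l" by (cases l) auto
lemma lit_var_negl [simp]: "lit_var (negl l) = lit_var l" by (cases l) auto
lemma lit_eval_negl [simp]: "lit_eval a (negl l) \<longleftrightarrow> \<not> lit_eval a l" by (cases l) auto
lemma negl_neq [simp]: "negl l \<noteq> l" "l \<noteq> negl l" by (cases l; simp)+

fun star :: "atree \<Rightarrow> atree" where
  "star (Leaf l) = Leaf (negl l)"
| "star (Node c ts) = Node (opp c) (map star ts)"

lemma star_star [simp]: "star (star t) = t"
  by (induction t rule: star.induct) (auto intro: map_idI)

lemma root_label_star [simp]: "root_label (star t) = map_option opp (root_label t)"
  by (cases t) auto

lemma assoc_tree_star [simp]: "assoc_tree n (star t) \<longleftrightarrow> assoc_tree n t"
proof (induction t rule: star.induct)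
  case (2 c ts)
  have "root_label (star t) \<noteq> Some (opp c) \<longleftrightarrow> root_label t \<noteq> Some c" for t
    by (cases t) (auto, metis opp_opp)
  thus ?case using 2 by auto
qed auto

lemma leaves_star [simp]: "leaves (star t) = leaves t"
  by (induction t rule: star.induct) (auto intro!: arg_cong[of _ _ sum_list] simp: o_def)

lemma eval_star [simp]: "tree_eval a (star t) \<longleftrightarrow> \<not> tree_eval a t"
proof (induction t rule: star.induct)
  case (2 c ts)
  thus ?case by (cases c) auto
qed auto

definition lsize :: "atree list \<Rightarrow> nat" where "lsize ts = sum_list (map leaves ts)"

lemma lsize_simps [simp]: "lsize [] = 0" "lsize (t # ts) = leaves t + lsize ts" "lsize (xs @ ys) = lsize xs + lsize ys"
  by (auto simp: lsize_def)

lemma leaves_Node: "leaves (Node c ts) = lsize ts" by (simp add: lsize_def)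

lemma leaves_pos: "assoc_tree n t \<Longrightarrow> leaves t \<ge> 1"
proof (induction t rule: leaves.induct)
  case (2 c ts)
  then obtain t us where ts: "ts = t # us" by (cases ts) auto
  hence "leaves t \<ge> 1" using 2 by simp
  thus ?case using ts by simp
qed auto

lemma length_le_lsize:
  assumes "\<And>t. t \<in> set ts \<Longrightarrow> assoc_tree n t" shows "length ts \<le> lsize ts"
  using assms
proof (induction ts)
  case (Cons t ts)
  from Cons.prems[of t] leaves_pos[of n t] Cons show ?case by fastforce
qed auto

lemma leaves_le_lsize: "t \<in> set ts \<Longrightarrow> leaves t \<le> lsize ts"
  by (induction ts) auto

lemma leaves_less_lsize:
  assumes "\<And>t. t \<in> set ts \<Longrightarrow> assoc_tree n t" "length ts \<ge> 2" "t \<in> set ts"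
  shows "leaves t < lsize ts"
proof -
  obtain xs ys where ts: "ts = xs @ t # ys" using assms(3) by (meson split_list)
  have "length xs \<le> lsize xs" "length ys \<le> lsize ys" using assms(1) ts by (auto intro!: length_le_lsize)
  moreover have "length xs + length ys \<ge> 1" using assms(2) ts by auto
  ultimately show ?thesis unfolding ts by simp linarith
qed

definition lits :: "nat \<Rightarrow> literal set" where "lits n = {l. lit_var l \<in> {1..n}}"

lemma lits_eq: "lits n = Pos ` {1..n} \<union> Neg ` {1..n}"
proof -
  have "l \<in> Pos ` {1..n} \<union> Neg ` {1..n}" if "l \<in> lits n" for l using that by (cases l) (auto simp: lits_def)
  thus ?thesis by (auto simp: lits_def)
qed

lemma finite_lits [simp]: "finite (lits n)" by (simp add: lits_eq)

lemma card_lits: "card (lits n) = 2 * n"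
  unfolding lits_eq by (subst card_Un_disjoint) (auto simp: card_image inj_on_def)

lemma negl_lits [simp]: "negl l \<in> lits n \<longleftrightarrow> l \<in> lits n" by (simp add: lits_def)

lemma finite_trees: "finite {t. assoc_tree n t \<and> leaves t \<le> m}"
proof (induction m)
  case 0
  have "{t. assoc_tree n t \<and> leaves t \<le> 0} = {}" using leaves_pos by fastforce
  thus ?case by (metis finite.emptyI)
next
  case (Suc m)
  let ?A = "{t. assoc_tree n t \<and> leaves t \<le> m}"
  let ?L = "{ts. set ts \<subseteq> ?A \<and> length ts \<le> Suc m}"
  have "finite ?L" by (rule finite_lists_length_le[OF Suc])
  moreover have "{t. assoc_tree n t \<and> leaves t \<le> Suc m} \<subseteq> Leaf ` lits n \<union> (Node Conj ` ?L \<union> Node Disj ` ?L)"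
  proof
    fix t assume t: "t \<in> {t. assoc_tree n t \<and> leaves t \<le> Suc m}"
    show "t \<in> Leaf ` lits n \<union> (Node Conj ` ?L \<union> Node Disj ` ?L)"
    proof (cases t)
      case (Leaf l) thus ?thesis using t by (auto simp: lits_def)
    next
      case (Node c ts)
      have a: "assoc_tree n u" if "u \<in> set ts" for u using t Node that by auto
      have "lsize ts \<le> Suc m" using t Node by (simp add: lsize_def)
      moreover have "leaves u < lsize ts" if "u \<in> set ts" for u
        using leaves_less_lsize[of ts n u] a that t Node by auto
      ultimately have "ts \<in> ?L" using a length_le_lsize[of ts n] by fastforce
      thus ?thesis using Node by (cases c) auto
    qed
  qed
  ultimately show ?case by (meson finite_UnI finite_imageI finite_lits finite_subset)
qed

section \<open>Counting trees and lists of children by size\<close>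

definition num :: "atree set \<Rightarrow> nat \<Rightarrow> nat" where "num A m = card {t \<in> A. leaves t = m}"

definition num_lists :: "atree set \<Rightarrow> nat \<Rightarrow> nat" where
  "num_lists A m = card {ts. set ts \<subseteq> A \<and> 2 \<le> length ts \<and> lsize ts = m}"

lemma finite_num: "A \<subseteq> Collect (assoc_tree n) \<Longrightarrow> finite {t \<in> A. leaves t = m}"
  by (rule finite_subset[OF _ finite_trees[of n m]]) auto

lemma finite_lists:
  assumes "A \<subseteq> Collect (assoc_tree n)" shows "finite {ts. set ts \<subseteq> A \<and> lsize ts \<le> m}"
proof (rule finite_subset)
  show "{ts. set ts \<subseteq> A \<and> lsize ts \<le> m} \<subseteq> {ts. set ts \<subseteq> {t. assoc_tree n t \<and> leaves t \<le> m} \<and> length ts \<le> m}"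
  proof clarify
    fix ts assume ts: "set ts \<subseteq> A" "m \<ge> lsize ts"
    have "length ts \<le> lsize ts" using ts assms by (intro length_le_lsize[of _ n]) auto
    moreover have "leaves t \<le> lsize ts" if "t \<in> set ts" for t using that by (rule leaves_le_lsize)
    ultimately show "set ts \<subseteq> {t. assoc_tree n t \<and> leaves t \<le> m} \<and> length ts \<le> m"
      using ts assms by fastforce
  qed
qed (intro finite_lists_length_le finite_trees)

lemma num_lists_mono: "A \<subseteq> B \<Longrightarrow> B \<subseteq> Collect (assoc_tree n) \<Longrightarrow> num_lists A m \<le> num_lists B m"
  unfolding num_lists_def by (intro card_mono finite_subset[OF _ finite_lists[of B n m]]) auto

lemma num_mono: "A \<subseteq> B \<Longrightarrow> B \<subseteq> Collect (assoc_tree n) \<Longrightarrow> num A m \<le> num B m"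
  unfolding num_def by (intro card_mono finite_num) auto

lemma num_zero: "A \<subseteq> Collect (assoc_tree n) \<Longrightarrow> num A 0 = 0"
proof -
  assume A: "A \<subseteq> Collect (assoc_tree n)"
  have "leaves t \<noteq> 0" if "t \<in> A" for t using leaves_pos[of n t] that A by auto
  hence "{t \<in> A. leaves t = 0} = {}" by blast
  thus ?thesis unfolding num_def by (metis card.empty)
qed

lemma num_star: "num (star ` A) m = num A m"
proof -
  have "{t \<in> star ` A. leaves t = m} = star ` {t \<in> A. leaves t = m}" by auto
  moreover have "inj_on star X" for X by (metis inj_onI star_star)
  ultimately show ?thesis by (simp add: num_def card_image)
qed

lemma lsize_map_star: "lsize (map star ts) = lsize ts"
  by (simp add: lsize_def o_def)

lemma num_lists_star: "num_lists (star ` A) m = num_lists A m"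
proof -
  have "{ts. set ts \<subseteq> star ` A \<and> 2 \<le> length ts \<and> lsize ts = m} = map star ` {ts. set ts \<subseteq> A \<and> 2 \<le> length ts \<and> lsize ts = m}"
  proof (intro set_eqI iffI)
    fix ts assume ts: "ts \<in> {ts. set ts \<subseteq> star ` A \<and> 2 \<le> length ts \<and> lsize ts = m}"
    hence "map star ts \<in> {ts. set ts \<subseteq> A \<and> 2 \<le> length ts \<and> lsize ts = m}"
      by (auto simp: lsize_map_star)
    moreover have "ts = map star (map star ts)" by (simp add: o_def)
    ultimately show "ts \<in> map star ` {ts. set ts \<subseteq> A \<and> 2 \<le> length ts \<and> lsize ts = m}" by blast
  qed (auto simp: lsize_map_star intro!: imageI)
  moreover have "inj_on (map star) X" for X
    by (rule inj_on_mapI) (metis inj_onI star_star)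
  ultimately show ?thesis by (simp add: num_lists_def card_image)
qed

lemma num_lists_rec:
  assumes A: "A \<subseteq> Collect (assoc_tree n)"
  shows "num_lists A m = (\<Sum>i\<le>m. num A i * (num A (m - i) + num_lists A (m - i)))"
proof -
  let ?E = "\<lambda>k. {ts. set ts \<subseteq> A \<and> ts \<noteq> [] \<and> lsize ts = k}"
  let ?T = "\<lambda>i. {t \<in> A. leaves t = i}"
  have finE: "finite (?E k)" for k by (rule finite_subset[OF _ finite_lists[OF A, of k]]) auto
  have E: "card (?E k) = num A k + num_lists A k" for k
  proof -
    have "?E k = (\<lambda>t. [t]) ` ?T k \<union> {ts. set ts \<subseteq> A \<and> 2 \<le> length ts \<and> lsize ts = k}"
    proof (intro set_eqI iffI)
      fix ts assume ts: "ts \<in> ?E k"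
      then obtain t us where "ts = t # us" by (cases ts) auto
      thus "ts \<in> (\<lambda>t. [t]) ` ?T k \<union> {ts. set ts \<subseteq> A \<and> 2 \<le> length ts \<and> lsize ts = k}"
        using ts by (cases us) auto
    qed auto
    moreover have "finite {ts. set ts \<subseteq> A \<and> 2 \<le> length ts \<and> lsize ts = k}"
      by (rule finite_subset[OF _ finite_lists[OF A, of k]]) auto
    moreover have "card ((\<lambda>t. [t]) ` ?T k) = num A k" by (simp add: num_def card_image inj_on_def)
    moreover have "finite ((\<lambda>t. [t]) ` ?T k)" using finite_num[OF A] by simp
    moreover have "(\<lambda>t. [t]) ` ?T k \<inter> {ts. set ts \<subseteq> A \<and> 2 \<le> length ts \<and> lsize ts = k} = {}" by auto
    ultimately show ?thesis unfolding num_lists_def by (simp add: card_Un_disjoint)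
  qed
  have "{ts. set ts \<subseteq> A \<and> 2 \<le> length ts \<and> lsize ts = m} = (\<Union>i\<in>{..m}. (\<lambda>(t,us). t # us) ` (?T i \<times> ?E (m - i)))"
  proof (intro set_eqI iffI)
    fix ts assume ts: "ts \<in> {ts. set ts \<subseteq> A \<and> 2 \<le> length ts \<and> lsize ts = m}"
    then obtain t us where tu: "ts = t # us" "us \<noteq> []" by (cases ts; cases "tl ts") auto
    hence "ts \<in> (\<lambda>(t,us). t # us) ` (?T (leaves t) \<times> ?E (m - leaves t))" "leaves t \<le> m" using ts by auto
    thus "ts \<in> (\<Union>i\<in>{..m}. (\<lambda>(t,us). t # us) ` (?T i \<times> ?E (m - i)))" by blast
  next
    fix ts assume "ts \<in> (\<Union>i\<in>{..m}. (\<lambda>(t,us). t # us) ` (?T i \<times> ?E (m - i)))"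
    thus "ts \<in> {ts. set ts \<subseteq> A \<and> 2 \<le> length ts \<and> lsize ts = m}"
      by (auto simp: Suc_le_eq)
  qed
  hence "num_lists A m = card (\<Union>i\<in>{..m}. (\<lambda>(t,us). t # us) ` (?T i \<times> ?E (m - i)))"
    by (simp add: num_lists_def)
  also have "\<dots> = (\<Sum>i\<le>m. card ((\<lambda>(t,us). t # us) ` (?T i \<times> ?E (m - i))))"
    by (rule card_UN_disjoint) (auto intro!: finite_imageI finite_cartesian_product finite_num[OF A] finE)
  also have "\<dots> = (\<Sum>i\<le>m. num A i * (num A (m - i) + num_lists A (m - i)))"
  proof (intro sum.cong refl)
    fix i
    have "card ((\<lambda>(t,us). t # us) ` (?T i \<times> ?E (m - i))) = card (?T i \<times> ?E (m - i))"
      by (rule card_image) (auto simp: inj_on_def)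
    thus "card ((\<lambda>(t,us). t # us) ` (?T i \<times> ?E (m - i))) = num A i * (num A (m - i) + num_lists A (m - i))"
      unfolding card_cartesian_product E by (simp add: num_def)
  qed
  finally show ?thesis .
qed

text \<open>The admissible children of a node labelled \<open>c\<close>: leaves and trees with root
  \<open>opp c\<close>.\<close>

definition cls :: "nat \<Rightarrow> connective \<Rightarrow> atree set" where
  "cls n c = {t. assoc_tree n t \<and> root_label t \<noteq> Some c}"

lemma cls_assoc: "cls n c \<subseteq> Collect (assoc_tree n)" by (auto simp: cls_def)

lemma Leaf_cls [simp]: "Leaf l \<in> cls n c \<longleftrightarrow> l \<in> lits n" by (simp add: cls_def lits_def)

lemma Node_cls [simp]: "Node d ts \<in> cls n c \<longleftrightarrow> d = opp c \<and> 2 \<le> length ts \<and> set ts \<subseteq> cls n d"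
  by (auto simp: cls_def neq_iff_opp[symmetric])

lemma star_cls: "star ` cls n c = cls n (opp c)"
proof -
  have *: "star t \<in> cls n (opp c)" if "t \<in> cls n c" for t c
    using that by (cases t) (auto simp: cls_def root_label_star dest: arg_cong[of "opp _" "opp _" opp])
  show ?thesis
  proof (intro set_eqI iffI)
    fix t assume "t \<in> cls n (opp c)"
    hence "star t \<in> cls n c" using *[of t "opp c"] by simp
    thus "t \<in> star ` cls n c" by (metis imageI star_star)
  qed (use * in auto)
qed

text \<open>\<open>(2 * n) ^ m\<close> is the number of leaf labellings of a shape of size
  \<open>m\<close>. Dividing by it makes the sequences of the full classes independent of
  \<open>n\<close>, with their singularity at \<open>w0\<close>.\<close>

definition nrm :: "nat \<Rightarrow> atree set \<Rightarrow> nat \<Rightarrow> real" where "nrm n A m = real (num A m) / real (2 * n) ^ m"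
definition nrml :: "nat \<Rightarrow> atree set \<Rightarrow> nat \<Rightarrow> real" where "nrml n A m = real (num_lists A m) / real (2 * n) ^ m"

lemma nrm_nonneg: "0 \<le> nrm n A m" "0 \<le> nrml n A m" by (simp_all add: nrm_def nrml_def)

lemma nrml_rec:
  assumes "A \<subseteq> Collect (assoc_tree k)"
  shows "nrml n A m = conv (nrm n A) (\<lambda>k. nrm n A k + nrml n A k) m"
proof -
  have "nrml n A m = (\<Sum>i\<le>m. real (num A i) * (real (num A (m-i)) + real (num_lists A (m-i))) / real (2 * n) ^ m)"
    unfolding nrml_def by (subst num_lists_rec[OF assms]) (simp add: sum_divide_distrib)
  also have "\<dots> = conv (nrm n A) (\<lambda>k. nrm n A k + nrml n A k) m"
    unfolding conv_def
  proof (intro sum.cong refl)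
    fix i assume "i \<in> {..m}"
    hence "N ^ m = N ^ i * N ^ (m - i)" for N :: real by (simp add: power_add[symmetric])
    from this[of "real (2 * n)"]
    show "real (num A i) * (real (num A (m-i)) + real (num_lists A (m-i))) / real (2 * n) ^ m =
       nrm n A i * (nrm n A (m - i) + nrml n A (m - i))"
      unfolding nrm_def nrml_def by (simp only: add_divide_distrib[symmetric] times_divide_times_eq)
  qed
  finally show ?thesis .
qed

locale trees =
  fixes n :: nat
  assumes n_pos: "n \<ge> 1"
begin

abbreviation s :: "nat \<Rightarrow> real" where "s \<equiv> nrm n (cls n Conj)"
abbreviation r :: "nat \<Rightarrow> real" where "r \<equiv> nrml n (cls n Conj)"

lemma num_cls: "num (cls n c) = num (cls n Conj)" "num_lists (cls n c) = num_lists (cls n Conj)"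
  using star_cls[of n Conj] num_star[of "cls n Conj"] num_lists_star[of "cls n Conj"] by (cases c; force)+

lemma num_value_lists:
  assumes A: "A = {t \<in> cls n c. P t}" and B: "B \<subseteq> cls n (opp c)"
    and P: "\<And>ts. 2 \<le> length ts \<Longrightarrow> set ts \<subseteq> cls n (opp c) \<Longrightarrow> P (Node (opp c) ts) \<longleftrightarrow> set ts \<subseteq> B"
  shows "num A m = (if m = 1 then card {l \<in> lits n. P (Leaf l)} else 0) + num_lists B m"
proof -
  have "{t \<in> A. leaves t = m} = (if m = 1 then Leaf ` {l \<in> lits n. P (Leaf l)} else {}) \<union> Node (opp c) ` {ts. set ts \<subseteq> B \<and> 2 \<le> length ts \<and> lsize ts = m}"
    (is "?L = ?R1 \<union> ?R2")
  proof (intro set_eqI iffI)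
    fix t assume t: "t \<in> ?L"
    show "t \<in> ?R1 \<union> ?R2"
    proof (cases t)
      case (Leaf l) thus ?thesis using t A by auto
    next
      case (Node d ts) thus ?thesis using t P[of ts] unfolding A by (auto simp: leaves_Node simp del: leaves.simps)
    qed
  next
    fix t assume t: "t \<in> ?R1 \<union> ?R2"
    thus "t \<in> ?L"
    proof
      assume "t \<in> ?R2"
      thus ?thesis using P B unfolding A by (auto simp: leaves_Node simp del: leaves.simps)
    qed (auto simp: A split: if_splits)
  qed
  moreover have "finite {ts. set ts \<subseteq> B \<and> 2 \<le> length ts \<and> lsize ts = m}"
    by (rule finite_subset[OF _ finite_lists[of B n m]]) (use B cls_assoc in auto)
  moreover have "?R1 \<inter> ?R2 = {}" by auto
  ultimately show ?thesis unfolding num_def num_lists_def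
    by (simp add: card_Un_disjoint card_image inj_on_def)
qed

sublocale schroeder s r
proof
  show "s 0 = 0" using num_zero[OF cls_assoc] by (simp add: nrm_def)
  fix m
  have "num (cls n Conj) m = (if m = 1 then card (lits n) else 0) + num_lists (cls n (opp Conj)) m"
    using num_value_lists[of "cls n Conj" Conj "\<lambda>_. True" "cls n (opp Conj)" m] by simp
  hence "s m = (if m = 1 then 1 else 0) + real (num_lists (cls n (opp Conj)) m) / real (2 * n) ^ m"
    using n_pos by (simp add: nrm_def card_lits add_divide_distrib)
  thus "s m = (if m = 1 then 1 else 0) + r m" using num_cls(2)[of "opp Conj"] by (simp add: nrml_def)
  show "r m = conv s (\<lambda>k. s k + r k) m" by (rule nrml_rec[OF cls_assoc])
  show "0 \<le> s m" "0 \<le> r m" by (rule nrm_nonneg)+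
qed

definition T :: "connective \<Rightarrow> (nat \<Rightarrow> bool) set \<Rightarrow> (nat \<Rightarrow> bool) set \<Rightarrow> atree set" where
  "T c G1 G0 = {t \<in> cls n c. (\<forall>a\<in>G1. tree_eval a t) \<and> (\<forall>a\<in>G0. \<not> tree_eval a t)}"

lemma T_cls: "T c G1 G0 \<subseteq> cls n c" by (auto simp: T_def)

lemma T_assoc: "T c G1 G0 \<subseteq> Collect (assoc_tree n)" using T_cls cls_assoc by fast

lemma star_T: "star ` T c G1 G0 = T (opp c) G0 G1"
proof -
  have "star t \<in> T (opp c) G0 G1" if "t \<in> T c G1 G0" for t c G1 G0
    using that star_cls[of n c] by (auto simp: T_def)
  note 1 = this and 2 = this[of _ "opp c" G0 G1]
  show ?thesis
  proof (intro set_eqI iffI)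
    fix t assume "t \<in> T (opp c) G0 G1"
    from 2[OF this] show "t \<in> star ` T c G1 G0" by (metis imageI star_star opp_opp)
  qed (use 1 in auto)
qed

lemma nrm_le_s: "A \<subseteq> cls n Conj \<Longrightarrow> nrm n A m \<le> s m"
  unfolding nrm_def using num_mono[OF _ cls_assoc, of A n Conj m] by (simp add: divide_right_mono)

lemma r_le_s: "r m \<le> s m" using s_r[of m] by simp

lemma nrml_le_r: "A \<subseteq> cls n Conj \<Longrightarrow> nrml n A m \<le> r m"
  unfolding nrml_def using num_lists_mono[OF _ cls_assoc, of A n Conj m] by (simp add: divide_right_mono)

text \<open>The missing leaf loses the weight \<open>w0 / (2 n)\<close>. Since
  \<open>3 * s0 + (s0 - w0) = 1\<close> by \<open>s0_w0\<close>, any such loss brings the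
  contraction factor of \<open>fixpoint_convergent\<close> below 1.\<close>

lemma suminf_nrm_less:
  assumes A: "A \<subseteq> cls n Conj" and l: "l \<in> lits n" "Leaf l \<notin> A"
  shows "(tau (nrm n A)) + (1 / real (2 * n)) * w0 \<le> s0"
proof -
  have "nrm n A 1 + 1 / real (2 * n) \<le> s 1"
  proof -
    have "{t \<in> A. leaves t = 1} \<subset> {t \<in> cls n Conj. leaves t = 1}" using A l by auto
    hence "num A 1 < num (cls n Conj) 1"
      unfolding num_def by (intro psubset_card_mono finite_num[OF cls_assoc])
    hence "real (num A 1) + 1 \<le> real (num (cls n Conj) 1)" by simp
    hence "(real (num A 1) + 1) / real (2 * n) \<le> real (num (cls n Conj) 1) / real (2 * n)" by (rule divide_right_mono) simp
    thus ?thesis by (simp add: nrm_def add_divide_distrib)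
  qed
  hence 1: "nrm n A i + (if i = 1 then 1 / real (2 * n) else 0) \<le> s i" for i
    using nrm_le_s[OF A] by simp
  have sa: "summable (\<lambda>i. nrm n A i * w0^i)"
  proof (intro summable_le_s nrm_nonneg)
    show "nrm n A m \<le> 2 * s m" for m using nrm_le_s[OF A, of m] s_nonneg[of m] by linarith
  qed
  have S1: "(\<lambda>i. nrm n A i * w0^i + (if i = 1 then (1 / real (2 * n)) * w0 else 0)) sums ((tau (nrm n A)) + (1 / real (2 * n)) * w0)"
    using sums_single[of 1 "\<lambda>_. (1 / real (2 * n)) * w0"] summable_sums[OF sa] by (intro sums_add) auto
  have S2: "nrm n A i * w0^i + (if i = 1 then (1 / real (2 * n)) * w0 else 0) \<le> s i * w0^i" for i
  proof -
    have "nrm n A i * w0^i + (if i = 1 then (1 / real (2 * n)) * w0 else 0) = (nrm n A i + (if i = 1 then 1 / real (2 * n) else 0)) * w0^i"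
      by (simp add: distrib_right)
    thus ?thesis using 1[of i] w0_pos by (simp add: mult_right_mono)
  qed
  have "(tau (nrm n A)) + (1 / real (2 * n)) * w0 \<le> (tau s)"
    by (rule sums_le[OF S2 S1 summable_sums[OF summable_s]])
  thus ?thesis by (simp add: suminf_s)
qed

lemma suminf_nrml_le:
  assumes A: "A \<subseteq> cls n Conj"
  shows "(tau (nrml n A)) \<le> s0 - w0"
proof -
  have le: "nrml n A i * w0^i \<le> r i * w0^i" for i using nrml_le_r[OF A] w0_pos by (simp add: mult_right_mono)
  have "summable (\<lambda>i. nrml n A i * w0^i)"
    by (rule summable_comparison_test'[OF summable_r, of 0]) (use le w0_pos nrm_nonneg in simp)
  hence "(tau (nrml n A)) \<le> (tau r)" by (intro suminf_le le summable_r)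
  thus ?thesis using suminf_r_le by simp
qed

abbreviation cv :: "(nat \<Rightarrow> real) \<Rightarrow> bool" where "cv x \<equiv> convergent (\<lambda>m. x m / s m)"

text \<open>A tree true on \<open>G1\<close> is either true or false at \<open>g\<close>. So moving
  \<open>g\<close> from the true side to the false side flips the sign of the count, up to a count
  for a smaller union, which converges by assumption. Modulo convergent ratios, all classes with the
  same union agree up to sign.\<close>

lemma T_reduce:
  assumes "finite G1" "finite G0" "G1 \<inter> G0 = {}"
    "\<And>H1 H0. finite H1 \<Longrightarrow> finite H0 \<Longrightarrow> H1 \<inter> H0 = {} \<Longrightarrow> card (H1 \<union> H0) < card (G1 \<union> G0) \<Longrightarrow> cv (nrm n (T Conj H1 H0))"
  shows "\<exists>x. cv x \<and> (\<forall>m. nrm n (T Conj G1 G0) m = x m + (-1) ^ card G1 * nrm n (T Conj {} (G1 \<union> G0)) m)"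
  using assms
proof (induction G1 arbitrary: G0 rule: finite_induct)
  case empty
  show ?case by (intro exI[of _ "\<lambda>_. 0"]) (simp add: convergent_const)
next
  case (insert g G1)
  have un: "insert g G1 \<union> G0 = G1 \<union> insert g G0" by auto
  have "\<exists>x. cv x \<and> (\<forall>m. nrm n (T Conj G1 (insert g G0)) m = x m + (-1) ^ card G1 * nrm n (T Conj {} (G1 \<union> insert g G0)) m)"
  proof (rule insert.IH)
    show "finite (insert g G0)" "G1 \<inter> insert g G0 = {}" using insert.hyps(2) insert.prems(1,2) by auto
    show "cv (nrm n (T Conj H1 H0))" if "finite H1" "finite H0" "H1 \<inter> H0 = {}" "card (H1 \<union> H0) < card (G1 \<union> insert g G0)" for H1 H0
      using that insert.prems(3)[of H1 H0] by (simp add: un)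
  qed
  then obtain x where x: "cv x" "\<And>m. nrm n (T Conj G1 (insert g G0)) m = x m + (-1) ^ card G1 * nrm n (T Conj {} (G1 \<union> insert g G0)) m"
    by auto
  have "card (G1 \<union> G0) < card (insert g G1 \<union> G0)"
  proof (rule psubset_card_mono)
    show "finite (insert g G1 \<union> G0)" using insert.hyps(1) insert.prems(1) by simp
    show "G1 \<union> G0 \<subset> insert g G1 \<union> G0" using insert.hyps(2) insert.prems(2) by blast
  qed
  hence y: "cv (nrm n (T Conj G1 G0))"
    using insert.hyps(1) insert.prems(1,2) by (intro insert.prems(3)) auto
  have split: "nrm n (T Conj G1 G0) m = nrm n (T Conj (insert g G1) G0) m + nrm n (T Conj G1 (insert g G0)) m" for m
  proof -
    have "{t \<in> T Conj G1 G0. leaves t = m} = {t \<in> T Conj (insert g G1) G0. leaves t = m} \<union> {t \<in> T Conj G1 (insert g G0). leaves t = m}"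
      by (auto simp: T_def)
    moreover have "{t \<in> T Conj (insert g G1) G0. leaves t = m} \<inter> {t \<in> T Conj G1 (insert g G0). leaves t = m} = {}"
      by (auto simp: T_def)
    ultimately have "num (T Conj G1 G0) m = num (T Conj (insert g G1) G0) m + num (T Conj G1 (insert g G0)) m"
      unfolding num_def by (simp add: card_Un_disjoint finite_num[OF T_assoc])
    thus ?thesis by (simp add: nrm_def add_divide_distrib)
  qed
  show ?case
  proof (intro exI conjI allI)
    show "cv (\<lambda>m. nrm n (T Conj G1 G0) m - x m)" using convergent_diff[OF y x(1)] by (simp add: diff_divide_distrib)
    fix m show "nrm n (T Conj (insert g G1) G0) m = nrm n (T Conj G1 G0) m - x m + (- 1) ^ card (insert g G1) * nrm n (T Conj {} (insert g G1 \<union> G0)) m"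
      unfolding split x(2) un using insert.hyps by simp
  qed
qed

lemma T_convergent_Conj:
  assumes "finite G1" "finite G0" "G1 \<inter> G0 = {}"
  shows "cv (nrm n (T Conj G1 G0))"
  using assms
proof (induction "card (G1 \<union> G0)" arbitrary: G1 G0 rule: less_induct)
  case less
  define G where "G = G1 \<union> G0"
  have G: "finite G" using less by (simp add: G_def)
  show ?case
  proof (cases "G = {}")
    case True
    hence "T Conj G1 G0 = cls n Conj" by (auto simp: G_def T_def)
    moreover have "(\<lambda>m. s m / s m) \<longlonglongrightarrow> 1"
    proof (rule tendsto_eventually)
      show "\<forall>\<^sub>F m in sequentially. s m / s m = 1"
        unfolding eventually_at_top_linorder by (intro exI[of _ 1] allI impI, drule s_pos) simp
    qed
    ultimately show ?thesis by (auto simp: convergent_def)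
  next
    case False
    \<comment> \<open>The duals of the trees in \<open>A\<close> are the possible children of a
      disjunction that is false on \<open>G\<close>, so lists over \<open>A\<close> are counted by
      \<open>T Conj {} G\<close>. Conversely \<open>T_reduce\<close> expresses \<open>A\<close> by
      the same sequence up to sign and a convergent term, which closes the scalar equation.\<close>
    define A where "A = T Conj G {}"
    have Ac: "A \<subseteq> cls n Conj" by (simp add: A_def T_cls)
    have Aa: "A \<subseteq> Collect (assoc_tree n)" by (simp add: A_def T_assoc)
    have smaller: "cv (nrm n (T Conj H1 H0))" if "finite H1" "finite H0" "H1 \<inter> H0 = {}" "card (H1 \<union> H0) < card G" for H1 H0
      using less that by (auto simp: G_def)
    have "\<exists>x. cv x \<and> (\<forall>m. nrm n A m = x m + (-1) ^ card G * nrm n (T Conj {} (G \<union> {})) m)"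
      unfolding A_def using G smaller by (intro T_reduce) auto
    then obtain x where x: "cv x" "\<And>m. nrm n A m = x m + (-1) ^ card G * nrm n (T Conj {} G) m" by auto
    have bR: "nrm n (T Conj {} G) m = nrml n A m" if "m \<ge> 2" for m
    proof -
      have "num (T Conj {} G) m = (if m = 1 then card {l \<in> lits n. \<forall>a\<in>G. \<not> tree_eval a (Leaf l)} else 0) + num_lists (T Disj {} G) m"
      proof (rule num_value_lists[where c = Conj and P = "\<lambda>t. \<forall>a\<in>G. \<not> tree_eval a t", unfolded opp.simps])
        show "T Conj {} G = {t \<in> cls n Conj. \<forall>a\<in>G. \<not> tree_eval a t}" by (auto simp: T_def)
        show "T Disj {} G \<subseteq> cls n Disj" by (rule T_cls)
      qed (auto simp: T_def)
      also have "num_lists (T Disj {} G) = num_lists A" unfolding A_def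
        using star_T[of Conj G "{}"] num_lists_star[of "T Conj G {}"] by (auto simp: fun_eq_iff)
      finally show ?thesis using that by (simp add: nrm_def nrml_def)
    qed
    \<comment> \<open>At any assignment in \<open>G\<close> one of the first variable and its
      negation is false, so that leaf is missing from \<open>A\<close>.\<close>
    obtain l where l: "l \<in> lits n" "Leaf l \<notin> A"
    proof -
      obtain a where a: "a \<in> G" using False by auto
      have "Pos 1 \<in> lits n" "Neg 1 \<in> lits n" using n_pos by (auto simp: lits_def)
      moreover have "Leaf (Pos 1) \<notin> A \<or> Leaf (Neg 1) \<notin> A" using a by (auto simp: A_def T_def)
      ultimately show ?thesis using that by blast
    qed
    have "0 < (1 / real (2 * n)) * w0" using w0_pos n_pos by simp
    hence q: "3 * (tau (nrm n A)) + (tau (nrml n A)) < 1"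
      using suminf_nrm_less[OF Ac l] suminf_nrml_le[OF Ac] s0_w0 by linarith
    from x(1) obtain \<kappa> where \<kappa>: "(\<lambda>m. x m / s m) \<longlonglongrightarrow> \<kappa>" by (auto simp: convergent_def)
    have "cv (nrml n A)"
    proof (rule fixpoint_convergent[OF nrm_nonneg(1) nrm_le_s[OF Ac] nrm_nonneg(2) _ nrml_rec[OF Aa] \<kappa> _ _ q])
      show "nrml n A m \<le> s m" for m using nrml_le_r[OF Ac] r_le_s order_trans by blast
      show "\<forall>\<^sub>F m in sequentially. nrm n A m = x m + (-1) ^ card G * nrml n A m"
        unfolding eventually_at_top_linorder using x(2) bR by (intro exI[of _ 2]) auto
    qed (simp add: power_abs)
    then obtain \<rho> where "(\<lambda>m. nrml n A m / s m) \<longlonglongrightarrow> \<rho>" by (auto simp: convergent_def)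
    moreover have "\<forall>\<^sub>F m in sequentially. nrml n A m / s m = nrm n (T Conj {} G) m / s m"
      unfolding eventually_at_top_linorder using bR by (intro exI[of _ 2]) auto
    ultimately have "(\<lambda>m. nrm n (T Conj {} G) m / s m) \<longlonglongrightarrow> \<rho>" by (rule Lim_transform_eventually)
    hence b: "cv (nrm n (T Conj {} G))" by (auto simp: convergent_def)
    have "\<exists>y. cv y \<and> (\<forall>m. nrm n (T Conj G1 G0) m = y m + (-1) ^ card G1 * nrm n (T Conj {} G) m)"
      unfolding G_def using less smaller by (intro T_reduce) (auto simp: G_def)
    then obtain y where y: "cv y" "\<And>m. nrm n (T Conj G1 G0) m = y m + (-1) ^ card G1 * nrm n (T Conj {} G) m" by auto
    have "cv (\<lambda>m. y m + (-1) ^ card G1 * nrm n (T Conj {} G) m)"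
      using convergent_add[OF y(1) convergent_mult[OF convergent_const b]] by (simp add: add_divide_distrib)
    thus ?thesis using y(2) by (simp add: fun_eq_iff)
  qed
qed

lemma T_convergent:
  assumes "finite G1" "finite G0" "G1 \<inter> G0 = {}"
  shows "cv (nrm n (T c G1 G0))"
proof (cases c)
  case Conj thus ?thesis using T_convergent_Conj assms by simp
next
  case Disj
  have "num (T Disj G1 G0) = num (T Conj G0 G1)"
    using num_star[of "T Conj G0 G1"] star_T[of Conj G0 G1] by (auto simp: fun_eq_iff)
  hence "nrm n (T c G1 G0) = nrm n (T Conj G0 G1)" using Disj by (simp add: nrm_def fun_eq_iff)
  moreover have "cv (nrm n (T Conj G0 G1))" using assms by (intro T_convergent_Conj) auto
  ultimately show ?thesis by simp
qed

end

section \<open>Exchangeability of literals\<close>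

lemma sum_over_image:
  fixes g :: "'a \<Rightarrow> real"
  assumes "finite T" "S \<subseteq> f ` T" "\<And>x. x \<in> T \<Longrightarrow> 0 \<le> g (f x)" "\<And>x. x \<in> T \<Longrightarrow> g (f x) \<le> h x"
  shows "sum g S \<le> sum h T"
proof -
  have "sum g S \<le> sum g (f ` T)" using assms by (intro sum_mono2) auto
  also have "\<dots> \<le> sum (g \<circ> f) T" using assms by (intro sum_image_le) auto
  also have "\<dots> \<le> sum h T" using assms by (intro sum_mono) auto
  finally show ?thesis .
qed

lemma lists_length_Suc: "{xs. set xs \<subseteq> A \<and> length xs = Suc k} = (\<lambda>(x,xs). x # xs) ` (A \<times> {xs. set xs \<subseteq> A \<and> length xs = k})"
proof (intro set_eqI iffI)
  fix xs assume "xs \<in> {xs. set xs \<subseteq> A \<and> length xs = Suc k}"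
  then show "xs \<in> (\<lambda>(x,xs). x # xs) ` (A \<times> {xs. set xs \<subseteq> A \<and> length xs = k})"
    by (cases xs) auto
qed auto

lemma sum_lists_prod:
  fixes f :: "'a \<Rightarrow> real"
  shows "(\<Sum>xs\<in>{xs. set xs \<subseteq> A \<and> length xs = k}. prod_list (map f xs)) = (\<Sum>x\<in>A. f x) ^ k"
proof (induction k)
  case 0
  have "{xs. set xs \<subseteq> A \<and> length xs = 0} = {[]}" by auto
  thus ?case by simp
next
  case (Suc k)
  have "(\<Sum>xs\<in>{xs. set xs \<subseteq> A \<and> length xs = Suc k}. prod_list (map f xs)) =
     (\<Sum>(x,xs)\<in>A \<times> {xs. set xs \<subseteq> A \<and> length xs = k}. f x * prod_list (map f xs))"
    unfolding lists_length_Suc by (subst sum.reindex) (auto simp: inj_on_def case_prod_beta)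
  also have "\<dots> = (\<Sum>x\<in>A. f x) * (\<Sum>xs\<in>{xs. set xs \<subseteq> A \<and> length xs = k}. prod_list (map f xs))"
    by (simp add: sum_product sum.cartesian_product)
  finally show ?case using Suc by simp
qed

definition llist :: "'a set \<Rightarrow> nat \<Rightarrow> nat \<Rightarrow> 'a list set" where
  "llist A k M = {xs. set xs \<subseteq> A \<and> k \<le> length xs \<and> length xs \<le> M}"

lemma finite_llist: "finite A \<Longrightarrow> finite (llist A k M)"
  by (rule finite_subset[OF _ finite_lists_length_le[of A M]]) (auto simp: llist_def)

lemma sum_llist_prod:
  fixes f :: "'a \<Rightarrow> real"
  assumes A: "finite A" and f: "\<And>x. x \<in> A \<Longrightarrow> 0 \<le> f x" and q: "(\<Sum>x\<in>A. f x) \<le> q" "q < 1"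
  shows "(\<Sum>xs\<in>llist A k M. prod_list (map f xs)) \<le> q ^ k / (1 - q)"
proof -
  define p where "p = (\<Sum>x\<in>A. f x)"
  have p: "0 \<le> p" "p \<le> q" "p < 1" using f q by (auto simp: p_def intro: sum_nonneg)
  have un: "llist A k M = (\<Union>j\<in>{k..M}. {xs. set xs \<subseteq> A \<and> length xs = j})" by (auto simp: llist_def)
  have "(\<Sum>xs\<in>llist A k M. prod_list (map f xs)) = (\<Sum>j\<in>{k..M}. \<Sum>xs\<in>{xs. set xs \<subseteq> A \<and> length xs = j}. prod_list (map f xs))"
    unfolding un using A by (intro sum.UNION_disjoint) (auto intro: finite_lists_length_eq)
  also have "\<dots> = (\<Sum>j\<in>{k..M}. p ^ j)" by (simp add: sum_lists_prod p_def)
  also have "\<dots> \<le> p ^ k / (1 - p)"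
  proof (cases "k \<le> M")
    case True
    have "(\<Sum>j\<in>{k..M}. p ^ j) = (p^k - p ^ Suc M) / (1 - p)"
      using sum_gp_multiplied[OF True, of p] p by (simp add: field_simps)
    also have "\<dots> \<le> p ^ k / (1 - p)" using p by (intro divide_right_mono) auto
    finally show ?thesis .
  qed (use p in auto)
  also have "\<dots> \<le> q ^ k / (1 - q)" using p q by (intro frac_le power_mono) auto
  finally show ?thesis .
qed

lemma sum_count_list: "finite A \<Longrightarrow> set xs \<subseteq> A \<Longrightarrow> (\<Sum>y\<in>A. real (count_list xs y)) = real (length xs)"
proof (induction xs)
  case (Cons x xs)
  have "(\<Sum>y\<in>A. real (count_list (x # xs) y)) = (\<Sum>y\<in>A. real (count_list xs y) + (if y = x then 1 else 0))"
    by (intro sum.cong) auto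
  also have "\<dots> = real (length (x # xs))" using Cons by (simp add: sum.distrib)
  finally show ?case .
qed simp

text \<open>Every \<open>k\<close>-subset is enumerated by a list without repetition, and the
  \<open>k\<close>-th power expands into a sum over all lists of length \<open>k\<close>.\<close>

lemma sum_subsets_prod_le:
  fixes f :: "'a \<Rightarrow> real"
  assumes A: "finite A" and f: "\<And>x. x \<in> A \<Longrightarrow> 0 \<le> f x"
  shows "(\<Sum>Y\<in>{Y. Y \<subseteq> A \<and> card Y = k}. prod f Y) \<le> (\<Sum>x\<in>A. f x) ^ k"
proof -
  define e where "e = (\<lambda>Y::'a set. SOME xs. set xs = Y \<and> distinct xs)"
  have e: "set (e Y) = Y \<and> distinct (e Y)" if "finite Y" for Y
    unfolding e_def using finite_distinct_list[OF that] by (rule someI_ex)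
  let ?S = "{Y. Y \<subseteq> A \<and> card Y = k}"
  have fin: "finite Y" if "Y \<in> ?S" for Y using that A finite_subset by auto
  have inj: "inj_on e ?S" using e fin by (metis (no_types, lifting) inj_onI)
  have "(\<Sum>Y\<in>?S. prod f Y) = (\<Sum>Y\<in>?S. prod_list (map f (e Y)))"
    using e fin by (intro sum.cong refl) (metis prod.distinct_set_conv_list)
  also have "\<dots> = (\<Sum>xs\<in>e ` ?S. prod_list (map f xs))" by (simp add: sum.reindex[OF inj])
  also have "\<dots> \<le> (\<Sum>xs\<in>{xs. set xs \<subseteq> A \<and> length xs = k}. prod_list (map f xs))"
  proof (rule sum_mono2)
    show "finite {xs. set xs \<subseteq> A \<and> length xs = k}" by (rule finite_lists_length_eq[OF A])
    show "e ` ?S \<subseteq> {xs. set xs \<subseteq> A \<and> length xs = k}"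
    proof clarify
      fix Y assume Y: "Y \<subseteq> A" "k = card Y"
      hence "finite Y" using A finite_subset by auto
      from e[OF this] Y show "set (e Y) \<subseteq> A \<and> length (e Y) = card Y" by (metis distinct_card)
    qed
  qed (auto intro!: prod_list_nonneg f)
  finally show ?thesis by (simp add: sum_lists_prod)
qed

lemma permutes_extending:
  assumes A: "finite A" "Y \<subseteq> A" "Y' \<subseteq> A" "card Y = card Y'"
  shows "\<exists>\<pi>. \<pi> permutes A \<and> \<pi> ` Y = Y'"
proof -
  have fin: "finite Y" "finite Y'" using A finite_subset by auto
  obtain f where f: "bij_betw f Y Y'" using finite_same_card_bij[OF fin A(4)] by auto
  have "card (A - Y) = card (A - Y')" using A fin by (simp add: card_Diff_subset)
  then obtain g where g: "bij_betw g (A - Y) (A - Y')" using finite_same_card_bij[of "A - Y" "A - Y'"] A(1) by auto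
  define \<pi> where "\<pi> = (\<lambda>x. if x \<in> Y then f x else if x \<in> A then g x else x)"
  have 1: "bij_betw \<pi> Y Y'" using f by (rule bij_betw_cong[THEN iffD1, rotated]) (simp add: \<pi>_def)
  have 2: "bij_betw \<pi> (A - Y) (A - Y')" using g by (rule bij_betw_cong[THEN iffD1, rotated]) (simp add: \<pi>_def)
  have "bij_betw \<pi> (Y \<union> (A - Y)) (Y' \<union> (A - Y'))" by (rule bij_betw_combine[OF 1 2]) auto
  hence "bij_betw \<pi> A A" using A by (simp add: Un_absorb1)
  hence "\<pi> permutes A" by (rule bij_imp_permutes) (use A in \<open>auto simp: \<pi>_def\<close>)
  thus ?thesis using 1 by (auto simp: bij_betw_def)
qed

text \<open>The permutations of the literals that act here need not respect negation.\<close>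

locale exchangeable =
  fixes n :: nat and X :: "'o set" and act :: "(literal \<Rightarrow> literal) \<Rightarrow> 'o \<Rightarrow> 'o" and p :: "'o \<Rightarrow> literal list"
  assumes n_pos: "n \<ge> 1" and fin: "finite X"
    and act_in: "\<pi> permutes lits n \<Longrightarrow> x \<in> X \<Longrightarrow> act \<pi> x \<in> X"
    and act_inv: "\<pi> permutes lits n \<Longrightarrow> x \<in> X \<Longrightarrow> act (inv \<pi>) (act \<pi> x) = x"
    and p_act: "\<pi> permutes lits n \<Longrightarrow> x \<in> X \<Longrightarrow> p (act \<pi> x) = map \<pi> (p x)"
    and p_lits: "x \<in> X \<Longrightarrow> set (p x) \<subseteq> lits n"
begin

definition invariant :: "('o \<Rightarrow> real) \<Rightarrow> bool" where
  "invariant g \<longleftrightarrow> (\<forall>\<pi> x. \<pi> permutes lits n \<longrightarrow> x \<in> X \<longrightarrow> g (act \<pi> x) = g x) \<and> (\<forall>x\<in>X. 0 \<le> g x)"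

lemma exchange_eq:
  assumes g: "invariant g" and Y: "Y \<subseteq> lits n" "Y' \<subseteq> lits n" "card Y = card Y'"
  shows "(\<Sum>x\<in>X. g x * (\<Prod>y\<in>Y. real (count_list (p x) y))) = (\<Sum>x\<in>X. g x * (\<Prod>y\<in>Y'. real (count_list (p x) y)))"
proof -
  obtain \<pi> where \<pi>: "\<pi> permutes lits n" "\<pi> ` Y = Y'" using permutes_extending[OF finite_lits Y] by auto
  have inv: "inv \<pi> permutes lits n" "inv (inv \<pi>) = \<pi>"
    using permutes_inv[OF \<pi>(1)] permutes_inv_inv[OF \<pi>(1)] by auto
  have inj: "inj \<pi>" using permutes_inj[OF \<pi>(1)] .
  show ?thesis
  proof (rule sum.reindex_bij_witness[of X "act (inv \<pi>)" "act \<pi>"])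
    fix x assume x: "x \<in> X"
    show "act (inv \<pi>) (act \<pi> x) = x" "act \<pi> x \<in> X" using act_inv act_in \<pi> x by auto
    show "act \<pi> (act (inv \<pi>) x) = x" "act (inv \<pi>) x \<in> X" using act_inv[OF inv(1) x] act_in inv x by auto
    have "(\<Prod>y\<in>Y'. real (count_list (p (act \<pi> x)) y)) = (\<Prod>y\<in>Y. real (count_list (p (act \<pi> x)) (\<pi> y)))"
      unfolding \<pi>(2)[symmetric] using inj by (subst prod.reindex) (auto simp: inj_on_def)
    also have "\<dots> = (\<Prod>y\<in>Y. real (count_list (p x) y))"
    proof (intro prod.cong refl)
      fix y
      have "count_list (map \<pi> xs) (\<pi> y) = count_list xs y" for xs
        using inj by (induction xs) (auto simp: inj_eq)
      thus "real (count_list (p (act \<pi> x)) (\<pi> y)) = real (count_list (p x) y)" using p_act[OF \<pi>(1) x] by simp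
    qed
    finally show "g (act \<pi> x) * (\<Prod>y\<in>Y'. real (count_list (p (act \<pi> x)) y)) = g x * (\<Prod>y\<in>Y. real (count_list (p x) y))"
      using g x \<pi>(1) by (simp add: invariant_def)
  qed
qed

text \<open>All \<open>k\<close>-subsets of the literals give the same sum, there are at least
  \<open>(2 n / k)^k\<close> of them, and their total is at most the \<open>k\<close>-th moment of
  the pattern length. So \<open>k\<close> prescribed pattern literals cost a factor of order
  \<open>1 / n^k\<close>.\<close>

lemma exchange_bound:
  assumes g: "invariant g" and Y: "Y \<subseteq> lits n" "card Y = k" "k \<ge> 1"
  shows "(\<Sum>x\<in>X. g x * (\<Prod>y\<in>Y. real (count_list (p x) y))) \<le> (real k / real (2 * n)) ^ k * (\<Sum>x\<in>X. g x * real (length (p x)) ^ k)"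
proof -
  define F where "F = (\<lambda>Y. \<Sum>x\<in>X. g x * (\<Prod>y\<in>Y. real (count_list (p x) y)))"
  let ?S = "{Y. Y \<subseteq> lits n \<and> card Y = k}"
  have k: "k \<le> 2 * n" using card_mono[OF finite_lits Y(1)] Y(2) by (simp add: card_lits)
  have "F Y' = F Y" if "Y' \<in> ?S" for Y' unfolding F_def using that Y by (intro exchange_eq g) auto
  hence "(\<Sum>Y'\<in>?S. F Y') = real ((2 * n) choose k) * F Y" by (simp add: n_subsets card_lits)
  moreover have "(\<Sum>Y'\<in>?S. F Y') \<le> (\<Sum>x\<in>X. g x * real (length (p x)) ^ k)"
  proof -
    have "(\<Sum>Y'\<in>?S. F Y') = (\<Sum>x\<in>X. g x * (\<Sum>Y'\<in>?S. \<Prod>y\<in>Y'. real (count_list (p x) y)))"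
      unfolding F_def sum_distrib_left by (rule sum.swap)
    also have "\<dots> \<le> (\<Sum>x\<in>X. g x * real (length (p x)) ^ k)"
    proof (intro sum_mono mult_left_mono)
      fix x assume x: "x \<in> X"
      show "0 \<le> g x" using g x by (simp add: invariant_def)
      show "(\<Sum>Y'\<in>?S. \<Prod>y\<in>Y'. real (count_list (p x) y)) \<le> real (length (p x)) ^ k"
        using sum_subsets_prod_le[of "lits n" "\<lambda>y. real (count_list (p x) y)" k] sum_count_list[of "lits n" "p x"] p_lits[OF x] by simp
    qed
    finally show ?thesis .
  qed
  ultimately have 1: "real ((2 * n) choose k) * F Y \<le> (\<Sum>x\<in>X. g x * real (length (p x)) ^ k)" by simp
  have FY: "F Y \<ge> 0" unfolding F_def using g by (auto simp: invariant_def intro!: sum_nonneg mult_nonneg_nonneg prod_nonneg)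
  have "(real (2 * n) / real k) ^ k * F Y \<le> real ((2 * n) choose k) * F Y"
    using binomial_ge_n_over_k_pow_k[OF k, where 'a = real] FY by (intro mult_right_mono) auto
  hence "(real (2 * n) / real k) ^ k * F Y \<le> (\<Sum>x\<in>X. g x * real (length (p x)) ^ k)" using 1 by simp
  hence "(real k / real (2 * n)) ^ k * ((real (2 * n) / real k) ^ k * F Y) \<le> (real k / real (2 * n)) ^ k * (\<Sum>x\<in>X. g x * real (length (p x)) ^ k)"
    by (rule mult_left_mono) simp
  moreover have "(real k / real (2 * n)) ^ k * ((real (2 * n) / real k) ^ k * F Y) = F Y"
  proof -
    have "(real k / real (2 * n)) ^ k * (real (2 * n) / real k) ^ k = 1"
      using Y(3) n_pos by (simp add: power_mult_distrib[symmetric])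
    thus ?thesis by (simp only: mult.assoc[symmetric] mult_1)
  qed
  ultimately have "F Y \<le> (real k / real (2 * n)) ^ k * (\<Sum>x\<in>X. g x * real (length (p x)) ^ k)" by (simp only:)
  thus ?thesis by (simp only: F_def)
qed

end

text \<open>For \<open>Z = {l}\<close> the failure of this event means that the pattern together
  with \<open>negl l\<close> is a consistent set of literals. A larger \<open>Z\<close> records
  literals on which an estimate is conditioned.\<close>

definition hit :: "literal set \<Rightarrow> literal list \<Rightarrow> bool" where
  "hit Z ps \<longleftrightarrow> (\<exists>y\<in>set ps. y \<in> Z \<or> negl y \<in> set ps)"

text \<open>A coincidence that involves \<open>qs\<close> is one with \<open>Z\<close>, within
  \<open>qs\<close>, or with the complement of a literal of \<open>ps\<close>. This lets the
  patterns of two subtrees be exposed one after the other.\<close>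

lemma hit_append: "hit Z (ps @ qs) \<Longrightarrow> hit (Z \<union> negl ` set ps) qs \<or> hit Z ps"
proof -
  assume "hit Z (ps @ qs)"
  then obtain y where y: "y \<in> set ps \<union> set qs" "y \<in> Z \<or> negl y \<in> set ps \<union> set qs" by (auto simp: hit_def)
  have *: "y \<in> negl ` set ps" if "negl y \<in> set ps" for y using that by (metis image_eqI negl_negl)
  show ?thesis
  proof (cases "y \<in> set ps")
    case True
    hence "y \<in> Z \<or> negl y \<in> set ps \<Longrightarrow> ?thesis" by (auto simp: hit_def)
    moreover have "negl y \<in> set qs \<Longrightarrow> ?thesis" using True by (auto simp: hit_def)
    ultimately show ?thesis using y(2) by auto
  next
    case False
    thus ?thesis using y * by (auto simp: hit_def)
  qed
qed

text \<open>The literals of \<open>ps\<close> and \<open>negl l\<close> contain no complementary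
  pair, so they can all be given the value \<open>b\<close>.\<close>

lemma no_hit_assignment:
  assumes "\<not> hit {l} ps" "set ps \<subseteq> lits n" "l \<in> lits n"
  shows "\<exists>a\<in>assignments n. lit_eval a l = (\<not> b) \<and> (\<forall>y\<in>set ps. lit_eval a y = b)"
proof -
  define Y where "Y = insert (negl l) (set ps)"
  have cons: "negl y \<notin> Y" if "y \<in> Y" for y
    using that assms(1) unfolding Y_def hit_def by (metis insertCI insertE negl_negl negl_neq(2) singletonI)
  define a where "a = (\<lambda>i\<in>{1..n}. if b then Pos i \<in> Y else Neg i \<in> Y)"
  have "a \<in> assignments n" by (simp add: a_def assignments_def)
  moreover have Yl: "y \<in> lits n" if "y \<in> Y" for y using that assms(2,3) by (auto simp: Y_def)
  have ev: "lit_eval a y = b" if "y \<in> Y" for y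
  proof (cases y)
    case (Pos i)
    moreover have "i \<in> {1..n}" using Yl[OF that] Pos by (simp add: lits_def)
    ultimately show ?thesis using that cons[of y] by (auto simp: a_def)
  next
    case (Neg i)
    moreover have "i \<in> {1..n}" using Yl[OF that] Neg by (simp add: lits_def)
    ultimately show ?thesis using that cons[of y] by (auto simp: a_def)
  qed
  moreover have "lit_eval a l = (\<not> b)" using ev[of "negl l"] by (auto simp: Y_def)
  ultimately show ?thesis by (auto simp: Y_def)
qed

context exchangeable
begin

text \<open>Union bound: each literal of \<open>Z\<close> costs \<open>1 / (2 n)\<close>, and each
  of the \<open>n\<close> complementary pairs costs \<open>(2 / (2 n))^2\<close>, together
  \<open>1 / n\<close>, which is the \<open>+ 2\<close> in the numerator. The shifted second moment
  dominates both moments that occur.\<close>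

lemma hit_bound:
  assumes g: "invariant g" and Z: "Z \<subseteq> lits n" and B: "(\<Sum>x\<in>X. g x * (real (length (p x)) + 2) ^ 2) \<le> B"
  shows "(\<Sum>x\<in>X. g x * of_bool (hit Z (p x))) \<le> (real (card Z) + 2) / real (2 * n) * B"
proof -
  have g0: "g x \<ge> 0" if "x \<in> X" for x using g that by (simp add: invariant_def)
  have finZ: "finite Z" by (rule finite_subset[OF Z finite_lits])
  let ?c = "\<lambda>x y. real (count_list (p x) y)"
  have c0: "?c x y \<ge> 0" for x y by simp
  have c1: "?c x y \<ge> 1" if "y \<in> set (p x)" for x y
    using that count_list_0_iff[of "p x" y] by linarith
  have "(\<Sum>x\<in>X. g x * of_bool (hit Z (p x))) \<le> (\<Sum>x\<in>X. g x * ((\<Sum>z\<in>Z. \<Prod>y\<in>{z}. ?c x y) + (\<Sum>i\<in>{1..n}. \<Prod>y\<in>{Pos i, Neg i}. ?c x y)))"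
  proof (intro sum_mono mult_left_mono g0)
    fix x assume x: "x \<in> X"
    have nn: "0 \<le> (\<Sum>z\<in>Z. \<Prod>y\<in>{z}. ?c x y)" "0 \<le> (\<Sum>i\<in>{1..n}. \<Prod>y\<in>{Pos i, Neg i}. ?c x y)"
      by (intro sum_nonneg prod_nonneg; simp)+
    show "of_bool (hit Z (p x)) \<le> (\<Sum>z\<in>Z. \<Prod>y\<in>{z}. ?c x y) + (\<Sum>i\<in>{1..n}. \<Prod>y\<in>{Pos i, Neg i}. ?c x y)"
    proof (cases "hit Z (p x)")
      case True
      then obtain y where y: "y \<in> set (p x)" "y \<in> Z \<or> negl y \<in> set (p x)" by (auto simp: hit_def)
      from y(2) show ?thesis
      proof
        assume "y \<in> Z"
        hence "?c x y \<le> (\<Sum>z\<in>Z. ?c x z)" using finZ by (intro member_le_sum) auto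
        thus ?thesis using c1[OF y(1)] nn by simp
      next
        assume ny: "negl y \<in> set (p x)"
        define i where "i = lit_var y"
        have "y \<in> lits n" using y(1) p_lits[OF x] by blast
        hence i: "i \<in> {1..n}" by (simp add: i_def lits_def)
        have PN: "Pos i \<in> set (p x) \<and> Neg i \<in> set (p x)"
        proof (cases y)
          case (Pos j) thus ?thesis using y(1) ny by (simp add: i_def)
        next
          case (Neg j) thus ?thesis using y(1) ny by (simp add: i_def)
        qed
        have "1 * 1 \<le> ?c x (Pos i) * ?c x (Neg i)" using c1[of "Pos i" x] c1[of "Neg i" x] PN by (intro mult_mono) auto
        also have "\<dots> = (\<Prod>y\<in>{Pos i, Neg i}. ?c x y)" by simp
        also have "\<dots> \<le> (\<Sum>i\<in>{1..n}. \<Prod>y\<in>{Pos i, Neg i}. ?c x y)"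
          by (rule member_le_sum[OF i]) (auto intro!: prod_nonneg)
        finally show ?thesis using nn by simp
      qed
    qed (use nn in simp)
  qed
  also have "\<dots> = (\<Sum>z\<in>Z. \<Sum>x\<in>X. g x * (\<Prod>y\<in>{z}. ?c x y)) + (\<Sum>i\<in>{1..n}. \<Sum>x\<in>X. g x * (\<Prod>y\<in>{Pos i, Neg i}. ?c x y))"
    unfolding distrib_left sum.distrib sum_distrib_left by (intro arg_cong2[of _ _ _ _ "(+)"] sum.swap)
  also have "\<dots> \<le> (\<Sum>z\<in>Z. 1 / real (2 * n) * B) + (\<Sum>i\<in>{1..n}. (1 / real n)^2 * B)"
  proof (intro add_mono sum_mono)
    fix z assume z: "z \<in> Z"
    have "(\<Sum>x\<in>X. g x * (\<Prod>y\<in>{z}. ?c x y)) \<le> (real 1 / real (2 * n)) ^ 1 * (\<Sum>x\<in>X. g x * real (length (p x)) ^ 1)"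
      using z Z by (intro exchange_bound g) auto
    also have "\<dots> \<le> (real 1 / real (2 * n)) ^ 1 * B"
    proof (intro mult_left_mono order_trans[OF _ B])
      show "(\<Sum>x\<in>X. g x * real (length (p x)) ^ 1) \<le> (\<Sum>x\<in>X. g x * (real (length (p x)) + 2) ^ 2)"
        by (intro sum_mono mult_left_mono g0) (auto simp: power2_eq_square algebra_simps)
    qed simp
    finally show "(\<Sum>x\<in>X. g x * (\<Prod>y\<in>{z}. ?c x y)) \<le> 1 / real (2 * n) * B" by simp
  next
    fix i assume i: "i \<in> {1..n}"
    have "(\<Sum>x\<in>X. g x * (\<Prod>y\<in>{Pos i, Neg i}. ?c x y)) \<le> (real 2 / real (2 * n)) ^ 2 * (\<Sum>x\<in>X. g x * real (length (p x)) ^ 2)"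
      using i by (intro exchange_bound g) (auto simp: lits_def)
    also have "\<dots> \<le> (real 2 / real (2 * n)) ^ 2 * B"
    proof (intro mult_left_mono order_trans[OF _ B])
      show "(\<Sum>x\<in>X. g x * real (length (p x)) ^ 2) \<le> (\<Sum>x\<in>X. g x * (real (length (p x)) + 2) ^ 2)"
        by (intro sum_mono mult_left_mono g0 power_mono) auto
    qed simp
    finally show "(\<Sum>x\<in>X. g x * (\<Prod>y\<in>{Pos i, Neg i}. ?c x y)) \<le> (1 / real n)^2 * B" by simp
  qed
  also have "\<dots> = (real (card Z) + 2) / real (2 * n) * B"
    using n_pos by (simp add: field_simps power2_eq_square)
  finally show ?thesis by (simp add: mult_left_mono)
qed

end

text \<open>If all literals of the pattern evaluate to \<open>val d\<close>, so does the tree.  Hence a pattern without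
  complementary literals gives an assignment at which the tree has the value \<open>val d\<close>.\<close>

fun pat :: "connective \<Rightarrow> atree \<Rightarrow> literal list" where
  "pat d (Leaf l) = [l]"
| "pat d (Node c ts) = concat (let ps = map (pat d) ts in if c = d then ps else take 1 ps)"

definition patl :: "connective \<Rightarrow> atree list \<Rightarrow> literal list" where "patl d ts = concat (map (pat d) ts)"

lemma patl_simps [simp]: "patl d [] = []" "patl d (t # ts) = pat d t @ patl d ts" "patl d (xs @ ys) = patl d xs @ patl d ys"
  by (auto simp: patl_def)

lemma set_patl: "set (patl d ts) = (\<Union>t\<in>set ts. set (pat d t))" by (simp add: patl_def)

lemma pat_Node [simp]: "pat d (Node d ts) = patl d ts" "pat d (Node (opp d) (t # ts)) = pat d t"
   "pat (opp d) (Node d (t # ts)) = pat (opp d) t"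
  by (auto simp: patl_def)

declare pat.simps(2) [simp del]

lemma pat_lits: "assoc_tree n t \<Longrightarrow> set (pat d t) \<subseteq> lits n"
proof (induction d t rule: pat.induct)
  case (2 d c ts)
  have "set (pat d (Node c ts)) \<subseteq> (\<Union>t\<in>set ts. set (pat d t))"
    by (auto simp: pat.simps(2) Let_def take_map dest: in_set_takeD split: if_splits)
  moreover have "set (pat d t) \<subseteq> lits n" if "t \<in> set ts" for t
    using 2 that by auto
  ultimately show ?case by blast
qed (auto simp: lits_def)

lemma pat_nonempty: "assoc_tree n t \<Longrightarrow> pat d t \<noteq> []"
proof (induction d t rule: pat.induct)
  case (2 d c ts)
  then obtain t us where ts: "ts = t # us" by (cases ts) auto
  have "pat d t \<noteq> []" using 2 ts by auto
  thus ?case by (simp add: pat.simps(2) Let_def ts)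
qed auto

text \<open>At a node labelled \<open>d\<close> all children must have the value
  \<open>val d\<close>, and the pattern contains the patterns of all of them. At the other nodes one
  such child suffices, and the pattern follows the first one.\<close>

lemma pat_eval:
  assumes "assoc_tree n t" "\<And>y. y \<in> set (pat d t) \<Longrightarrow> lit_eval a y = val d"
  shows "tree_eval a t = val d"
  using assms
proof (induction d t rule: pat.induct)
  case (2 d c ts)
  have sub: "assoc_tree n t" if "t \<in> set ts" for t using 2 that by auto
  show ?case
  proof (cases "c = d")
    case True
    have "tree_eval a t = val d" if "t \<in> set ts" for t
      using that True sub "2.prems"(2) by (intro "2.IH") (auto simp: set_patl)
    thus ?thesis using eval_Node[of a d ts] True by simp
  next
    case False
    hence c: "c = opp d" by (simp add: neq_iff_opp)
    obtain t us where ts: "ts = t # us" using "2.prems" by (cases ts) auto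
    have "tree_eval a t = val d"
      using sub "2.prems"(2) c ts by (intro "2.IH") auto
    hence "tree_eval a (Node c ts) \<noteq> val c" unfolding eval_Node using ts c by auto
    thus ?thesis using c by simp
  qed
qed auto

text \<open>Renaming need not preserve the computed function. It preserves shape and size and
  renames the pattern accordingly, which is all that the estimates use.\<close>

fun ren :: "(literal \<Rightarrow> literal) \<Rightarrow> atree \<Rightarrow> atree" where
  "ren \<pi> (Leaf l) = Leaf (\<pi> l)"
| "ren \<pi> (Node c ts) = Node c (map (ren \<pi>) ts)"

lemma root_label_ren [simp]: "root_label (ren \<pi> t) = root_label t" by (cases t) auto

lemma leaves_ren [simp]: "leaves (ren \<pi> t) = leaves t"
  by (induction \<pi> t rule: ren.induct) (auto intro!: arg_cong[of _ _ sum_list] simp: o_def)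

lemma assoc_tree_ren: "\<pi> permutes lits n \<Longrightarrow> assoc_tree n t \<Longrightarrow> assoc_tree n (ren \<pi> t)"
proof (induction \<pi> t rule: ren.induct)
  case (1 \<pi> l)
  thus ?case using permutes_in_image[OF 1(1), of l] by (auto simp: lits_def)
qed auto

lemma ren_inv: "\<pi> permutes A \<Longrightarrow> ren (inv \<pi>) (ren \<pi> t) = t"
  by (induction \<pi> t rule: ren.induct) (auto simp: permutes_inverses intro!: map_idI)

lemma pat_ren: "pat d (ren \<pi> t) = map \<pi> (pat d t)"
proof (induction d t rule: pat.induct)
  case (2 d c ts)
  have "map (pat d) (map (ren \<pi>) ts) = map (map \<pi>) (map (pat d) ts)" using 2 by simp
  thus ?case unfolding ren.simps pat.simps(2) Let_def by (simp only: map_concat take_map if_distrib[of "map (map \<pi>)"] split: if_split)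
qed auto

lemma ren_cls: "\<pi> permutes lits n \<Longrightarrow> t \<in> cls n c \<Longrightarrow> ren \<pi> t \<in> cls n c"
  by (auto simp: cls_def assoc_tree_ren)

section \<open>Trees computing a literal\<close>

text \<open>The necessary condition on every child of a node labelled \<open>c\<close> that computes
  \<open>l\<close>.\<close>

definition sem :: "nat \<Rightarrow> connective \<Rightarrow> literal \<Rightarrow> atree \<Rightarrow> bool" where
  "sem n c l t \<longleftrightarrow> (\<forall>a\<in>assignments n. lit_eval a l = val c \<longrightarrow> tree_eval a t = val c)"

text \<open>The coincidences visible among the leaf children. They already force \<open>sem\<close>,
  and their limit frequency can be computed exactly.\<close>

definition direct :: "literal \<Rightarrow> atree list \<Rightarrow> bool" where
  "direct l ts \<longleftrightarrow> (\<exists>y. Leaf y \<in> set ts \<and> (y = l \<or> Leaf (negl y) \<in> set ts))"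

definition hits :: "nat \<Rightarrow> connective \<Rightarrow> literal \<Rightarrow> atree set" where
  "hits n c l = {t \<in> cls n c. hit {l} (pat (opp c) t)}"

definition indirect :: "nat \<Rightarrow> connective \<Rightarrow> literal \<Rightarrow> atree set" where
  "indirect n c l = {t. \<exists>ts. t = Node (opp c) ts \<and> t \<in> cls n c \<and> sem n c l t \<and> \<not> direct l ts}"

definition computing :: "nat \<Rightarrow> connective \<Rightarrow> literal \<Rightarrow> atree set" where
  "computing n c l = {t. \<exists>ts. t = Node c ts \<and> t \<in> cls n (opp c) \<and> (\<forall>a\<in>assignments n. tree_eval a t = lit_eval a l)}"

definition main_lists :: "nat \<Rightarrow> connective \<Rightarrow> literal \<Rightarrow> atree list set" where
  "main_lists n c l = {ts. set ts \<subseteq> cls n (opp c) \<and> 2 \<le> length ts \<and> direct l ts}"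

definition main :: "nat \<Rightarrow> connective \<Rightarrow> literal \<Rightarrow> atree set" where
  "main n c l = (\<lambda>ts. Node c [Leaf l, Node (opp c) ts]) ` main_lists n c l \<union> (\<lambda>ts. Node c [Node (opp c) ts, Leaf l]) ` main_lists n c l"

text \<open>Separates one distinguished child from the list of the others; its position
  \<open>j\<close> becomes a summation index of its own.\<close>

definition ins :: "nat \<Rightarrow> atree \<Rightarrow> atree list \<Rightarrow> atree list" where
  "ins j t zs = take j zs @ t # drop j zs"

lemma ins_append: "ins (length xs) t (xs @ ys) = xs @ t # ys" by (simp add: ins_def)

text \<open>Without a hit some assignment gives \<open>l\<close> the value \<open>val c\<close> and
  all pattern literals the opposite value, which \<open>pat_eval\<close> passes on to the
  tree.\<close>

lemma sem_hits:
  assumes "t \<in> cls n c" "l \<in> lits n" "sem n c l t" shows "t \<in> hits n c l"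
proof -
  have t: "assoc_tree n t" using assms(1) cls_assoc by auto
  have "hit {l} (pat (opp c) t)"
  proof (rule ccontr)
    assume "\<not> hit {l} (pat (opp c) t)"
    from no_hit_assignment[OF this pat_lits[OF t] assms(2), of "val (opp c)"]
    obtain a where a: "a \<in> assignments n" "lit_eval a l = val c" "\<forall>y\<in>set (pat (opp c) t). lit_eval a y = val (opp c)" by auto
    hence "tree_eval a t = val (opp c)" using pat_eval[OF t] by blast
    moreover have "tree_eval a t = val c" using assms(3) a by (simp add: sem_def)
    ultimately show False by simp
  qed
  thus ?thesis using assms by (simp add: hits_def)
qed

lemma direct_sem:
  assumes "direct l ts" shows "sem n c l (Node (opp c) ts)"
  unfolding sem_def
proof (intro ballI impI)
  fix a assume a: "lit_eval a l = val c"
  obtain y where y: "Leaf y \<in> set ts" "y = l \<or> Leaf (negl y) \<in> set ts" using assms by (auto simp: direct_def)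
  have "\<exists>t\<in>set ts. tree_eval a t \<noteq> val (opp c)"
  proof (cases "lit_eval a y = val c")
    case True thus ?thesis using y(1) by (intro bexI[of _ "Leaf y"]) auto
  next
    case False
    hence "y \<noteq> l" using a by auto
    thus ?thesis using y(2) False by (intro bexI[of _ "Leaf (negl y)"]) auto
  qed
  hence "tree_eval a (Node (opp c) ts) \<noteq> val (opp c)" unfolding eval_Node by auto
  thus "tree_eval a (Node (opp c) ts) = val c" by simp
qed

lemma main_computing:
  assumes l: "l \<in> lits n" shows "main n c l \<subseteq> computing n c l"
proof
  fix t assume "t \<in> main n c l"
  then obtain ts us where ts: "ts \<in> main_lists n c l" "t = Node c us" "us = [Leaf l, Node (opp c) ts] \<or> us = [Node (opp c) ts, Leaf l]"
    by (auto simp: main_def)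
  have "tree_eval a t = lit_eval a l" if "a \<in> assignments n" for a
  proof -
    have "tree_eval a t = val c \<longleftrightarrow> lit_eval a l = val c \<and> tree_eval a (Node (opp c) ts) = val c"
      using ts(2,3) unfolding ts(2) eval_Node by auto
    moreover have "lit_eval a l = val c \<Longrightarrow> tree_eval a (Node (opp c) ts) = val c"
      using direct_sem[of l ts n c] ts(1) that unfolding main_lists_def sem_def by blast
    ultimately have "tree_eval a t = val c \<longleftrightarrow> lit_eval a l = val c" by blast
    thus ?thesis by blast
  qed
  moreover have "t \<in> cls n (opp c)" using ts l by (auto simp: main_lists_def)
  ultimately show "t \<in> computing n c l" using ts(2) by (auto simp: computing_def)
qed

text \<open>If \<open>t\<close> has no direct witness, its pattern has a witness inside some child \<open>Node c (e1 # e2 # es)\<close>,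
  all of whose pattern lies in \<open>e1\<close>.  Switching the pattern of this child to \<open>e2\<close> yields a second,
  independent witness.\<close>

lemma indirect_decomp:
  assumes t: "t \<in> indirect n c l" and l: "l \<in> lits n"
  shows "\<exists>zs j e1 e2 es. t = Node (opp c) (ins j (Node c (e1 # e2 # es)) zs) \<and> j \<le> length zs \<and>
    set zs \<subseteq> cls n (opp c) \<and> e1 \<in> cls n c \<and> e2 \<in> cls n c \<and> set es \<subseteq> cls n c \<and>
    hit (insert l (negl ` set (patl (opp c) zs))) (pat (opp c) e1) \<and> hit {l} (patl (opp c) zs @ pat (opp c) e2)"
proof -
  define d where "d = opp c"
  have c: "c = opp d" "opp c = d" by (simp_all add: d_def)
  obtain ts where ts: "t = Node d ts" "t \<in> cls n c" "sem n c l t" "\<not> direct l ts"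
    using t by (auto simp: indirect_def d_def)
  have tsd: "set ts \<subseteq> cls n d" using ts c by auto
  have "hit {l} (patl d ts)" using sem_hits[OF ts(2) l ts(3)] by (simp add: hits_def c ts(1))
  then obtain y x where x: "x \<in> set ts" "y \<in> set (pat d x)" "y = l \<or> negl y \<in> set (patl d ts)"
    by (auto simp: hit_def set_patl)
  have claim: "\<exists>xs x ys. ts = xs @ x # ys \<and> (\<forall>k. x \<noteq> Leaf k) \<and> hit (insert l (negl ` set (patl d (xs @ ys)))) (pat d x)"
    if x: "x \<in> set ts" "y \<in> set (pat d x)" "\<forall>k. x \<noteq> Leaf k" "y = l \<or> negl y \<in> set (patl d ts)" for x y
  proof -
    obtain xs ys where s: "ts = xs @ x # ys" using x(1) by (meson split_list)
    have "hit (insert l (negl ` set (patl d (xs @ ys)))) (pat d x)"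
    proof (cases "y = l \<or> negl y \<in> set (pat d x)")
      case True thus ?thesis using x(2) by (auto simp: hit_def)
    next
      case False
      hence "negl y \<in> set (patl d (xs @ ys))" using x(4) s by auto
      hence "negl (negl y) \<in> negl ` set (patl d (xs @ ys))" by (rule imageI)
      thus ?thesis using x(2) by (auto simp: hit_def simp del: patl_simps)
    qed
    thus ?thesis using s x(3) by blast
  qed
  have "\<exists>xs x ys. ts = xs @ x # ys \<and> (\<forall>k. x \<noteq> Leaf k) \<and> hit (insert l (negl ` set (patl d (xs @ ys)))) (pat d x)"
  proof (cases "\<forall>k. x \<noteq> Leaf k")
    case True thus ?thesis using claim x by blast
  next
    case False
    \<comment> \<open>A leaf cannot be split further. As there is no direct witness, the complement
      of \<open>y\<close> occurs inside a child that is not a leaf, and the two literals exchange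
      their roles.\<close>
    hence xl: "x = Leaf y" using x(2) by auto
    have "y \<noteq> l" using ts(4) x(1) xl by (auto simp: direct_def)
    then obtain x' where x': "x' \<in> set ts" "negl y \<in> set (pat d x')" using x(3) by (auto simp: set_patl)
    have "\<forall>k. x' \<noteq> Leaf k"
    proof (intro allI notI)
      fix k assume "x' = Leaf k"
      hence "x' = Leaf (negl y)" using x'(2) by auto
      thus False using ts(4) x(1) xl x'(1) by (auto simp: direct_def)
    qed
    moreover have "negl (negl y) \<in> set (patl d ts)" using x(1,2) by (auto simp: set_patl)
    ultimately show ?thesis using claim[OF x'] by blast
  qed
  then obtain xs x ys where s: "ts = xs @ x # ys" "\<forall>k. x \<noteq> Leaf k" "hit (insert l (negl ` set (patl d (xs @ ys)))) (pat d x)"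
    by blast
  have "x \<in> cls n d" using tsd s by auto
  then obtain us where us: "x = Node c us" "2 \<le> length us" "set us \<subseteq> cls n c" using s(2) c by (cases x) auto
  then obtain e1 e2 es where e: "us = e1 # e2 # es" by (cases us; cases "tl us") auto
  define zs where "zs = xs @ ys"
  have h1: "hit (insert l (negl ` set (patl d zs))) (pat d e1)"
    using s(3) unfolding us(1) e zs_def c(1) by simp
  have zsd: "set zs \<subseteq> cls n d" using tsd s by (auto simp: zs_def)
  have za: "assoc_tree n z" if "z \<in> set zs" for z using zsd that cls_assoc by blast
  have ea: "assoc_tree n e2" using us e cls_assoc by auto
  have h2: "hit {l} (patl d zs @ pat d e2)"
  proof (rule ccontr)
    assume "\<not> ?thesis"
    moreover have "set (patl d zs @ pat d e2) \<subseteq> lits n"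
      using za pat_lits[of n _ d] pat_lits[OF ea] by (fastforce simp: set_patl)
    ultimately obtain a where a: "a \<in> assignments n" "lit_eval a l = (\<not> val d)" "\<forall>y\<in>set (patl d zs @ pat d e2). lit_eval a y = val d"
      using no_hit_assignment[OF _ _ l, of _ "val d"] by blast
    have "tree_eval a z = val d" if "z \<in> set zs" for z
      using that a(3) by (intro pat_eval[OF za]) (auto simp: set_patl)
    moreover have "tree_eval a e2 = val d" using a(3) by (intro pat_eval[OF ea]) auto
    hence "tree_eval a x \<noteq> val c" unfolding us(1) e eval_Node c(1) by simp
    hence "tree_eval a x = val d" by (simp add: c(1))
    ultimately have "tree_eval a t = val d" unfolding ts(1) eval_Node s(1) zs_def by auto
    moreover have "tree_eval a t = val c" using ts(3) a(1,2) by (simp add: sem_def c(1))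
    ultimately show False by (simp add: c(1))
  qed
  have "t = Node (opp c) (ins (length xs) (Node c (e1 # e2 # es)) zs)" "length xs \<le> length zs"
    unfolding ts(1) s(1) us(1) e c(2) zs_def ins_append by simp_all
  thus ?thesis using zsd us e h1 h2 unfolding c(2) by force
qed

text \<open>The \<open>rest\<close> shapes cover the trees left over by \<open>main\<close>, and
  each contains three coincidences, hence has weight of order \<open>1 / n^3\<close>. Here they sit
  in three children, every one of which must be a hit.\<close>

definition rest_many :: "nat \<Rightarrow> connective \<Rightarrow> literal \<Rightarrow> atree set" where
  "rest_many n c l = {Node c (x # y # z # us) |x y z us. x \<in> hits n c l \<and> y \<in> hits n c l \<and> z \<in> hits n c l \<and> set us \<subseteq> cls n c}"

text \<open>One coincidence is the leaf \<open>l\<close>, the other two come from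
  \<open>indirect_decomp\<close>. The Boolean chooses the order of the two children.\<close>

definition rest_leaf :: "nat \<Rightarrow> connective \<Rightarrow> literal \<Rightarrow> bool \<Rightarrow> atree set" where
  "rest_leaf n c l b = {Node c (if b then [Leaf l, x] else [x, Leaf l]) |x. x \<in> indirect n c l}"

definition rest_indirect :: "nat \<Rightarrow> connective \<Rightarrow> literal \<Rightarrow> bool \<Rightarrow> atree set" where
  "rest_indirect n c l b = {Node c (if b then [x, y] else [y, x]) |x y. x \<in> indirect n c l \<and> y \<in> hits n c l}"

text \<open>Arises when one child is constantly \<open>val c\<close> by two complementary leaves.
  The other child, with root \<open>opp c\<close>, must then have the value
  \<open>val (opp c)\<close> whenever \<open>l\<close> has it, so two of its own children are hits
  for \<open>opp c\<close>.\<close>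

definition rest_const :: "nat \<Rightarrow> connective \<Rightarrow> literal \<Rightarrow> bool \<Rightarrow> atree set" where
  "rest_const n c l b = {Node c (let w = Node (opp c) (y # z # us) in if b then [x, w] else [w, x]) |x y z us.
     x \<in> hits n c l \<and> y \<in> hits n (opp c) l \<and> z \<in> hits n (opp c) l \<and> set us \<subseteq> cls n (opp c)}"

text \<open>The leaf \<open>l\<close> in both children gives two coincidences; the third is between
  the patterns, now taken for \<open>c\<close>, of one further grandchild on each side.\<close>

definition rest_both :: "nat \<Rightarrow> connective \<Rightarrow> literal \<Rightarrow> atree set" where
  "rest_both n c l = {Node c [Node (opp c) (ins i (Leaf l) (x # xs)), Node (opp c) (ins j (Leaf l) (y # ys))] |x xs i y ys j.
     set (x # xs) \<subseteq> cls n (opp c) \<and> set (y # ys) \<subseteq> cls n (opp c) \<and> i \<le> length xs + 1 \<and> j \<le> length ys + 1 \<and>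
     hit {l} (pat c x @ pat c y)}"

lemma computing_decomp:
  assumes t: "t \<in> computing n c l" and l: "l \<in> lits n" and m: "leaves t \<noteq> 2" "t \<notin> main n c l"
  shows "t \<in> rest_many n c l \<union> (\<Union>b. rest_leaf n c l b \<union> rest_indirect n c l b \<union> rest_const n c l b) \<union> rest_both n c l"
proof -
  define d where "d = opp c"
  have c: "c = opp d" "opp c = d" by (simp_all add: d_def)
  obtain ts where ts: "t = Node c ts" "set ts \<subseteq> cls n c" "2 \<le> length ts" "\<And>a. a \<in> assignments n \<Longrightarrow> tree_eval a t = lit_eval a l"
    using t by (auto simp: computing_def)
  have sem: "sem n c l x" if "x \<in> set ts" for x
    unfolding sem_def
  proof (intro ballI impI)
    fix a assume a: "a \<in> assignments n" "lit_eval a l = val c"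
    hence "tree_eval a (Node c ts) = val c" using ts(1,4) by auto
    thus "tree_eval a x = val c" using that unfolding eval_Node by auto
  qed
  have h: "x \<in> hits n c l" if "x \<in> set ts" for x using sem_hits[OF _ l sem] that ts by auto
  \<comment> \<open>The pattern of a leaf is its own literal, which is a hit only if it is
    \<open>l\<close>.\<close>
  have leaf: "k = l" if "Leaf k \<in> set ts" for k using h[OF that] by (auto simp: hits_def hit_def)
  obtain x y us where us: "ts = x # y # us" using ts(3) by (cases ts; cases "tl ts") auto
  show ?thesis
  proof (cases us)
    case (Cons z us')
    hence "t \<in> rest_many n c l" using h ts us by (auto simp: rest_many_def)
    thus ?thesis by blast
  next
    case Nil
    have node: "\<exists>xs. v = Node d xs \<and> set xs \<subseteq> cls n d \<and> 2 \<le> length xs" if "v \<in> set ts" "v \<noteq> Leaf l" for v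
    proof (cases v)
      case (Leaf k) thus ?thesis using leaf that by auto
    next
      case (Node e xs)
      hence "Node e xs \<in> cls n c" using ts(2) that by blast
      thus ?thesis using Node by (auto simp: c)
    qed
    have ind: "v \<in> indirect n c l" if "v \<in> set ts" "v = Node d xs" "\<not> direct l xs" for v xs
    proof -
      have "v \<in> cls n c" "sem n c l v" using that sem ts(2) by blast+
      thus ?thesis unfolding indirect_def c(2) using that(2,3) by blast
    qed
    have ml: "xs \<in> main_lists n c l" if "Node d xs \<in> set ts" "direct l xs" for xs
    proof -
      have "Node d xs \<in> cls n c" using that ts(2) by blast
      thus ?thesis using that(2) unfolding main_lists_def Node_cls c(2) by simp
    qed
    have xy: "x \<in> set ts" "y \<in> set ts" by (auto simp: us)
    consider "x = Leaf l" "y = Leaf l" | (L) xs where "x = Leaf l" "y = Node d xs" | (R) xs where "x = Node d xs" "y = Leaf l"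
      | (N) xs ys where "x = Node d xs" "y = Node d ys" "set xs \<subseteq> cls n d" "2 \<le> length xs" "set ys \<subseteq> cls n d" "2 \<le> length ys"
      using node[OF xy(1)] node[OF xy(2)] by blast
    thus ?thesis
    proof cases
      case 1
      thus ?thesis using m(1) ts(1) us Nil by simp
    next
      case L
      have "\<not> direct l xs" using m(2) ml[of xs] xy L ts(1) us Nil by (auto simp: main_def c)
      hence "y \<in> indirect n c l" using ind[OF xy(2)] L by blast
      hence "t \<in> rest_leaf n c l True" using L ts(1) us Nil by (auto simp: rest_leaf_def)
      thus ?thesis by blast
    next
      case R
      have "\<not> direct l xs" using m(2) ml[of xs] xy R ts(1) us Nil by (auto simp: main_def c)
      hence "x \<in> indirect n c l" using ind[OF xy(1)] R by blast
      hence "t \<in> rest_leaf n c l False" using R ts(1) us Nil by (auto simp: rest_leaf_def)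
      thus ?thesis by blast
    next
      case N
      have ev: "tree_eval a t = val c \<longleftrightarrow> tree_eval a (Node d xs) = val c \<and> tree_eval a (Node d ys) = val c" for a
        unfolding ts(1) eval_Node using us Nil N by auto
      have td: "tree_eval a (Node d xs) = val d \<or> tree_eval a (Node d ys) = val d" if "a \<in> assignments n" "lit_eval a l = val d" for a
        using ev[of a] ts(4)[OF that(1)] that(2) c(1) by auto
      have const: "tree_eval a (Node d us) = val c" if "Leaf k \<in> set us" "Leaf (negl k) \<in> set us" for a us k
      proof -
        have "tree_eval a (Leaf k) \<noteq> val d \<or> tree_eval a (Leaf (negl k)) \<noteq> val d" by auto
        hence "tree_eval a (Node d us) \<noteq> val d" unfolding eval_Node using that by blast
        thus ?thesis by (simp add: c)
      qed
      have hd: "\<exists>u v ws. vs = u # v # ws \<and> u \<in> hits n d l \<and> v \<in> hits n d l \<and> set ws \<subseteq> cls n d"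
        if vs: "set vs \<subseteq> cls n d" "2 \<le> length vs" and all: "\<And>a. a \<in> assignments n \<Longrightarrow> lit_eval a l = val d \<Longrightarrow> tree_eval a (Node d vs) = val d" for vs
      proof -
        have "sem n d l v" if "v \<in> set vs" for v
          unfolding sem_def using all that unfolding eval_Node by blast
        hence "v \<in> hits n d l" if "v \<in> set vs" for v using that vs sem_hits[OF _ l] by blast
        moreover obtain u v ws where "vs = u # v # ws" using vs(2) by (cases vs; cases "tl vs") auto
        ultimately show ?thesis using vs by auto
      qed
      show ?thesis
      proof (cases "direct l xs \<and> direct l ys")
        case False
        hence "x \<in> indirect n c l \<or> y \<in> indirect n c l" using ind xy N by blast
        hence "t \<in> rest_indirect n c l True \<or> t \<in> rest_indirect n c l False"
          using h xy ts(1) us Nil unfolding rest_indirect_def by auto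
        thus ?thesis by blast
      next
        case True
        show ?thesis
        proof (cases "(\<exists>k. Leaf k \<in> set xs \<and> Leaf (negl k) \<in> set xs) \<or> (\<exists>k. Leaf k \<in> set ys \<and> Leaf (negl k) \<in> set ys)")
          case True
          thus ?thesis
          proof
            assume "\<exists>k. Leaf k \<in> set xs \<and> Leaf (negl k) \<in> set xs"
            hence "tree_eval a (Node d xs) = val c" for a using const by blast
            hence "tree_eval a (Node d ys) = val d" if "a \<in> assignments n" "lit_eval a l = val d" for a
              using td[OF that] c(1) by auto
            from hd[OF N(5,6) this] obtain u v ws where "ys = u # v # ws" "u \<in> hits n d l" "v \<in> hits n d l" "set ws \<subseteq> cls n d"
              by blast
            hence "t \<in> rest_const n c l True" using h[OF xy(1)] N ts(1) us Nil unfolding rest_const_def c(2) Let_def by force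
            thus ?thesis by blast
          next
            assume "\<exists>k. Leaf k \<in> set ys \<and> Leaf (negl k) \<in> set ys"
            hence "tree_eval a (Node d ys) = val c" for a using const by blast
            hence "tree_eval a (Node d xs) = val d" if "a \<in> assignments n" "lit_eval a l = val d" for a
              using td[OF that] c(1) by auto
            from hd[OF N(3,4) this] obtain u v ws where "xs = u # v # ws" "u \<in> hits n d l" "v \<in> hits n d l" "set ws \<subseteq> cls n d"
              by blast
            hence "t \<in> rest_const n c l False" using h[OF xy(2)] N ts(1) us Nil unfolding rest_const_def c(2) Let_def by force
            thus ?thesis by blast
          qed
        next
          case False
          have split: "\<exists>i u ws. vs = ins i (Leaf l) (u # ws) \<and> i \<le> length ws + 1"
            if vs: "Leaf l \<in> set vs" "2 \<le> length vs" for vs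
          proof -
            obtain p q where pq: "vs = p @ Leaf l # q" using vs(1) by (meson split_list)
            then obtain u ws where "p @ q = u # ws" using vs(2) by (cases "p @ q") auto
            moreover have "vs = ins (length p) (Leaf l) (p @ q)" by (simp add: pq ins_append)
            moreover have "length p \<le> length (p @ q)" by simp
            ultimately show ?thesis by (metis length_Cons Suc_eq_plus1)
          qed
          have "Leaf l \<in> set xs" "Leaf l \<in> set ys" using True False by (auto simp: direct_def)
          with split N obtain i u us' j v vs' where uv: "xs = ins i (Leaf l) (u # us')" "i \<le> length us' + 1"
             "ys = ins j (Leaf l) (v # vs')" "j \<le> length vs' + 1" by metis
          have set_ins: "set (ins k w zs) = insert w (set zs)" for k w zs
            unfolding ins_def by (metis Un_insert_right append_take_drop_id list.simps(15) set_append)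
          have sub: "set (u # us') \<subseteq> cls n d" "set (v # vs') \<subseteq> cls n d" using N uv set_ins by auto
          have uva: "assoc_tree n u" "assoc_tree n v" using sub cls_assoc by auto
          \<comment> \<open>Otherwise some assignment gives \<open>l\<close> the value
            \<open>val d\<close> and both \<open>u\<close> and \<open>v\<close> the value
            \<open>val c\<close>; then neither child of the root has the value \<open>val d\<close>,
            against \<open>td\<close>.\<close>
          have "hit {l} (pat c u @ pat c v)"
          proof (rule ccontr)
            assume nh: "\<not> ?thesis"
            have "set (pat c u @ pat c v) \<subseteq> lits n" using pat_lits[OF uva(1), of c] pat_lits[OF uva(2), of c] by auto
            from no_hit_assignment[OF nh this l, of "val c"] obtain a where a: "a \<in> assignments n" "lit_eval a l = val d"
              "\<forall>y\<in>set (pat c u @ pat c v). lit_eval a y = val c" by (auto simp: c(1))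
            have "tree_eval a u = val c" "tree_eval a v = val c" using a(3) pat_eval[OF uva(1), of c a] pat_eval[OF uva(2), of c a] by auto
            moreover have "u \<in> set xs" "v \<in> set ys" using uv set_ins by auto
            ultimately have "tree_eval a (Node d xs) \<noteq> val d" "tree_eval a (Node d ys) \<noteq> val d"
              unfolding eval_Node c(1) by auto
            thus False using td[OF a(1,2)] by blast
          qed
          hence "t \<in> rest_both n c l" using ts(1) us Nil N(1,2) uv sub unfolding rest_both_def c(2) by blast
          thus ?thesis by blast
        qed
      qed
    qed
  qed
qed

section \<open>Weight bounds\<close>

lemma sum_le_Un:
  fixes f :: "'a \<Rightarrow> real"
  assumes "finite A" "finite B" "S \<subseteq> A \<union> B" "\<And>x. x \<in> A \<union> B \<Longrightarrow> 0 \<le> f x"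
  shows "sum f S \<le> sum f A + sum f B"
proof -
  have "sum f S \<le> sum f (A \<union> B)" using assms by (intro sum_mono2) auto
  also have "\<dots> \<le> sum f A + sum f B"
  proof -
    have "0 \<le> sum f (A \<inter> B)" by (rule sum_nonneg) (use assms in auto)
    thus ?thesis using sum.union_inter[OF assms(1,2), of f] by linarith
  qed
  finally show ?thesis .
qed

lemma sum_filter:
  fixes f :: "'a \<Rightarrow> real"
  shows "finite X \<Longrightarrow> sum f {x\<in>X. P x} = (\<Sum>x\<in>X. f x * of_bool (P x))"
  by (simp add: sum.inter_filter of_bool_def if_distrib cong: if_cong)

lemma sum_pair: "(\<Sum>(x,y)\<in>A \<times> B. f x * g y) = sum f A * (sum g B :: real)"
  by (simp add: sum_product sum.cartesian_product)

lemma set_ins: "set (ins k w zs) = insert w (set zs)"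
  unfolding ins_def by (metis Un_insert_right append_take_drop_id list.simps(15) set_append)

lemma lsize_ins: "lsize (ins j t zs) = lsize zs + leaves t"
proof -
  have "lsize zs = lsize (take j zs) + lsize (drop j zs)" by (simp flip: lsize_simps(3))
  thus ?thesis by (simp add: ins_def)
qed

text \<open>The bound \<open>3 / 10\<close> is slightly larger than \<open>s0\<close>.  It is small enough for the system of equations of the
  pattern-weighted sums to have, at the factor \<open>21 / 20\<close> per pattern literal, the supersolution
  \<open>(39 / 100, 36 / 100)\<close> used in \<open>exp_bound\<close> below.\<close>

locale weights = trees +
  fixes \<nu> :: "nat \<Rightarrow> real" and M :: nat and Cu :: real
  assumes nu_nonneg: "0 \<le> \<nu> i" and nu_add: "\<nu> (i + j) \<le> \<nu> i * \<nu> j" and nu_zero: "\<nu> 0 \<le> 1"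
    and nu_one: "2 * real n * \<nu> 1 \<le> 175/1000"
    and nu_total: "(\<Sum>t\<in>{t \<in> cls n c. leaves t \<le> M}. \<nu> (leaves t)) \<le> 3/10"
    and Cu: "(real L + 2) ^ 6 \<le> Cu * (21/20) ^ L"
begin

definition C :: "connective \<Rightarrow> atree set" where "C c = {t \<in> cls n c. leaves t \<le> M}"
definition mu :: "atree \<Rightarrow> real" where "mu t = \<nu> (leaves t)"
definition mul :: "atree list \<Rightarrow> real" where "mul ts = prod_list (map mu ts)"
abbreviation LL :: "connective \<Rightarrow> atree list set" where "LL d \<equiv> llist (C d) 0 M"
text \<open>The price of one coincidence. Since \<open>Cu\<close> is at least 64, it absorbs small
  numerical factors.\<close>

definition eps :: real where "eps = Cu / real n"

lemma Cu_ge: "Cu \<ge> 64" using Cu[of 0] by simp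

lemma eps_pos: "eps > 0" using Cu_ge n_pos by (simp add: eps_def)

lemma inverse_le_eps: "1 / real n \<le> eps" using Cu_ge n_pos by (simp add: eps_def divide_right_mono)

lemma nu_one_le: "\<nu> 1 \<le> eps"
proof -
  have "real n * \<nu> 1 \<le> Cu" using nu_one Cu_ge by simp
  thus ?thesis using n_pos by (simp add: eps_def field_simps)
qed

lemma finite_C: "finite (C c)"
  by (rule finite_subset[OF _ finite_trees[of n M]]) (auto simp: C_def cls_def)

lemma finite_LL: "finite (llist (C d) k M)" by (rule finite_llist[OF finite_C])

lemma mu_nonneg [simp]: "0 \<le> mu t" by (simp add: mu_def nu_nonneg)

lemma mul_nonneg [simp]: "0 \<le> mul ts" by (auto simp: mul_def intro!: prod_list_nonneg)

lemma mul_simps [simp]: "mul [] = 1" "mul (t # ts) = mu t * mul ts" by (auto simp: mul_def)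

lemma nu_le: "\<nu> i \<le> a \<Longrightarrow> \<nu> j \<le> b \<Longrightarrow> \<nu> (i + j) \<le> a * b"
  using nu_nonneg[of i] nu_nonneg[of j] by (intro order_trans[OF nu_add mult_mono]) auto

lemma nu_lsize: "\<nu> (lsize ts) \<le> mul ts"
  by (induction ts) (auto intro!: nu_le simp: nu_zero mu_def)

lemma mu_Node: "mu (Node c ts) \<le> mul ts"
  unfolding mu_def leaves_Node by (rule nu_lsize)

lemma sum_mu: "(\<Sum>t\<in>C c. mu t) \<le> 3/10" using nu_total[of c] by (simp add: C_def mu_def)

lemma sum_mul: "(\<Sum>ts\<in>LL d. mul ts) \<le> 10/7"
  using sum_llist_prod[OF finite_C _ sum_mu, of d 0 M] by (simp add: mul_def)

lemma LL_I: "set ts \<subseteq> cls n d \<Longrightarrow> lsize ts \<le> M \<Longrightarrow> ts \<in> LL d"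
  using length_le_lsize[of ts n] leaves_le_lsize[of _ ts] cls_assoc[of n d]
  by (fastforce simp: llist_def C_def)

lemma sum_leaves: "(\<Sum>t\<in>Leaf ` lits n. mu t) = 2 * real n * \<nu> 1"
  by (subst sum.reindex) (auto simp: inj_on_def mu_def card_lits)

abbreviation u :: real where "u \<equiv> 21/20"

definition ew :: "connective \<Rightarrow> atree \<Rightarrow> real" where "ew d t = mu t * u ^ length (pat d t)"

lemma ew_nonneg [simp]: "0 \<le> ew d t" by (simp add: ew_def)

lemma ew_list: "prod_list (map (ew d) ts) = mul ts * u ^ length (patl d ts)"
  by (induction ts) (auto simp: ew_def power_add)

text \<open>Leaves contribute at most \<open>u * 175/1000\<close>. Trees with root \<open>d\<close>
  pass on the patterns of all children, whence a geometric series in the second bound; trees with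
  root \<open>opp d\<close> pass on only that of the first child, the others contributing at most
  \<open>(3/10) / (1 - 3/10)\<close>. The induction on \<open>h\<close> starts from empty sets and
  stays below the supersolution.\<close>

lemma exp_bound:
  "h \<le> M \<Longrightarrow> (\<Sum>t\<in>{t \<in> cls n (opp d). leaves t \<le> h}. ew d t) \<le> 39/100 \<and> (\<Sum>t\<in>{t \<in> cls n d. leaves t \<le> h}. ew d t) \<le> 36/100"
proof (induction h)
  case 0
  have E: "{t \<in> cls n c. leaves t \<le> 0} = {}" for c using leaves_pos by (fastforce simp: cls_def)
  show ?case unfolding E by simp
next
  case (Suc h)
  define P where "P = {t \<in> cls n (opp d). leaves t \<le> h}"
  define Q where "Q = {t \<in> cls n d. leaves t \<le> h}"
  have PQC: "P \<subseteq> C (opp d)" "Q \<subseteq> C d" using Suc.prems by (auto simp: P_def Q_def C_def)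
  have fin: "finite P" "finite Q" using PQC finite_C finite_subset by blast+
  have IH: "(\<Sum>t\<in>P. ew d t) \<le> 39/100" "(\<Sum>t\<in>Q. ew d t) \<le> 36/100" using Suc by (auto simp: P_def Q_def)
  have muP: "(\<Sum>t\<in>P. mu t) \<le> 3/10"
    using sum_mono2[OF finite_C PQC(1), of mu] sum_mu[of "opp d"] by simp
  have leafs: "(\<Sum>t\<in>Leaf ` lits n. ew d t) \<le> 18375/100000"
  proof -
    have "(\<Sum>t\<in>Leaf ` lits n. ew d t) = u * (\<Sum>t\<in>Leaf ` lits n. mu t)"
      by (subst (1 2) sum.reindex) (auto simp: inj_on_def ew_def sum_distrib_left mult.commute)
    thus ?thesis using nu_one unfolding sum_leaves by simp
  qed
  have len: "length ts \<le> M \<and> (\<forall>t\<in>set ts. leaves t \<le> h)"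
    if "set ts \<subseteq> cls n c" "2 \<le> length ts" "lsize ts \<le> Suc h" for ts c
  proof
    have a: "assoc_tree n t" if "t \<in> set ts" for t using that \<open>set ts \<subseteq> cls n c\<close> cls_assoc by blast
    show "length ts \<le> M" using length_le_lsize[of ts n] a that Suc.prems by fastforce
    show "\<forall>t\<in>set ts. leaves t \<le> h" using leaves_less_lsize[of ts n] a that by fastforce
  qed
  have "(\<Sum>t\<in>{t \<in> cls n (opp d). leaves t \<le> Suc h}. ew d t) \<le> (\<Sum>t\<in>Leaf ` lits n. ew d t) + (\<Sum>t\<in>Node d ` llist Q 2 M. ew d t)"
  proof (rule sum_le_Un)
    show "{t \<in> cls n (opp d). leaves t \<le> Suc h} \<subseteq> Leaf ` lits n \<union> Node d ` llist Q 2 M"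
    proof
      fix t assume t: "t \<in> {t \<in> cls n (opp d). leaves t \<le> Suc h}"
      show "t \<in> Leaf ` lits n \<union> Node d ` llist Q 2 M"
      proof (cases t)
        case (Leaf l) thus ?thesis using t by simp
      next
        case (Node e ts)
        hence ts: "e = d" "set ts \<subseteq> cls n d" "2 \<le> length ts" "lsize ts \<le> Suc h" using t by (auto simp: lsize_def)
        thus ?thesis using len[OF ts(2-4)] Node by (auto simp: llist_def Q_def)
      qed
    qed
  qed (auto intro: finite_llist fin)
  also have "(\<Sum>t\<in>Node d ` llist Q 2 M. ew d t) \<le> (\<Sum>ts\<in>llist Q 2 M. prod_list (map (ew d) ts))"
    by (rule sum_over_image) (auto simp: finite_llist fin ew_list ew_def intro!: mult_right_mono mu_Node)
  also have "\<dots> \<le> (36/100)^2 / (1 - 36/100)" by (rule sum_llist_prod[OF fin(2) _ IH(2)]) auto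
  finally have 1: "(\<Sum>t\<in>{t \<in> cls n (opp d). leaves t \<le> Suc h}. ew d t) \<le> 39/100" using leafs by (simp add: power2_eq_square)
  have "(\<Sum>t\<in>{t \<in> cls n d. leaves t \<le> Suc h}. ew d t) \<le> (\<Sum>t\<in>Leaf ` lits n. ew d t) + (\<Sum>t\<in>(\<lambda>(t,us). Node (opp d) (t # us)) ` (P \<times> llist P 1 M). ew d t)"
  proof (rule sum_le_Un)
    show "{t \<in> cls n d. leaves t \<le> Suc h} \<subseteq> Leaf ` lits n \<union> (\<lambda>(t,us). Node (opp d) (t # us)) ` (P \<times> llist P 1 M)"
    proof
      fix t assume t: "t \<in> {t \<in> cls n d. leaves t \<le> Suc h}"
      show "t \<in> Leaf ` lits n \<union> (\<lambda>(t,us). Node (opp d) (t # us)) ` (P \<times> llist P 1 M)"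
      proof (cases t)
        case (Leaf l) thus ?thesis using t by simp
      next
        case (Node e ts)
        hence ts: "e = opp d" "set ts \<subseteq> cls n (opp d)" "2 \<le> length ts" "lsize ts \<le> Suc h" using t by (auto simp: lsize_def)
        obtain x us where "ts = x # us" using ts(3) by (cases ts) auto
        thus ?thesis using len[OF ts(2-4)] Node ts by (auto simp: llist_def P_def)
      qed
    qed
  qed (auto intro: finite_llist fin)
  also have "(\<Sum>t\<in>(\<lambda>(t,us). Node (opp d) (t # us)) ` (P \<times> llist P 1 M). ew d t) \<le> (\<Sum>(t,us)\<in>P \<times> llist P 1 M. ew d t * mul us)"
  proof (rule sum_over_image)
    fix x assume "x \<in> P \<times> llist P 1 M"
    obtain t us where x: "x = (t, us)" by (cases x)
    have "mu (Node (opp d) (t # us)) \<le> mu t * mul us" using mu_Node[of "opp d" "t # us"] by simp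
    hence "mu (Node (opp d) (t # us)) * u ^ length (pat d t) \<le> mu t * mul us * u ^ length (pat d t)"
      by (rule mult_right_mono) simp
    thus "ew d (case x of (t, us) \<Rightarrow> Node (opp d) (t # us)) \<le> (case x of (t, us) \<Rightarrow> ew d t * mul us)"
      by (simp add: x ew_def mult.commute mult.left_commute)
  qed (auto simp: finite_llist fin)
  also have "\<dots> = (\<Sum>t\<in>P. ew d t) * (\<Sum>us\<in>llist P 1 M. mul us)" by (rule sum_pair)
  also have "\<dots> \<le> 39/100 * ((3/10)^1 / (1 - 3/10))"
    unfolding mul_def by (intro mult_mono IH sum_llist_prod fin muP) (auto intro!: sum_nonneg prod_list_nonneg)
  finally have "(\<Sum>t\<in>{t \<in> cls n d. leaves t \<le> Suc h}. ew d t) \<le> 36/100" using leafs by simp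
  with 1 show ?case by simp
qed

lemma poly_le: "k \<le> 6 \<Longrightarrow> (real L + 2) ^ k \<le> Cu * u ^ L"
proof -
  assume "k \<le> 6"
  hence "(real L + 2) ^ k \<le> (real L + 2) ^ 6" by (rule power_increasing) simp
  thus ?thesis using Cu[of L] by linarith
qed

section \<open>Moments of the pattern length and the cost of coincidences\<close>

lemma sum_poly_trees:
  assumes "k \<le> 6" shows "(\<Sum>t\<in>C (opp d). mu t * (real (length (pat d t)) + 2) ^ k) \<le> Cu * (39/100)"
proof -
  have "(\<Sum>t\<in>C (opp d). mu t * (real (length (pat d t)) + 2) ^ k) \<le> (\<Sum>t\<in>C (opp d). Cu * ew d t)"
    unfolding ew_def using mult_left_mono[OF poly_le[OF assms] mu_nonneg] by (intro sum_mono) (simp add: mult.left_commute)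
  also have "\<dots> \<le> Cu * (39/100)"
    using exp_bound[of M d] Cu_ge unfolding sum_distrib_left[symmetric] by (intro mult_left_mono) (auto simp: C_def)
  finally show ?thesis .
qed

lemma sum_poly_lists:
  assumes "k \<le> 6" shows "(\<Sum>ts\<in>LL d. mul ts * (real (length (patl d ts)) + 2) ^ k) \<le> 2 * Cu"
proof -
  have "(\<Sum>ts\<in>LL d. mul ts * (real (length (patl d ts)) + 2) ^ k) \<le> (\<Sum>ts\<in>LL d. Cu * prod_list (map (ew d) ts))"
    unfolding ew_list using mult_left_mono[OF poly_le[OF assms] mul_nonneg] by (intro sum_mono) (simp add: mult.left_commute)
  also have "\<dots> \<le> Cu * ((36/100)^0 / (1 - 36/100))"
    unfolding sum_distrib_left[symmetric] using exp_bound[of M d] Cu_ge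
    by (intro mult_left_mono sum_llist_prod finite_C) (auto simp: C_def)
  also have "\<dots> \<le> 2 * Cu" using Cu_ge by simp
  finally show ?thesis .
qed

lemma C_assoc: "t \<in> C c \<Longrightarrow> assoc_tree n t" by (auto simp: C_def cls_def)

lemma LL_assoc: "ts \<in> LL d \<Longrightarrow> t \<in> set ts \<Longrightarrow> assoc_tree n t" by (auto simp: llist_def C_def cls_def)

lemma exch_trees: "exchangeable n (C c) ren (pat d)"
proof
  show "n \<ge> 1" by (rule n_pos)
  show "finite (C c)" by (rule finite_C)
  show "ren \<pi> t \<in> C c" if "\<pi> permutes lits n" "t \<in> C c" for \<pi> t using that by (simp add: C_def ren_cls)
  show "set (pat d t) \<subseteq> lits n" if "t \<in> C c" for t using pat_lits C_assoc that by blast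
qed (simp_all add: pat_ren ren_inv)

lemma mul_ren: "mul (map (ren \<pi>) ts) = mul ts"
  by (induction ts) (auto simp: mu_def)

lemma exch_lists: "exchangeable n (LL d) (\<lambda>\<pi>. map (ren \<pi>)) (patl d)"
proof
  show "n \<ge> 1" by (rule n_pos)
  show "finite (LL d)" by (rule finite_LL)
  show "map (ren \<pi>) t \<in> LL d" if "\<pi> permutes lits n" "t \<in> LL d" for \<pi> t using that by (auto simp: llist_def C_def ren_cls)
  show "set (patl d t) \<subseteq> lits n" if "t \<in> LL d" for t using pat_lits LL_assoc that by (fastforce simp: set_patl)
  show "map (ren (inv \<pi>)) (map (ren \<pi>) t) = t" if "\<pi> permutes lits n" for \<pi> t using that by (simp add: o_def ren_inv)
  show "patl d (map (ren \<pi>) t) = map \<pi> (patl d t)" for \<pi> t by (induction t) (auto simp: pat_ren)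
qed

lemma hit_trees:
  assumes "Z \<subseteq> lits n"
  shows "(\<Sum>t\<in>C (opp d). mu t * of_bool (hit Z (pat d t))) \<le> (real (card Z) + 2) * eps"
proof -
  interpret exchangeable n "C (opp d)" ren "pat d" by (rule exch_trees)
  have "(\<Sum>t\<in>C (opp d). mu t * of_bool (hit Z (pat d t))) \<le> (real (card Z) + 2) / real (2 * n) * (Cu * (39/100))"
    by (rule hit_bound[OF _ assms sum_poly_trees]) (auto simp: invariant_def mu_def nu_nonneg)
  also have "\<dots> = (real (card Z) + 2) * eps * (39/200)" by (simp add: eps_def)
  also have "\<dots> \<le> (real (card Z) + 2) * eps" using eps_pos by simp
  finally show ?thesis .
qed

text \<open>The quadratic factor is carried along because in \<open>sum_N\<close> an insertion
  position and a coincidence with another subtree are already charged to the same list.\<close>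

lemma hit_lists:
  assumes "Z \<subseteq> lits n"
  shows "(\<Sum>ts\<in>LL d. mul ts * (real (length (patl d ts)) + 2) ^ 2 * of_bool (hit Z (patl d ts))) \<le> (real (card Z) + 2) * eps"
proof -
  interpret exchangeable n "LL d" "\<lambda>\<pi>. map (ren \<pi>)" "patl d" by (rule exch_lists)
  have "(\<Sum>ts\<in>LL d. mul ts * (real (length (patl d ts)) + 2) ^ 2 * of_bool (hit Z (patl d ts))) \<le> (real (card Z) + 2) / real (2 * n) * (2 * Cu)"
  proof (rule hit_bound[OF _ assms])
    show "invariant (\<lambda>ts. mul ts * (real (length (patl d ts)) + 2) ^ 2)"
      unfolding invariant_def using p_act by (auto simp: mul_ren)
    show "(\<Sum>x\<in>LL d. mul x * (real (length (patl d x)) + 2)\<^sup>2 * (real (length (patl d x)) + 2)\<^sup>2) \<le> 2 * Cu"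
      using sum_poly_lists[of 4 d] by (simp add: mult.assoc power_add[symmetric])
  qed
  thus ?thesis by (simp add: eps_def)
qed

definition H :: "connective \<Rightarrow> literal \<Rightarrow> atree set" where "H c l = {t \<in> C c. hit {l} (pat (opp c) t)}"

lemma finite_H: "finite (H c l)" using finite_C by (simp add: H_def)

lemma H_I: "t \<in> hits n c l \<Longrightarrow> leaves t \<le> M \<Longrightarrow> t \<in> H c l" by (simp add: H_def hits_def C_def)

lemma sum_H: assumes "l \<in> lits n" shows "(\<Sum>t\<in>H c l. mu t) \<le> 3 * eps"
  using hit_trees[of "{l}" "opp c"] assms by (simp add: H_def sum_filter[OF finite_C])

definition N :: "connective \<Rightarrow> literal \<Rightarrow> atree set" where "N c l = {t \<in> indirect n c l. leaves t \<le> M}"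

lemma finite_N: "finite (N c l)"
  by (rule finite_subset[OF _ finite_C[of c]]) (auto simp: N_def indirect_def C_def)

text \<open>Every child contributes at least one pattern literal, so insertion positions are paid
  for by moments of the pattern length.\<close>

lemma length_le_patl: "ts \<in> LL d \<Longrightarrow> length ts \<le> length (patl d ts)"
proof -
  assume "ts \<in> LL d"
  hence "\<And>t. t \<in> set ts \<Longrightarrow> assoc_tree n t" using LL_assoc by blast
  thus ?thesis
  proof (induction ts)
    case (Cons t ts)
    have "length (pat d t) \<ge> 1" using pat_nonempty[of n t d] Cons.prems by (cases "pat d t") auto
    thus ?case using Cons by fastforce
  qed auto
qed

lemma hit_cond:
  assumes l: "l \<in> lits n" and ps: "set ps \<subseteq> lits n"
  shows "(\<Sum>t\<in>C (opp d). mu t * of_bool (hit (insert l (negl ` set ps)) (pat d t))) \<le> 2 * (real (length ps) + 2) * eps"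
proof -
  have "(\<Sum>t\<in>C (opp d). mu t * of_bool (hit (insert l (negl ` set ps)) (pat d t))) \<le> (real (card (insert l (negl ` set ps))) + 2) * eps"
    using l ps by (intro hit_trees) auto
  also have "\<dots> \<le> 2 * (real (length ps) + 2) * eps"
  proof (intro mult_right_mono)
    have "card (insert l (negl ` set ps)) \<le> Suc (card (negl ` set ps))" by (rule card_insert_le_m1) auto
    also have "card (negl ` set ps) \<le> card (set ps)" by (rule card_image_le) simp
    also have "card (set ps) \<le> length ps" by (rule card_length)
    finally show "real (card (insert l (negl ` set ps))) + 2 \<le> 2 * (real (length ps) + 2)" by simp
  qed (use eps_pos in simp)
  finally show ?thesis .
qed

text \<open>Given \<open>zs\<close>, the position \<open>j\<close> and the coincidence of
  \<open>e1\<close> cost a factor of order \<open>L^2 * eps\<close>. The second coincidence involves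
  \<open>e2\<close>, at a cost of order \<open>L * eps\<close>, or lies within \<open>zs\<close>,
  and then the second \<open>eps\<close> comes from averaging over \<open>zs\<close>.\<close>

lemma sum_N:
  assumes l: "l \<in> lits n" shows "(\<Sum>t\<in>N c l. mu t) \<le> 20 * Cu * eps^2"
proof -
  define d where "d = opp c"
  have c: "c = opp d" "opp c = d" by (simp_all add: d_def)
  define Z where "Z = (\<lambda>zs. insert l (negl ` set (patl d zs)))"
  define A where "A = (\<lambda>zs. {e \<in> C c. hit (Z zs) (pat d e)})"
  define B where "B = (\<lambda>zs. {e \<in> C c. hit {l} (patl d zs @ pat d e)})"
  define T where "T = (SIGMA zs:LL d. ({..length zs} \<times> A zs) \<times> (B zs \<times> LL c))"
  define f where "f = (\<lambda>(zs, (j::nat, e1), (e2, es)). Node d (ins j (Node c (e1 # e2 # es)) zs))"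
  define h where "h = (\<lambda>(zs, (j::nat, e1), (e2, es)). mul zs * ((1 * mu e1) * (mu e2 * mul es)))"
  have fin: "finite (A zs)" "finite (B zs)" for zs using finite_C by (auto simp: A_def B_def)
  have "(\<Sum>t\<in>N c l. mu t) \<le> sum h T"
  proof (rule sum_over_image)
    show "finite T" unfolding T_def using fin finite_LL by auto
    show "N c l \<subseteq> f ` T"
    proof
      fix t assume t: "t \<in> N c l"
      then obtain zs j e1 e2 es where e: "t = Node d (ins j (Node c (e1 # e2 # es)) zs)" "j \<le> length zs"
        "set zs \<subseteq> cls n d" "e1 \<in> cls n c" "e2 \<in> cls n c" "set es \<subseteq> cls n c"
        "hit (Z zs) (pat d e1)" "hit {l} (patl d zs @ pat d e2)"
        using indirect_decomp[of t n c l] l unfolding N_def Z_def d_def by blast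
      have le: "leaves t = lsize zs + (leaves e1 + (leaves e2 + lsize es))"
        unfolding e(1) leaves_Node lsize_ins by simp
      have "leaves t \<le> M" using t by (simp add: N_def)
      hence m: "lsize zs \<le> M" "leaves e1 \<le> M" "leaves e2 \<le> M" "lsize es \<le> M" using le by auto
      have "(zs, (j, e1), (e2, es)) \<in> T" unfolding T_def A_def B_def C_def using e m by (auto intro!: LL_I[unfolded C_def])
      moreover have "t = f (zs, (j, e1), (e2, es))" by (simp add: f_def e(1))
      ultimately show "t \<in> f ` T" by blast
    qed
    fix x assume "x \<in> T"
    obtain zs j e1 e2 es where x: "x = (zs, (j, e1), (e2, es))" by (metis surj_pair)
    show "mu (f x) \<le> h x" unfolding x f_def h_def prod.case mu_def leaves_Node lsize_ins lsize_simps mult_1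
      by (intro nu_le nu_lsize order_refl)
  qed simp
  also have "sum h T = (\<Sum>zs\<in>LL d. \<Sum>((j,e1),(e2,es))\<in>({..length zs} \<times> A zs) \<times> (B zs \<times> LL c). mul zs * ((1 * mu e1) * (mu e2 * mul es)))"
    unfolding T_def h_def using fin finite_LL by (subst sum.Sigma) (auto simp: case_prod_beta)
  also have "\<dots> = (\<Sum>zs\<in>LL d. mul zs * (((real (length zs) + 1) * (\<Sum>e\<in>A zs. mu e)) * ((\<Sum>e\<in>B zs. mu e) * (\<Sum>es\<in>LL c. mul es))))"
  proof (intro sum.cong refl)
    fix zs
    have "(\<Sum>((j,e1),(e2,es))\<in>({..length zs} \<times> A zs) \<times> (B zs \<times> LL c). mul zs * ((1 * mu e1) * (mu e2 * mul es)))
      = mul zs * (\<Sum>(a,b)\<in>({..length zs} \<times> A zs) \<times> (B zs \<times> LL c). (case a of (j,e1) \<Rightarrow> 1 * mu e1) * (case b of (e2,es) \<Rightarrow> mu e2 * mul es))"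
      unfolding sum_distrib_left by (intro sum.cong) auto
    also have "\<dots> = mul zs * ((\<Sum>(j,e1)\<in>{..length zs} \<times> A zs. 1 * mu e1) * (\<Sum>(e2,es)\<in>B zs \<times> LL c. mu e2 * mul es))"
      by (simp only: sum_pair)
    also have "\<dots> = mul zs * ((sum (\<lambda>_. 1) {..length zs} * (\<Sum>e\<in>A zs. mu e)) * ((\<Sum>e\<in>B zs. mu e) * (\<Sum>es\<in>LL c. mul es)))"
      by (simp only: sum_pair)
    finally show "(\<Sum>((j,e1),(e2,es))\<in>({..length zs} \<times> A zs) \<times> (B zs \<times> LL c). mul zs * ((1 * mu e1) * (mu e2 * mul es)))
      = mul zs * (((real (length zs) + 1) * (\<Sum>e\<in>A zs. mu e)) * ((\<Sum>e\<in>B zs. mu e) * (\<Sum>es\<in>LL c. mul es)))"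
      by (simp add: add.commute)
  qed
  also have "\<dots> \<le> (\<Sum>zs\<in>LL d. 6 * eps^2 * (mul zs * (real (length (patl d zs)) + 2) ^ 3)
      + 3 * eps * (mul zs * (real (length (patl d zs)) + 2) ^ 2 * of_bool (hit {l} (patl d zs))))"
  proof (intro sum_mono)
    fix zs assume zs: "zs \<in> LL d"
    define L where "L = real (length (patl d zs)) + 2"
    have L2: "L \<ge> 2" by (simp add: L_def)
    have pl: "set (patl d zs) \<subseteq> lits n" using pat_lits LL_assoc[OF zs] by (fastforce simp: set_patl)
    have a: "(\<Sum>e\<in>A zs. mu e) \<le> 2 * L * eps"
      using hit_cond[OF l pl, of d] by (simp add: A_def sum_filter[OF finite_C] Z_def L_def c(1))
    have b: "(\<Sum>e\<in>B zs. mu e) \<le> 2 * L * eps + of_bool (hit {l} (patl d zs))"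
    proof -
      have "(\<Sum>e\<in>B zs. mu e) = (\<Sum>e\<in>C c. mu e * of_bool (hit {l} (patl d zs @ pat d e)))"
        by (simp add: B_def sum_filter[OF finite_C])
      also have "\<dots> \<le> (\<Sum>e\<in>C c. mu e * of_bool (hit (Z zs) (pat d e)) + mu e * of_bool (hit {l} (patl d zs)))"
        unfolding distrib_left[symmetric]
      proof (intro sum_mono mult_left_mono mu_nonneg)
        fix e
        show "of_bool (hit {l} (patl d zs @ pat d e)) \<le> of_bool (hit (Z zs) (pat d e)) + (of_bool (hit {l} (patl d zs)) :: real)"
          using hit_append[of "{l}" "patl d zs" "pat d e"] by (auto simp: Z_def of_bool_def)
      qed
      also have "\<dots> = (\<Sum>e\<in>C c. mu e * of_bool (hit (Z zs) (pat d e))) + of_bool (hit {l} (patl d zs)) * (\<Sum>e\<in>C c. mu e)"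
        by (simp add: sum.distrib sum_distrib_left mult.commute)
      also have "\<dots> \<le> 2 * L * eps + of_bool (hit {l} (patl d zs)) * 1"
        using hit_cond[OF l pl, of d] sum_mu[of c] by (intro add_mono mult_left_mono) (auto simp: Z_def L_def c(1))
      finally show ?thesis by simp
    qed
    have s: "(\<Sum>es\<in>LL c. mul es) \<le> 3/2" using sum_mul[of c] by simp
    have ln: "real (length zs) + 1 \<le> L" using length_le_patl[OF zs] by (simp add: L_def)
    have nn: "0 \<le> (\<Sum>e\<in>A zs. mu e)" "0 \<le> (\<Sum>e\<in>B zs. mu e)" "0 \<le> (\<Sum>es\<in>LL c. mul es)" by (auto intro!: sum_nonneg)
    have "((real (length zs) + 1) * (\<Sum>e\<in>A zs. mu e)) * ((\<Sum>e\<in>B zs. mu e) * (\<Sum>es\<in>LL c. mul es))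
       \<le> (L * (2 * L * eps)) * ((2 * L * eps + of_bool (hit {l} (patl d zs))) * (3/2))"
      using a b s ln nn L2 eps_pos by (intro mult_mono mult_nonneg_nonneg add_nonneg_nonneg) auto
    also have "\<dots> = 6 * eps^2 * L^3 + 3 * eps * (L^2 * of_bool (hit {l} (patl d zs)))"
      by (simp add: power2_eq_square power3_eq_cube algebra_simps)
    finally have "mul zs * (((real (length zs) + 1) * (\<Sum>e\<in>A zs. mu e)) * ((\<Sum>e\<in>B zs. mu e) * (\<Sum>es\<in>LL c. mul es)))
       \<le> mul zs * (6 * eps^2 * L^3 + 3 * eps * (L^2 * of_bool (hit {l} (patl d zs))))"
      by (rule mult_left_mono) simp
    also have "\<dots> = 6 * eps^2 * (mul zs * L ^ 3) + 3 * eps * (mul zs * L ^ 2 * of_bool (hit {l} (patl d zs)))"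
      by (simp add: algebra_simps)
    finally show "mul zs * (((real (length zs) + 1) * (\<Sum>e\<in>A zs. mu e)) * ((\<Sum>e\<in>B zs. mu e) * (\<Sum>es\<in>LL c. mul es)))
      \<le> 6 * eps^2 * (mul zs * (real (length (patl d zs)) + 2) ^ 3) + 3 * eps * (mul zs * (real (length (patl d zs)) + 2) ^ 2 * of_bool (hit {l} (patl d zs)))"
      unfolding L_def .
  qed
  also have "\<dots> = 6 * eps^2 * (\<Sum>zs\<in>LL d. mul zs * (real (length (patl d zs)) + 2) ^ 3)
      + 3 * eps * (\<Sum>zs\<in>LL d. mul zs * (real (length (patl d zs)) + 2) ^ 2 * of_bool (hit {l} (patl d zs)))"
    by (simp only: sum.distrib sum_distrib_left)
  also have "\<dots> \<le> 6 * eps^2 * (2 * Cu) + 3 * eps * ((real (card {l}) + 2) * eps)"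
    using eps_pos l by (intro add_mono mult_left_mono sum_poly_lists hit_lists) auto
  also have "\<dots> = (12 * Cu + 9) * eps^2" by (simp add: power2_eq_square algebra_simps)
  also have "\<dots> \<le> 20 * Cu * eps^2" using Cu_ge by (intro mult_right_mono) auto
  finally show ?thesis .
qed

section \<open>Weights of the exceptional shapes\<close>

lemma sum_rest_many:
  assumes l: "l \<in> lits n" and S: "R \<subseteq> {t \<in> rest_many n c l. leaves t \<le> M}" shows "(\<Sum>t\<in>R. mu t) \<le> 40 * eps^3"
proof -
  define T where "T = (H c l \<times> H c l) \<times> (H c l \<times> LL c)"
  define f where "f = (\<lambda>((x,y),(z,us)). Node c (x # y # z # us))"
  have "(\<Sum>t\<in>R. mu t) \<le> (\<Sum>(a,b)\<in>T. (case a of (x,y) \<Rightarrow> mu x * mu y) * (case b of (z,us) \<Rightarrow> mu z * mul us))"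
  proof (rule sum_over_image)
    show "finite T" unfolding T_def using finite_H finite_LL by auto
    show "R \<subseteq> f ` T"
    proof
      fix t assume "t \<in> R"
      hence t: "t \<in> {t \<in> rest_many n c l. leaves t \<le> M}" using S by blast
      then obtain x y z us where e: "t = Node c (x # y # z # us)" "x \<in> hits n c l" "y \<in> hits n c l" "z \<in> hits n c l" "set us \<subseteq> cls n c"
        by (auto simp: rest_many_def)
      have "leaves x + (leaves y + (leaves z + lsize us)) \<le> M" using t e(1) by (simp add: lsize_def)
      hence "((x,y),(z,us)) \<in> T" unfolding T_def using e by (auto intro!: H_I LL_I)
      thus "t \<in> f ` T" using e(1) by (force simp: f_def)
    qed
    fix w assume "w \<in> T"
    obtain x y z us where w: "w = ((x,y),(z,us))" by (metis surj_pair)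
    have "\<nu> (leaves x + (leaves y + (leaves z + lsize us))) \<le> mu x * (mu y * (mu z * mul us))"
      unfolding mu_def by (intro nu_le nu_lsize order_refl)
    thus "mu (f w) \<le> (case w of (a,b) \<Rightarrow> (case a of (x,y) \<Rightarrow> mu x * mu y) * (case b of (z,us) \<Rightarrow> mu z * mul us))"
      unfolding w f_def prod.case mu_def leaves_Node lsize_simps by (simp add: mult.assoc)
  qed simp
  also have "\<dots> = ((\<Sum>x\<in>H c l. mu x) * (\<Sum>x\<in>H c l. mu x)) * ((\<Sum>x\<in>H c l. mu x) * (\<Sum>us\<in>LL c. mul us))"
    unfolding T_def by (simp only: sum_pair)
  also have "\<dots> \<le> ((3 * eps) * (3 * eps)) * ((3 * eps) * (10/7))"
    using eps_pos by (intro mult_mono sum_H sum_mul l mult_nonneg_nonneg sum_nonneg) auto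
  also have "\<dots> \<le> 40 * eps^3" using eps_pos by (simp add: power3_eq_cube)
  finally show ?thesis .
qed

lemma sum_rest_leaf:
  assumes l: "l \<in> lits n" and S: "R \<subseteq> {t \<in> rest_leaf n c l b. leaves t \<le> M}" shows "(\<Sum>t\<in>R. mu t) \<le> 20 * Cu * eps^3"
proof -
  define f where "f = (\<lambda>x. Node c (if b then [Leaf l, x] else [x, Leaf l]))"
  have "(\<Sum>t\<in>R. mu t) \<le> (\<Sum>x\<in>N c l. \<nu> 1 * mu x)"
  proof (rule sum_over_image)
    show "finite (N c l)" by (rule finite_N)
    show "R \<subseteq> f ` N c l" using S by (force simp: rest_leaf_def f_def N_def split: if_splits)
    fix x
    have "\<nu> (1 + leaves x) \<le> \<nu> 1 * mu x" unfolding mu_def by (rule nu_add)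
    thus "mu (f x) \<le> \<nu> 1 * mu x" by (simp add: f_def mu_def add.commute)
  qed simp
  also have "\<dots> = \<nu> 1 * (\<Sum>x\<in>N c l. mu x)" by (simp add: sum_distrib_left)
  also have "\<dots> \<le> eps * (20 * Cu * eps^2)" using eps_pos by (intro mult_mono nu_one_le sum_N l sum_nonneg) auto
  finally show ?thesis by (simp add: power2_eq_square power3_eq_cube mult.assoc mult.left_commute)
qed

lemma sum_rest_indirect:
  assumes l: "l \<in> lits n" and S: "R \<subseteq> {t \<in> rest_indirect n c l b. leaves t \<le> M}" shows "(\<Sum>t\<in>R. mu t) \<le> 60 * Cu * eps^3"
proof -
  define f where "f = (\<lambda>(x,y). Node c (if b then [x, y] else [y, x]))"
  have "(\<Sum>t\<in>R. mu t) \<le> (\<Sum>(x,y)\<in>N c l \<times> H c l. mu x * mu y)"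
  proof (rule sum_over_image)
    show "finite (N c l \<times> H c l)" using finite_N finite_H by auto
    show "R \<subseteq> f ` (N c l \<times> H c l)"
    proof
      fix t assume "t \<in> R"
      hence t: "t \<in> rest_indirect n c l b" "leaves t \<le> M" using S by auto
      then obtain x y where e: "t = f (x, y)" "x \<in> indirect n c l" "y \<in> hits n c l" by (auto simp: rest_indirect_def f_def)
      have "leaves x + leaves y \<le> M" using t(2) unfolding e(1) f_def by (auto split: if_splits)
      hence "(x, y) \<in> N c l \<times> H c l" using e by (auto simp: N_def intro!: H_I)
      thus "t \<in> f ` (N c l \<times> H c l)" using e(1) by blast
    qed
    fix w assume "w \<in> N c l \<times> H c l"
    obtain x y where w: "w = (x, y)" by (cases w)
    show "mu (f w) \<le> (case w of (x,y) \<Rightarrow> mu x * mu y)" using nu_add[of "leaves x" "leaves y"]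
      by (simp add: f_def mu_def w add.commute)
  qed simp
  also have "\<dots> = (\<Sum>x\<in>N c l. mu x) * (\<Sum>x\<in>H c l. mu x)" by (rule sum_pair)
  also have "\<dots> \<le> (20 * Cu * eps^2) * (3 * eps)" using eps_pos Cu_ge by (intro mult_mono sum_N sum_H l sum_nonneg) auto
  finally show ?thesis by (simp add: power2_eq_square power3_eq_cube mult.assoc mult.left_commute)
qed

lemma sum_rest_const:
  assumes l: "l \<in> lits n" and S: "R \<subseteq> {t \<in> rest_const n c l b. leaves t \<le> M}" shows "(\<Sum>t\<in>R. mu t) \<le> 40 * eps^3"
proof -
  define T where "T = (H c l \<times> H (opp c) l) \<times> (H (opp c) l \<times> LL (opp c))"
  define f where "f = (\<lambda>((x,y),(z,us)). Node c (let w = Node (opp c) (y # z # us) in if b then [x, w] else [w, x]))"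
  have "(\<Sum>t\<in>R. mu t) \<le> (\<Sum>(a,b)\<in>T. (case a of (x,y) \<Rightarrow> mu x * mu y) * (case b of (z,us) \<Rightarrow> mu z * mul us))"
  proof (rule sum_over_image)
    show "finite T" unfolding T_def using finite_H finite_LL by auto
    have lf: "leaves (f ((x,y),(z,us))) = leaves x + (leaves y + (leaves z + lsize us))" for x y z us
      unfolding f_def by (simp add: Let_def lsize_def)
    show "R \<subseteq> f ` T"
    proof
      fix t assume "t \<in> R"
      hence t: "t \<in> {t \<in> rest_const n c l b. leaves t \<le> M}" using S by blast
      then obtain x y z us where e: "t = f ((x,y),(z,us))" "x \<in> hits n c l" "y \<in> hits n (opp c) l" "z \<in> hits n (opp c) l" "set us \<subseteq> cls n (opp c)"
        by (auto simp: rest_const_def f_def)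
      have "leaves x + (leaves y + (leaves z + lsize us)) \<le> M" using t unfolding e(1) lf[symmetric] by simp
      hence "((x,y),(z,us)) \<in> T" unfolding T_def using e by (auto intro!: H_I LL_I)
      thus "t \<in> f ` T" using e(1) by blast
    qed
    fix w assume "w \<in> T"
    obtain x y z us where w: "w = ((x,y),(z,us))" by (metis surj_pair)
    have "\<nu> (leaves x + (leaves y + (leaves z + lsize us))) \<le> mu x * (mu y * (mu z * mul us))"
      unfolding mu_def by (intro nu_le nu_lsize order_refl)
    thus "mu (f w) \<le> (case w of (a,b) \<Rightarrow> (case a of (x,y) \<Rightarrow> mu x * mu y) * (case b of (z,us) \<Rightarrow> mu z * mul us))"
      unfolding w mu_def[of "f _"] lf by (simp add: mult.assoc)
  qed simp
  also have "\<dots> = ((\<Sum>x\<in>H c l. mu x) * (\<Sum>x\<in>H (opp c) l. mu x)) * ((\<Sum>x\<in>H (opp c) l. mu x) * (\<Sum>us\<in>LL (opp c). mul us))"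
    unfolding T_def by (simp only: sum_pair)
  also have "\<dots> \<le> ((3 * eps) * (3 * eps)) * ((3 * eps) * (10/7))"
    using eps_pos by (intro mult_mono sum_H sum_mul l mult_nonneg_nonneg sum_nonneg) auto
  also have "\<dots> \<le> 40 * eps^3" using eps_pos by (simp add: power3_eq_cube)
  finally show ?thesis .
qed

text \<open>Conditioning on \<open>x\<close>, the coincidence either involves \<open>y\<close>, at a
  cost linear in the pattern length of \<open>x\<close>, or lies within the pattern of
  \<open>x\<close>.\<close>

lemma sum_hit_pairs:
  assumes l: "l \<in> lits n"
  shows "(\<Sum>(x,y)\<in>{(x,y). x \<in> C (opp c) \<and> y \<in> C (opp c) \<and> hit {l} (pat c x @ pat c y)}. mu x * mu y) \<le> 2 * Cu * eps"
proof -
  have "{(x,y). x \<in> C (opp c) \<and> y \<in> C (opp c) \<and> hit {l} (pat c x @ pat c y)} = (SIGMA x:C (opp c). {y \<in> C (opp c). hit {l} (pat c x @ pat c y)})"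
    by auto
  hence "(\<Sum>(x,y)\<in>{(x,y). x \<in> C (opp c) \<and> y \<in> C (opp c) \<and> hit {l} (pat c x @ pat c y)}. mu x * mu y)
     = (\<Sum>x\<in>C (opp c). \<Sum>y\<in>{y \<in> C (opp c). hit {l} (pat c x @ pat c y)}. mu x * mu y)"
    using finite_C by (simp add: sum.Sigma)
  also have "\<dots> = (\<Sum>x\<in>C (opp c). mu x * (\<Sum>y\<in>C (opp c). mu y * of_bool (hit {l} (pat c x @ pat c y))))"
    by (simp add: sum_distrib_left[symmetric] sum_filter[OF finite_C])
  also have "\<dots> \<le> (\<Sum>x\<in>C (opp c). 2 * eps * (mu x * (real (length (pat c x)) + 2) ^ 1) + mu x * of_bool (hit {l} (pat c x)))"
  proof (intro sum_mono)
    fix x assume x: "x \<in> C (opp c)"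
    have pl: "set (pat c x) \<subseteq> lits n" using pat_lits C_assoc[OF x] by blast
    let ?Z = "insert l (negl ` set (pat c x))"
    have "(\<Sum>y\<in>C (opp c). mu y * of_bool (hit {l} (pat c x @ pat c y))) \<le> (\<Sum>y\<in>C (opp c). mu y * of_bool (hit ?Z (pat c y)) + mu y * of_bool (hit {l} (pat c x)))"
      unfolding distrib_left[symmetric]
    proof (intro sum_mono mult_left_mono mu_nonneg)
      fix y
      show "of_bool (hit {l} (pat c x @ pat c y)) \<le> of_bool (hit ?Z (pat c y)) + (of_bool (hit {l} (pat c x)) :: real)"
        using hit_append[of "{l}" "pat c x" "pat c y"] by (auto simp: of_bool_def)
    qed
    also have "\<dots> = (\<Sum>y\<in>C (opp c). mu y * of_bool (hit ?Z (pat c y))) + of_bool (hit {l} (pat c x)) * (\<Sum>y\<in>C (opp c). mu y)"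
      by (simp add: sum.distrib sum_distrib_left mult.commute)
    also have "\<dots> \<le> 2 * (real (length (pat c x)) + 2) * eps + of_bool (hit {l} (pat c x)) * 1"
      using hit_cond[OF l pl, of c] sum_mu[of "opp c"] by (intro add_mono mult_left_mono) auto
    finally have "mu x * (\<Sum>y\<in>C (opp c). mu y * of_bool (hit {l} (pat c x @ pat c y))) \<le> mu x * (2 * (real (length (pat c x)) + 2) * eps + of_bool (hit {l} (pat c x)) * 1)"
      by (rule mult_left_mono) simp
    thus "mu x * (\<Sum>y\<in>C (opp c). mu y * of_bool (hit {l} (pat c x @ pat c y))) \<le> 2 * eps * (mu x * (real (length (pat c x)) + 2) ^ 1) + mu x * of_bool (hit {l} (pat c x))"
      by (simp add: algebra_simps)
  qed
  also have "\<dots> = 2 * eps * (\<Sum>x\<in>C (opp c). mu x * (real (length (pat c x)) + 2) ^ 1) + (\<Sum>x\<in>C (opp c). mu x * of_bool (hit {l} (pat c x)))"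
    by (simp only: sum.distrib sum_distrib_left)
  also have "\<dots> \<le> 2 * eps * (Cu * (39/100)) + (real (card {l}) + 2) * eps"
    using eps_pos l by (intro add_mono mult_left_mono sum_poly_trees hit_trees) auto
  also have "\<dots> = (78/100 * Cu + 3) * eps" by (simp add: algebra_simps)
  also have "\<dots> \<le> (2 * Cu) * eps" using Cu_ge eps_pos by (intro mult_right_mono) auto
  finally show ?thesis .
qed

text \<open>Beside \<open>length xs + 1\<close> other children the leaf \<open>l\<close> has
  \<open>length xs + 2\<close> possible positions. Its weight \<open>\<nu> 1\<close> supplies one
  \<open>eps\<close> on each side, and \<open>sum_hit_pairs\<close> supplies the third.\<close>

lemma sum_rest_both:
  assumes l: "l \<in> lits n" and S: "R \<subseteq> {t \<in> rest_both n c l. leaves t \<le> M}" shows "(\<Sum>t\<in>R. mu t) \<le> 8 * Cu^3 * eps^3"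
proof -
  define d where "d = opp c"
  define S where "S = (SIGMA zs:LL d. {..length zs + 1})"
  define K where "K = {(x,y). x \<in> C d \<and> y \<in> C d \<and> hit {l} (pat c x @ pat c y)}"
  define f where "f = (\<lambda>(((xs, i), (ys, j)), (x, y)). Node c [Node d (ins i (Leaf l) (x # xs)), Node d (ins j (Leaf l) (y # ys))])"
  define h where "h = (\<lambda>(a, b). (case a of (a1, a2) \<Rightarrow> (case a1 of (xs, i::nat) \<Rightarrow> \<nu> 1 * mul xs) * (case a2 of (ys, j::nat) \<Rightarrow> \<nu> 1 * mul ys)) * (case b of (x, y) \<Rightarrow> mu x * mu y))"
  have finK: "finite K" by (rule finite_subset[of _ "C d \<times> C d"]) (auto simp: K_def finite_C)
  have finS: "finite S" unfolding S_def using finite_LL by auto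
  have "(\<Sum>t\<in>R. mu t) \<le> sum h ((S \<times> S) \<times> K)"
  proof (rule sum_over_image)
    show "finite ((S \<times> S) \<times> K)" using finK finS by auto
    have lf: "leaves (f (((xs, i), (ys, j)), (x, y))) = ((1 + lsize xs) + (1 + lsize ys)) + (leaves x + leaves y)" for xs i ys j x y
      unfolding f_def prod.case leaves_Node lsize_simps lsize_ins by simp
    show "R \<subseteq> f ` ((S \<times> S) \<times> K)"
    proof
      fix t assume "t \<in> R"
      hence t: "t \<in> {t \<in> rest_both n c l. leaves t \<le> M}" using S by blast
      then obtain x xs i y ys j where e: "t = f (((xs, i), (ys, j)), (x, y))" "set (x # xs) \<subseteq> cls n d" "set (y # ys) \<subseteq> cls n d"
        "i \<le> length xs + 1" "j \<le> length ys + 1" "hit {l} (pat c x @ pat c y)"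
        unfolding rest_both_def f_def d_def by auto
      have "leaves (f (((xs, i), (ys, j)), (x, y))) \<le> M" using t e(1) by simp
      hence "((1 + lsize xs) + (1 + lsize ys)) + (leaves x + leaves y) \<le> M" unfolding lf .
      hence "(((xs, i), (ys, j)), (x, y)) \<in> (S \<times> S) \<times> K"
        using e by (auto simp: S_def K_def C_def intro!: LL_I[unfolded C_def])
      thus "t \<in> f ` ((S \<times> S) \<times> K)" using e(1) by blast
    qed
    fix w assume "w \<in> (S \<times> S) \<times> K"
    obtain xs i ys j x y where w: "w = (((xs, i), (ys, j)), (x, y))" by (metis surj_pair)
    show "mu (f w) \<le> h w"
      unfolding w mu_def[of "f _"] lf h_def prod.case mu_def by (intro nu_le nu_lsize order_refl)
  qed simp
  also have "sum h ((S \<times> S) \<times> K) = ((\<Sum>(xs,i)\<in>S. \<nu> 1 * mul xs) * (\<Sum>(xs,i)\<in>S. \<nu> 1 * mul xs)) * (\<Sum>(x,y)\<in>K. mu x * mu y)"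
    unfolding h_def by (simp only: sum_pair)
  also have "(\<Sum>(xs,i)\<in>S. \<nu> 1 * mul xs) = (\<Sum>xs\<in>LL d. \<Sum>i\<in>{..length xs + 1}. \<nu> 1 * mul xs)"
    unfolding S_def using finite_LL by (subst sum.Sigma) auto
  also have "\<dots> = \<nu> 1 * (\<Sum>xs\<in>LL d. mul xs * (real (length xs) + 2))"
    by (simp add: sum_distrib_left mult.commute mult.left_commute add.commute)
  also have "(\<nu> 1 * (\<Sum>xs\<in>LL d. mul xs * (real (length xs) + 2))) * (\<nu> 1 * (\<Sum>xs\<in>LL d. mul xs * (real (length xs) + 2))) * (\<Sum>(x,y)\<in>K. mu x * mu y)
     \<le> ((eps * (2 * Cu)) * (eps * (2 * Cu))) * (2 * Cu * eps)"
  proof -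
    have "(\<Sum>xs\<in>LL d. mul xs * (real (length xs) + 2)) \<le> (\<Sum>xs\<in>LL d. mul xs * (real (length (patl d xs)) + 2) ^ 1)"
      using length_le_patl by (intro sum_mono mult_left_mono) auto
    also have "\<dots> \<le> 2 * Cu" by (rule sum_poly_lists) simp
    finally have 1: "(\<Sum>xs\<in>LL d. mul xs * (real (length xs) + 2)) \<le> 2 * Cu" .
    have 2: "(\<Sum>(x,y)\<in>K. mu x * mu y) \<le> 2 * Cu * eps" unfolding K_def d_def by (rule sum_hit_pairs[OF l])
    show ?thesis using eps_pos Cu_ge nu_nonneg[of 1]
      by (intro mult_mono nu_one_le 1 2 mult_nonneg_nonneg sum_nonneg) auto
  qed
  also have "\<dots> = 8 * Cu^3 * eps^3" by (simp add: power3_eq_cube)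
  finally show ?thesis .
qed

lemma sum_rest:
  assumes l: "l \<in> lits n"
  shows "(\<Sum>t\<in>{t \<in> computing n c l - main n c l. leaves t \<noteq> 2 \<and> leaves t \<le> M}. mu t) \<le> 300 * Cu^3 * eps^3"
proof -
  let ?D = "{t \<in> computing n c l. leaves t \<noteq> 2 \<and> t \<notin> main n c l}"
  have sub: "?D \<subseteq> Collect (assoc_tree n)" using cls_assoc by (auto simp: computing_def)
  let ?r = "\<lambda>R. {t \<in> ?D. t \<in> R \<and> leaves t \<le> M}"
  have fin: "finite (?r R)" for R by (rule finite_subset[OF _ finite_trees[of n M]]) (use sub in auto)
  have "{t \<in> computing n c l - main n c l. leaves t \<noteq> 2 \<and> leaves t \<le> M} \<subseteq>
     ?r (rest_many n c l) \<union> (?r (rest_leaf n c l True) \<union> (?r (rest_leaf n c l False) \<union> (?r (rest_indirect n c l True) \<union>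
       (?r (rest_indirect n c l False) \<union> (?r (rest_const n c l True) \<union> (?r (rest_const n c l False) \<union> ?r (rest_both n c l)))))))"
    (is "_ \<subseteq> ?U")
  proof
    fix t assume t: "t \<in> {t \<in> computing n c l - main n c l. leaves t \<noteq> 2 \<and> leaves t \<le> M}"
    hence "t \<in> rest_many n c l \<union> (\<Union>b. rest_leaf n c l b \<union> rest_indirect n c l b \<union> rest_const n c l b) \<union> rest_both n c l"
      by (intro computing_decomp l) auto
    then consider "t \<in> rest_many n c l" | b where "t \<in> rest_leaf n c l b" | b where "t \<in> rest_indirect n c l b"
      | b where "t \<in> rest_const n c l b" | "t \<in> rest_both n c l" by blast
    thus "t \<in> ?U"
    proof cases
      case (2 b) thus ?thesis using t by (cases b) auto
    next
      case (3 b) thus ?thesis using t by (cases b) auto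
    next
      case (4 b) thus ?thesis using t by (cases b) auto
    qed (use t in auto)
  qed
  hence "(\<Sum>t\<in>{t \<in> computing n c l - main n c l. leaves t \<noteq> 2 \<and> leaves t \<le> M}. mu t) \<le> sum mu ?U"
    using fin by (intro sum_mono2) auto
  also have "\<dots> \<le> sum mu (?r (rest_many n c l)) + (sum mu (?r (rest_leaf n c l True)) + (sum mu (?r (rest_leaf n c l False)) + (sum mu (?r (rest_indirect n c l True)) +
       (sum mu (?r (rest_indirect n c l False)) + (sum mu (?r (rest_const n c l True)) + (sum mu (?r (rest_const n c l False)) + sum mu (?r (rest_both n c l))))))))"
    by (intro order_trans[OF sum_le_Un[OF _ _ order_refl]] add_left_mono finite_UnI fin mu_nonneg order_refl)
  also have "\<dots> \<le> 40 * eps^3 + (20 * Cu * eps^3 + (20 * Cu * eps^3 + (60 * Cu * eps^3 + (60 * Cu * eps^3 + (40 * eps^3 + (40 * eps^3 + 8 * Cu^3 * eps^3))))))"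
    by (intro add_mono sum_rest_many sum_rest_leaf sum_rest_indirect sum_rest_const sum_rest_both) (use l in auto)
  also have "\<dots> = (120 + 160 * Cu + 8 * Cu^3) * eps^3" by (simp add: algebra_simps)
  also have "\<dots> \<le> (300 * Cu^3) * eps^3"
  proof (intro mult_right_mono)
    have "Cu * 1 \<le> Cu * Cu^2" using Cu_ge one_le_power[of Cu 2] by (intro mult_left_mono) auto
    hence "Cu \<le> Cu^3" by (simp add: power3_eq_cube power2_eq_square)
    thus "120 + 160 * Cu + 8 * Cu^3 \<le> 300 * Cu^3" using Cu_ge by simp
  qed (use eps_pos in simp)
  finally show ?thesis by simp
qed

end

section \<open>Direct witnesses\<close>

text \<open>Index 0 is free for the witness \<open>l\<close> because variables are numbered from 1;
  an index \<open>i \<ge> 1\<close> stands for the complementary pair of variable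
  \<open>i\<close>.\<close>

definition evset :: "literal \<Rightarrow> nat \<Rightarrow> literal set" where
  "evset l i = (if i = 0 then {l} else {Pos i, Neg i})"

definition ev :: "literal \<Rightarrow> nat \<Rightarrow> atree list \<Rightarrow> bool" where
  "ev l i ts \<longleftrightarrow> Leaf ` evset l i \<subseteq> set ts"

lemma direct_ev:
  assumes "set ts \<subseteq> cls n d"
  shows "direct l ts \<longleftrightarrow> (\<exists>i\<in>{0..n}. ev l i ts)"
proof
  assume "direct l ts"
  then obtain y where y: "Leaf y \<in> set ts" "y = l \<or> Leaf (negl y) \<in> set ts" by (auto simp: direct_def)
  from y(2) show "\<exists>i\<in>{0..n}. ev l i ts"
  proof
    assume "y = l" thus ?thesis using y(1) by (intro bexI[of _ 0]) (auto simp: ev_def evset_def)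
  next
    assume ny: "Leaf (negl y) \<in> set ts"
    have "y \<in> lits n" using y(1) assms by (metis Leaf_cls subsetD)
    hence i: "lit_var y \<in> {1..n}" by (simp add: lits_def)
    have "ev l (lit_var y) ts"
    proof (cases y)
      case (Pos j) thus ?thesis using i y(1) ny by (simp add: ev_def evset_def)
    next
      case (Neg j) thus ?thesis using i y(1) ny by (simp add: ev_def evset_def)
    qed
    thus ?thesis using i by (intro bexI[of _ "lit_var y"]) auto
  qed
next
  assume "\<exists>i\<in>{0..n}. ev l i ts"
  then obtain i where i: "ev l i ts" by auto
  show "direct l ts"
  proof (cases "i = 0")
    case True thus ?thesis using i by (auto simp: ev_def evset_def direct_def)
  next
    case False
    hence "Leaf (Pos i) \<in> set ts" "Leaf (negl (Pos i)) \<in> set ts" using i by (auto simp: ev_def evset_def)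
    thus ?thesis unfolding direct_def by blast
  qed
qed

lemma evset_lits: "l \<in> lits n \<Longrightarrow> i \<le> n \<Longrightarrow> evset l i \<subseteq> lits n"
  by (auto simp: evset_def lits_def)

context weights
begin

text \<open>Both events together force \<open>k\<close> distinct literals to occur as leaf children,
  hence in the pattern, where \<open>exchange_bound\<close> applies.\<close>

lemma pair_bound_card:
  assumes l: "l \<in> lits n" and ij: "i \<le> n" "j \<le> n" and k: "card (evset l i \<union> evset l j) = k" "1 \<le> k" "k \<le> 6"
  shows "(\<Sum>ts\<in>LL d. mul ts * of_bool (ev l i ts \<and> ev l j ts)) \<le> (real k / real (2 * n)) ^ k * (2 * Cu)"
proof -
  interpret exchangeable n "LL d" "\<lambda>\<pi>. map (ren \<pi>)" "patl d" by (rule exch_lists)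
  define Y where "Y = evset l i \<union> evset l j"
  have Y: "Y \<subseteq> lits n" using evset_lits l ij by (auto simp: Y_def)
  have "(\<Sum>ts\<in>LL d. mul ts * of_bool (ev l i ts \<and> ev l j ts)) \<le> (\<Sum>ts\<in>LL d. mul ts * (\<Prod>y\<in>Y. real (count_list (patl d ts) y)))"
  proof (intro sum_mono mult_left_mono mul_nonneg)
    fix ts
    show "of_bool (ev l i ts \<and> ev l j ts) \<le> (\<Prod>y\<in>Y. real (count_list (patl d ts) y))"
    proof (cases "ev l i ts \<and> ev l j ts")
      case True
      have "1 \<le> (\<Prod>y\<in>Y. real (count_list (patl d ts) y))"
      proof (rule prod_ge_1)
        fix y assume "y \<in> Y"
        hence "Leaf y \<in> set ts" using True by (auto simp: Y_def ev_def)
        hence "y \<in> set (patl d ts)" unfolding set_patl by force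
        hence "count_list (patl d ts) y \<noteq> 0" by (simp add: count_list_0_iff)
        thus "1 \<le> real (count_list (patl d ts) y)" by simp
      qed
      thus ?thesis by simp
    qed (auto intro!: prod_nonneg)
  qed
  also have "\<dots> \<le> (real k / real (2 * n)) ^ k * (\<Sum>ts\<in>LL d. mul ts * real (length (patl d ts)) ^ k)"
    by (rule exchange_bound) (use Y k in \<open>auto simp: invariant_def mul_ren Y_def\<close>)
  also have "\<dots> \<le> (real k / real (2 * n)) ^ k * (2 * Cu)"
  proof (intro mult_left_mono)
    have "(\<Sum>ts\<in>LL d. mul ts * real (length (patl d ts)) ^ k) \<le> (\<Sum>ts\<in>LL d. mul ts * (real (length (patl d ts)) + 2) ^ k)"
      by (intro sum_mono mult_left_mono power_mono) auto
    also have "\<dots> \<le> 2 * Cu" by (rule sum_poly_lists[OF k(3)])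
    finally show "(\<Sum>ts\<in>LL d. mul ts * real (length (patl d ts)) ^ k) \<le> 2 * Cu" .
  qed simp
  finally show ?thesis .
qed

text \<open>Two different events involve four distinct literals, or three if one of them is the
  event of \<open>l\<close>; only the pair of the variable of \<open>l\<close> contains
  \<open>l\<close> itself and leaves two. The cases 4, 3 and 2 of \<open>pair_bound_card\<close>
  give the constants, \<open>27/4\<close> being rounded up to 7.\<close>

lemma pair_bound:
  assumes l: "l \<in> lits n" and ij: "i \<le> n" "j \<le> n" "i \<noteq> j"
  shows "(\<Sum>ts\<in>LL d. mul ts * of_bool (ev l i ts \<and> ev l j ts)) \<le>
     32 * Cu / real n ^ 4 + (if i = 0 then 7 * Cu / real n ^ 3 else 0) + (if j = 0 then 7 * Cu / real n ^ 3 else 0)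
     + (if i = 0 then if j = lit_var l then 2 * Cu / real n ^ 2 else 0 else 0) + (if i = lit_var l then if j = 0 then 2 * Cu / real n ^ 2 else 0 else 0)"
    (is "?S \<le> ?B")
proof -
  define v where "v = lit_var l"
  have v: "v \<noteq> 0" using l by (auto simp: v_def lits_def)
  have lv: "l = Pos v \<or> l = Neg v" by (cases l) (auto simp: v_def)
  have nn: "0 \<le> 32 * Cu / real n ^ 4" "0 \<le> 7 * Cu / real n ^ 3" "0 \<le> 2 * Cu / real n ^ 2"
    using Cu_ge by auto
  have n0: "real n > 0" using n_pos by simp
  consider (a) "i \<noteq> 0" "j \<noteq> 0" | (b) "i = 0" "j \<noteq> v" "j \<noteq> 0" | (c) "j = 0" "i \<noteq> v" "i \<noteq> 0" | (d) "i = 0" "j = v" | (e) "j = 0" "i = v"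
    using ij by metis
  thus ?thesis
  proof cases
    case a
    hence "card (evset l i \<union> evset l j) = 4" using ij by (simp add: evset_def)
    hence "?S \<le> (real 4 / real (2 * n)) ^ 4 * (2 * Cu)" using l ij by (intro pair_bound_card) auto
    also have "\<dots> = 32 * Cu / real n ^ 4" by (simp add: power_divide power_mult_distrib)
    finally have "?S \<le> 32 * Cu / real n ^ 4" .
    moreover have "32 * Cu / real n ^ 4 \<le> ?B" using nn a by auto
    ultimately show ?thesis by (rule order_trans)
  next
    case b
    hence "card (evset l i \<union> evset l j) = 3" using lv by (auto simp: evset_def)
    hence "?S \<le> (real 3 / real (2 * n)) ^ 3 * (2 * Cu)" using l ij by (intro pair_bound_card) auto
    also have "\<dots> = 27 / 4 * Cu / real n ^ 3" by (simp add: power_divide power_mult_distrib)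
    also have "\<dots> \<le> 7 * Cu / real n ^ 3" using Cu_ge n0 by (intro divide_right_mono) auto
    finally show ?thesis using nn b by (simp add: v_def)
  next
    case c
    hence "card (evset l i \<union> evset l j) = 3" using lv by (auto simp: evset_def)
    hence "?S \<le> (real 3 / real (2 * n)) ^ 3 * (2 * Cu)" using l ij by (intro pair_bound_card) auto
    also have "\<dots> = 27 / 4 * Cu / real n ^ 3" by (simp add: power_divide power_mult_distrib)
    also have "\<dots> \<le> 7 * Cu / real n ^ 3" using Cu_ge n0 by (intro divide_right_mono) auto
    finally show ?thesis using nn c by (simp add: v_def)
  next
    case d
    hence "evset l i \<union> evset l j = {Pos v, Neg v}" using lv v by (auto simp: evset_def)
    hence "card (evset l i \<union> evset l j) = 2" by simp
    hence "?S \<le> (real 2 / real (2 * n)) ^ 2 * (2 * Cu)" using l ij by (intro pair_bound_card) auto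
    also have "\<dots> = 2 * Cu / real n ^ 2" by (simp add: power_divide power_mult_distrib)
    finally show ?thesis using nn d v by (simp add: v_def)
  next
    case e
    hence "evset l i \<union> evset l j = {Pos v, Neg v}" using lv v by (auto simp: evset_def)
    hence "card (evset l i \<union> evset l j) = 2" by simp
    hence "?S \<le> (real 2 / real (2 * n)) ^ 2 * (2 * Cu)" using l ij by (intro pair_bound_card) auto
    also have "\<dots> = 2 * Cu / real n ^ 2" by (simp add: power_divide power_mult_distrib)
    finally show ?thesis using nn e v by (simp add: v_def)
  qed
qed

text \<open>There are of order \<open>n^2\<close>, \<open>n\<close> and 1 pairs of the three kinds,
  so each kind contributes at most order \<open>1 / n^2\<close>; the constant is
  \<open>4 * 32 + 4 * 7 + 2 * 2\<close>.\<close>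

lemma sum_pairs:
  assumes l: "l \<in> lits n"
  shows "(\<Sum>i\<in>{0..n}. \<Sum>j\<in>{0..n} - {i}. \<Sum>ts\<in>LL d. mul ts * of_bool (ev l i ts \<and> ev l j ts)) \<le> 160 * Cu / real n ^ 2"
proof -
  define A where "A = 32 * Cu / real n ^ 4" define B where "B = 7 * Cu / real n ^ 3" define D where "D = 2 * Cu / real n ^ 2"
  have nn: "0 \<le> A" "0 \<le> B" "0 \<le> D" using Cu_ge by (auto simp: A_def B_def D_def)
  let ?b = "\<lambda>i j. A + (if i = 0 then B else 0) + (if j = 0 then B else 0)
     + (if i = 0 then if j = lit_var l then D else 0 else 0) + (if i = lit_var l then if j = 0 then D else 0 else 0)"
  have v: "lit_var l \<in> {0..n}" using l by (auto simp: lits_def)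
  have "(\<Sum>i\<in>{0..n}. \<Sum>j\<in>{0..n} - {i}. \<Sum>ts\<in>LL d. mul ts * of_bool (ev l i ts \<and> ev l j ts)) \<le> (\<Sum>i\<in>{0..n}. \<Sum>j\<in>{0..n} - {i}. ?b i j)"
    unfolding A_def B_def D_def using l by (intro sum_mono pair_bound) auto
  also have "\<dots> \<le> (\<Sum>i\<in>{0..n}. \<Sum>j\<in>{0..n}. ?b i j)" using nn by (intro sum_mono sum_mono2) auto
  also have "\<dots> = (real n + 1)^2 * A + 2 * (real n + 1) * B + 2 * D"
  proof -
    have "(\<Sum>j\<in>{0..n}. ?b i j) = (real n + 1) * A + (if i = 0 then (real n + 1) * B else 0) + B + (if i = 0 then D else 0) + (if i = lit_var l then D else 0)" for i
      using v by (auto simp: sum.distrib sum.delta algebra_simps)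
    thus ?thesis using v by (auto simp: sum.distrib sum.delta algebra_simps power2_eq_square)
  qed
  also have "\<dots> \<le> (4 * real n ^ 2) * A + 2 * (2 * real n) * B + 2 * D"
  proof (intro add_mono mult_right_mono nn)
    have "(real n + 1)^2 \<le> (2 * real n)^2" using n_pos by (intro power_mono) auto
    thus "(real n + 1)^2 \<le> 4 * real n ^ 2" by (simp add: power_mult_distrib)
  qed (use n_pos in auto)
  also have "\<dots> = 160 * Cu / real n ^ 2"
    using n_pos by (simp add: A_def B_def D_def field_simps power2_eq_square power3_eq_cube power4_eq_xxxx)
  finally show ?thesis .
qed

text \<open>The leaf \<open>l\<close> of a main tree contributes \<open>\<nu> 1\<close>, which is
  the third factor of order \<open>1 / n\<close> for trees with two direct witnesses. So the
  overcounting correction is as small as the exceptional trees.\<close>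

lemma error_bound:
  assumes l: "l \<in> lits n"
  shows "(\<Sum>t\<in>{t \<in> computing n c l - main n c l. leaves t \<noteq> 2 \<and> leaves t \<le> M}. mu t) +
    2 * \<nu> 1 * (\<Sum>i\<in>{0..n}. \<Sum>j\<in>{0..n} - {i}. \<Sum>ts\<in>LL d. mul ts * of_bool (ev l i ts \<and> ev l j ts)) \<le> 700 * Cu ^ 6 / real n ^ 3"
proof -
  let ?P = "\<Sum>i\<in>{0..n}. \<Sum>j\<in>{0..n} - {i}. \<Sum>ts\<in>LL d. mul ts * of_bool (ev l i ts \<and> ev l j ts)"
  have "?P \<le> 160 * Cu * (1 / real n)^2" using sum_pairs[OF l] by (simp add: power_divide)
  also have "\<dots> \<le> 160 * Cu * eps^2" using Cu_ge inverse_le_eps by (intro mult_left_mono power_mono) auto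
  finally have "2 * \<nu> 1 * ?P \<le> 2 * eps * (160 * Cu * eps^2)"
    using nu_one_le nu_nonneg[of 1] eps_pos by (intro mult_mono) (auto intro!: sum_nonneg)
  also have "\<dots> = 320 * Cu * eps^3" by (simp add: power2_eq_square power3_eq_cube)
  also have "\<dots> \<le> (400 * Cu^3) * eps^3"
  proof (intro mult_right_mono)
    have "Cu * 1 \<le> Cu * Cu^2" using Cu_ge one_le_power[of Cu 2] by (intro mult_left_mono) auto
    hence "Cu \<le> Cu^3" by (simp add: power3_eq_cube power2_eq_square)
    thus "320 * Cu \<le> 400 * Cu^3" using Cu_ge by simp
  qed (use eps_pos in simp)
  finally have "2 * \<nu> 1 * ?P \<le> 400 * Cu^3 * eps^3" .
  with sum_rest[OF l, of c] have "(\<Sum>t\<in>{t \<in> computing n c l - main n c l. leaves t \<noteq> 2 \<and> leaves t \<le> M}. mu t) + 2 * \<nu> 1 * ?P \<le> 700 * (Cu^3 * eps^3)"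
    by simp
  also have "Cu^3 * eps^3 = Cu^6 / real n ^ 3" by (simp add: eps_def power_divide power_add[symmetric])
  finally show ?thesis by simp
qed

end

section \<open>Bonferroni inequality for direct witnesses\<close>

lemma sum_by_size:
  fixes f :: "nat \<Rightarrow> real"
  assumes "finite {t \<in> X. g t \<le> M}"
  shows "(\<Sum>t\<in>{t \<in> X. g t \<le> M}. f (g t)) = (\<Sum>m\<le>M. real (card {t \<in> X. g t = m}) * f m)"
proof -
  have "(\<Sum>t\<in>{t \<in> X. g t \<le> M}. f (g t)) = (\<Sum>m\<le>M. \<Sum>t\<in>{t \<in> {t \<in> X. g t \<le> M}. g t = m}. f (g t))"
    by (rule sum.group[symmetric]) (use assms in auto)
  also have "\<dots> = (\<Sum>m\<le>M. real (card {t \<in> X. g t = m}) * f m)"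
  proof (intro sum.cong refl)
    fix m assume "m \<in> {..M}"
    hence "{t \<in> {t \<in> X. g t \<le> M}. g t = m} = {t \<in> X. g t = m}" by auto
    thus "(\<Sum>t\<in>{t \<in> {t \<in> X. g t \<le> M}. g t = m}. f (g t)) = real (card {t \<in> X. g t = m}) * f m" by simp
  qed
  finally show ?thesis .
qed

text \<open>\<open>k - k (k - 1) \<le> 1\<close> for the number \<open>k\<close> of events that occur.\<close>

lemma bonferroni_pointwise:
  assumes "finite I"
  shows "\<bar>of_bool (\<exists>i\<in>I. P i) - (\<Sum>i\<in>I. of_bool (P i))\<bar> \<le> (\<Sum>i\<in>I. \<Sum>j\<in>I - {i}. of_bool (P i \<and> P j) :: real)"
proof -
  define J where "J = {i\<in>I. P i}"
  have J: "finite J" using assms by (simp add: J_def)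
  have 1: "(\<Sum>i\<in>I. of_bool (P i)) = real (card J)"
    using assms by (simp add: J_def Int_def)
  have 2: "(\<Sum>i\<in>I. \<Sum>j\<in>I - {i}. of_bool (P i \<and> P j) :: real) = real (card J) * (real (card J) - 1)"
  proof -
    have "(\<Sum>j\<in>I - {i}. of_bool (P i \<and> P j) :: real) = of_bool (P i) * (real (card J) - 1)" if "i \<in> I" for i
    proof (cases "P i")
      case True
      hence i: "i \<in> J" using that by (simp add: J_def)
      have "(\<Sum>j\<in>I - {i}. of_bool (P i \<and> P j) :: real) = real (card {j \<in> I - {i}. P j})"
        using assms True by (simp add: Int_def)
      also have "{j \<in> I - {i}. P j} = J - {i}" by (auto simp: J_def)
      also have "real (card (J - {i})) = real (card J) - 1" using card.remove[OF J i] by simp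
      finally show ?thesis using True by simp
    qed simp
    hence "(\<Sum>i\<in>I. \<Sum>j\<in>I - {i}. of_bool (P i \<and> P j) :: real) = (\<Sum>i\<in>I. of_bool (P i)) * (real (card J) - 1)"
      by (simp add: sum_distrib_right)
    thus ?thesis by (simp only: 1)
  qed
  have 3: "of_bool (\<exists>i\<in>I. P i) = (if J = {} then 0 else 1 :: real)" by (auto simp: J_def)
  show ?thesis
  proof (cases "J = {}")
    case False
    hence k: "real (card J) \<ge> 1" using J by (simp add: Suc_le_eq card_gt_0_iff)
    have "1 * (real (card J) - 1) \<le> real (card J) * (real (card J) - 1)" using k by (intro mult_right_mono) auto
    thus ?thesis unfolding 1 2 3 using False k by simp
  qed (simp add: 1 2 3)
qed

definition ev_lists :: "nat \<Rightarrow> connective \<Rightarrow> (atree list \<Rightarrow> bool) \<Rightarrow> nat \<Rightarrow> nat" where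
  "ev_lists n d P m = card {ts. set ts \<subseteq> cls n d \<and> 2 \<le> length ts \<and> lsize ts = m \<and> P ts}"

lemma finite_ev_lists: "finite {ts. set ts \<subseteq> cls n d \<and> 2 \<le> length ts \<and> lsize ts = m \<and> P ts}"
  by (rule finite_subset[OF _ finite_lists[OF cls_assoc, of n d m]]) auto

lemma ev_lists_bonferroni:
  "\<bar>real (ev_lists n d (direct l) m) - (\<Sum>i\<in>{0..n}. real (ev_lists n d (ev l i) m))\<bar>
     \<le> (\<Sum>i\<in>{0..n}. \<Sum>j\<in>{0..n} - {i}. real (ev_lists n d (\<lambda>ts. ev l i ts \<and> ev l j ts) m))"
proof -
  define A where "A = {ts. set ts \<subseteq> cls n d \<and> 2 \<le> length ts \<and> lsize ts = m}"
  have fA: "finite A" using finite_ev_lists[of n d m "\<lambda>_. True"] by (simp add: A_def)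
  have card: "real (ev_lists n d P m) = (\<Sum>ts\<in>A. of_bool (P ts))" for P
  proof -
    have "{ts. set ts \<subseteq> cls n d \<and> 2 \<le> length ts \<and> lsize ts = m \<and> P ts} = {ts \<in> A. P ts}" by (auto simp: A_def)
    thus ?thesis using fA by (simp add: ev_lists_def Int_def)
  qed
  have "real (ev_lists n d (direct l) m) - (\<Sum>i\<in>{0..n}. real (ev_lists n d (ev l i) m))
     = (\<Sum>ts\<in>A. of_bool (\<exists>i\<in>{0..n}. ev l i ts) - (\<Sum>i\<in>{0..n}. of_bool (ev l i ts)))"
  proof -
    have "(\<Sum>ts\<in>A. of_bool (direct l ts) :: real) = (\<Sum>ts\<in>A. of_bool (\<exists>i\<in>{0..n}. ev l i ts))"
      using direct_ev[of _ n d l] by (intro sum.cong refl arg_cong[of _ _ of_bool]) (auto simp: A_def)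
    thus ?thesis unfolding card sum_subtractf by (simp add: sum.swap[of _ A])
  qed
  also have "\<bar>\<dots>\<bar> \<le> (\<Sum>ts\<in>A. \<Sum>i\<in>{0..n}. \<Sum>j\<in>{0..n} - {i}. of_bool (ev l i ts \<and> ev l j ts))"
    by (rule order_trans[OF sum_abs sum_mono]) (rule bonferroni_pointwise, simp)
  also have "\<dots> = (\<Sum>i\<in>{0..n}. \<Sum>j\<in>{0..n} - {i}. real (ev_lists n d (\<lambda>ts. ev l i ts \<and> ev l j ts) m))"
    unfolding card by (subst sum.swap, intro sum.cong refl, subst sum.swap, rule refl)
  finally show ?thesis .
qed

lemma num_main: "num (main n c l) (Suc m) = 2 * ev_lists n (opp c) (direct l) m"
proof -
  define A where "A = {ts. set ts \<subseteq> cls n (opp c) \<and> 2 \<le> length ts \<and> lsize ts = m \<and> direct l ts}"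
  have fA: "finite A" unfolding A_def by (rule finite_ev_lists)
  have "{t \<in> main n c l. leaves t = Suc m} = (\<lambda>ts. Node c [Leaf l, Node (opp c) ts]) ` A \<union> (\<lambda>ts. Node c [Node (opp c) ts, Leaf l]) ` A"
    by (auto simp: main_def A_def main_lists_def leaves_Node simp del: leaves.simps(2) intro!: imageI)
  moreover have "(\<lambda>ts. Node c [Leaf l, Node (opp c) ts]) ` A \<inter> (\<lambda>ts. Node c [Node (opp c) ts, Leaf l]) ` A = {}" by auto
  ultimately have "num (main n c l) (Suc m) = card ((\<lambda>ts. Node c [Leaf l, Node (opp c) ts]) ` A) + card ((\<lambda>ts. Node c [Node (opp c) ts, Leaf l]) ` A)"
    using fA by (simp add: num_def card_Un_disjoint)
  also have "\<dots> = 2 * card A" by (simp add: card_image inj_on_def)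
  finally show ?thesis by (simp add: ev_lists_def A_def)
qed

context trees
begin

lemma num_cls_any: "num (cls n c) = num (cls n d)" "num_lists (cls n c) = num_lists (cls n d)"
  using num_cls[of c] num_cls[of d] by auto

lemma nrm_cls: "nrm n (cls n c) = s" "nrml n (cls n c) = r"
  using num_cls_any[of c Conj] by (auto simp: nrm_def nrml_def fun_eq_iff)

text \<open>Forbids certain leaves as children only. The events \<open>ev\<close> are counted by
  complement and inclusion-exclusion over such classes.\<close>

definition avoid :: "connective \<Rightarrow> literal set \<Rightarrow> atree set" where
  "avoid d A = cls n d - Leaf ` A"

lemma nrm_avoid:
  assumes "A \<subseteq> lits n"
  shows "nrm n (avoid d A) m = s m - (if m = 1 then real (card A) / real (2 * n) else 0)"
proof -
  have "{t \<in> cls n d. leaves t = m} = {t \<in> avoid d A. leaves t = m} \<union> (if m = 1 then Leaf ` A else {})"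
    using assms by (auto simp: avoid_def)
  moreover have "finite A" by (rule finite_subset[OF assms finite_lits])
  moreover have "{t \<in> avoid d A. leaves t = m} \<inter> (if m = 1 then Leaf ` A else {}) = {}" by (auto simp: avoid_def)
  moreover have "finite {t \<in> avoid d A. leaves t = m}" using cls_assoc[of n d] by (intro finite_num[of _ n]) (auto simp: avoid_def)
  ultimately have "num (cls n d) m = num (avoid d A) m + (if m = 1 then card A else 0)"
    unfolding num_def by (simp add: card_Un_disjoint card_image inj_on_def)
  hence "nrm n (cls n d) m = nrm n (avoid d A) m + (if m = 1 then real (card A) / real (2 * n) else 0)"
    by (simp add: nrm_def add_divide_distrib)
  thus ?thesis unfolding nrm_cls(1)[of d] by simp
qed

text \<open>The value of \<open>fixpoint_limit\<close> for \<open>\<alpha> = 1\<close> and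
  \<open>t = s0 - k * w0 / (2 n)\<close>, since \<open>k\<close> missing leaves lower
  \<open>tau\<close> by that amount.\<close>

definition h :: "nat \<Rightarrow> real" where "h k = 1 / (1 - s0 + real k * (w0 / real (2 * n)))^2 - 1"

lemma nrml_avoid_limit:
  assumes A: "A \<subseteq> lits n" "card A = k" "k \<ge> 1"
  shows "(\<lambda>m. nrml n (avoid d A) m / s m) \<longlonglongrightarrow> h k"
proof -
  have sub: "avoid d A \<subseteq> cls n d" by (auto simp: avoid_def)
  have asub: "avoid d A \<subseteq> Collect (assoc_tree n)" using sub cls_assoc by blast
  have a: "nrm n (avoid d A) m \<le> s m" for m using nrm_avoid[OF A(1)] by simp
  have R: "nrml n (avoid d A) m \<le> s m" for m
  proof -
    have "nrml n (avoid d A) m \<le> nrml n (cls n d) m"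
      unfolding nrml_def using num_lists_mono[OF sub cls_assoc, of m] by (simp add: divide_right_mono)
    thus ?thesis using nrm_cls(2)[of d] r_le_s[of m] by simp
  qed
  define \<omega> where "\<omega> = w0 / real (2 * n)"
  have "(\<lambda>i. s i * w0^i - (if i = 1 then real k * \<omega> else 0)) sums (s0 - real k * \<omega>)"
    using sums_single[of 1 "\<lambda>_. real k * \<omega>"] summable_sums[OF summable_s] unfolding suminf_s by (intro sums_diff) auto
  moreover have "(\<lambda>i. s i * w0^i - (if i = 1 then real k * \<omega> else 0)) = (\<lambda>i. nrm n (avoid d A) i * w0^i)"
    unfolding nrm_avoid[OF A(1)] by (auto simp: fun_eq_iff left_diff_distrib \<omega>_def A(2))
  ultimately have ta: "(tau (nrm n (avoid d A))) = s0 - real k * \<omega>" by (simp add: sums_iff)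
  have "0 < real k * \<omega>" using A(3) w0_pos n_pos by (simp add: \<omega>_def)
  hence t: "s0 - real k * \<omega> < s0" by simp
  have la: "(\<lambda>m. nrm n (avoid d A) m / s m) \<longlonglongrightarrow> 1"
  proof (rule tendsto_eventually)
    show "\<forall>\<^sub>F m in sequentially. nrm n (avoid d A) m / s m = 1"
      unfolding eventually_at_top_linorder
    proof (intro exI[of _ 2] allI impI)
      fix m :: nat assume "2 \<le> m"
      hence "s m > 0" by (intro s_pos) simp
      thus "nrm n (avoid d A) m / s m = 1" using nrm_avoid[OF A(1), of d m] \<open>2 \<le> m\<close> by simp
    qed
  qed
  have "(\<lambda>m. nrml n (avoid d A) m / s m) \<longlonglongrightarrow> 1 * (1 / (1 - (s0 - real k * \<omega>))^2 - 1)"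
    by (rule fixpoint_limit[OF nrm_nonneg(1) a nrm_nonneg(2) R nrml_rec[OF asub] la ta t])
  moreover have E: "1 - (s0 - real k * \<omega>) = 1 - s0 + real k * \<omega>" by simp
  have "1 * (1 / (1 - (s0 - real k * \<omega>))^2 - 1) = h k" unfolding h_def \<omega>_def[symmetric] E by simp
  ultimately show ?thesis by simp
qed

lemma r_limit: "(\<lambda>m. r m / s m) \<longlonglongrightarrow> 1"
proof (rule tendsto_eventually)
  show "\<forall>\<^sub>F m in sequentially. r m / s m = 1"
    unfolding eventually_at_top_linorder
  proof (intro exI[of _ 2] allI impI)
    fix m :: nat assume "2 \<le> m"
    hence "s m > 0" by (intro s_pos) simp
    thus "r m / s m = 1" using s_r[of m] \<open>2 \<le> m\<close> by simp
  qed
qed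

abbreviation U :: "connective \<Rightarrow> (atree list \<Rightarrow> bool) \<Rightarrow> nat \<Rightarrow> real" where
  "U d P m \<equiv> real (ev_lists n d P m) / real (2 * n) ^ m"

lemma num_lists_avoid: "num_lists (avoid d A) m = ev_lists n d (\<lambda>ts. Leaf ` A \<inter> set ts = {}) m"
  unfolding num_lists_def ev_lists_def by (intro arg_cong[of _ _ card]) (auto simp: avoid_def)

lemma U_Leaf: "U d (\<lambda>ts. Leaf ` {y} \<subseteq> set ts) m = r m - nrml n (avoid d {y}) m"
proof -
  let ?A = "\<lambda>P. {ts. set ts \<subseteq> cls n d \<and> 2 \<le> length ts \<and> lsize ts = m \<and> P ts}"
  have "?A (\<lambda>_. True) = ?A (\<lambda>ts. Leaf ` {y} \<subseteq> set ts) \<union> ?A (\<lambda>ts. Leaf ` {y} \<inter> set ts = {})" by auto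
  hence "ev_lists n d (\<lambda>_. True) m = ev_lists n d (\<lambda>ts. Leaf ` {y} \<subseteq> set ts) m + ev_lists n d (\<lambda>ts. Leaf ` {y} \<inter> set ts = {}) m"
    unfolding ev_lists_def by (simp only:) (rule card_Un_disjoint[OF finite_ev_lists finite_ev_lists], auto)
  moreover have "ev_lists n d (\<lambda>_. True) m = num_lists (cls n d) m" by (simp add: ev_lists_def num_lists_def)
  ultimately have "real (ev_lists n d (\<lambda>ts. Leaf ` {y} \<subseteq> set ts) m) = real (num_lists (cls n d) m) - real (num_lists (avoid d {y}) m)"
    unfolding num_lists_avoid by simp
  hence "U d (\<lambda>ts. Leaf ` {y} \<subseteq> set ts) m = nrml n (cls n d) m - nrml n (avoid d {y}) m"
    unfolding nrml_def by (simp only: diff_divide_distrib)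
  thus ?thesis unfolding nrm_cls(2)[of d] .
qed

lemma U_pair:
  assumes "y \<noteq> z"
  shows "U d (\<lambda>ts. Leaf ` {y, z} \<subseteq> set ts) m = r m - nrml n (avoid d {y}) m - nrml n (avoid d {z}) m + nrml n (avoid d {y, z}) m"
proof -
  define A where "A = {ts. set ts \<subseteq> cls n d \<and> 2 \<le> length ts \<and> lsize ts = m}"
  have fA: "finite A" using finite_ev_lists[of n d m "\<lambda>_. True"] by (simp add: A_def)
  have card: "real (ev_lists n d P m) = (\<Sum>ts\<in>A. of_bool (P ts))" for P
  proof -
    have "{ts. set ts \<subseteq> cls n d \<and> 2 \<le> length ts \<and> lsize ts = m \<and> P ts} = {ts \<in> A. P ts}" by (auto simp: A_def)
    thus ?thesis using fA by (simp add: ev_lists_def Int_def)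
  qed
  have all: "num_lists (cls n d) m = ev_lists n d (\<lambda>_. True) m" by (simp add: ev_lists_def num_lists_def)
  have "real (ev_lists n d (\<lambda>ts. Leaf ` {y, z} \<subseteq> set ts) m) = real (num_lists (cls n d) m) - real (num_lists (avoid d {y}) m)
     - real (num_lists (avoid d {z}) m) + real (num_lists (avoid d {y, z}) m)"
    unfolding num_lists_avoid all card sum_subtractf[symmetric] sum.distrib[symmetric]
    by (intro sum.cong refl) auto
  hence "U d (\<lambda>ts. Leaf ` {y, z} \<subseteq> set ts) m = nrml n (cls n d) m - nrml n (avoid d {y}) m - nrml n (avoid d {z}) m + nrml n (avoid d {y, z}) m"
    unfolding nrml_def by (simp only: diff_divide_distrib add_divide_distrib)
  thus ?thesis unfolding nrm_cls(2)[of d] .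
qed

lemma U_limit:
  assumes l: "l \<in> lits n" and i: "i \<le> n"
  shows "(\<lambda>m. U d (ev l i) m / s m) \<longlonglongrightarrow> (if i = 0 then 1 - h 1 else 1 - 2 * h 1 + h 2)"
proof (cases "i = 0")
  case True
  have "ev l i = (\<lambda>ts. Leaf ` {l} \<subseteq> set ts)" using True by (simp add: ev_def evset_def fun_eq_iff)
  hence "(\<lambda>m. U d (ev l i) m / s m) = (\<lambda>m. r m / s m - nrml n (avoid d {l}) m / s m)"
    using U_Leaf[of d l] by (simp add: diff_divide_distrib)
  moreover have "(\<lambda>m. r m / s m - nrml n (avoid d {l}) m / s m) \<longlonglongrightarrow> 1 - h 1"
    using l by (intro tendsto_diff r_limit nrml_avoid_limit) auto
  ultimately show ?thesis using True by simp
next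
  case False
  hence y: "Pos i \<in> lits n" "Neg i \<in> lits n" using i by (auto simp: lits_def)
  have "ev l i = (\<lambda>ts. Leaf ` {Pos i, Neg i} \<subseteq> set ts)" using False by (simp add: ev_def evset_def fun_eq_iff)
  hence "(\<lambda>m. U d (ev l i) m / s m) = (\<lambda>m. r m / s m - nrml n (avoid d {Pos i}) m / s m - nrml n (avoid d {Neg i}) m / s m + nrml n (avoid d {Pos i, Neg i}) m / s m)"
    using U_pair[of "Pos i" "Neg i" d] by (simp add: diff_divide_distrib add_divide_distrib)
  moreover have "(\<lambda>m. r m / s m - nrml n (avoid d {Pos i}) m / s m - nrml n (avoid d {Neg i}) m / s m + nrml n (avoid d {Pos i, Neg i}) m / s m) \<longlonglongrightarrow> 1 - h 1 - h 1 + h 2"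
    using y by (intro tendsto_diff tendsto_add r_limit nrml_avoid_limit) auto
  moreover have "1 - h 1 - h 1 + h 2 = 1 - 2 * h 1 + h 2" by simp
  ultimately show ?thesis using False by simp
qed

text \<open>The normalised count of main trees, with a list counted once for each of its direct
  witnesses. The factor \<open>1 / n\<close> is two positions times the normalisation
  \<open>1 / (2 n)\<close> of the leaf \<open>l\<close>, and \<open>m - 1\<close> is the size left
  for the list.\<close>

definition X :: "connective \<Rightarrow> literal \<Rightarrow> nat \<Rightarrow> real" where
  "X d l m = (1 / real n) * (\<Sum>i\<in>{0..n}. U d (ev l i) (m - 1))"

definition X_lim :: real where
  "X_lim = (w0 / real n) * ((1 - h 1) + real n * (1 - 2 * h 1 + h 2))"

lemma X_limit:
  assumes l: "l \<in> lits n" shows "(\<lambda>m. X d l m / s m) \<longlonglongrightarrow> X_lim"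
proof -
  have lim: "(\<lambda>m. (1 / real n) * (\<Sum>i\<in>{0..n}. U d (ev l i) (m - 1) / s (m - 1)) * (s (m - 1) / s m))
     \<longlonglongrightarrow> (1 / real n) * (\<Sum>i\<in>{0..n}. if i = 0 then 1 - h 1 else 1 - 2 * h 1 + h 2) * w0"
    by (intro tendsto_mult tendsto_const tendsto_sum ratio_step filterlim_compose[OF U_limit[OF l]] filterlim_minus_const_nat_at_top) auto
  have "{0..n} = insert 0 {1..n}" by auto
  hence "(\<Sum>i\<in>{0..n}. if i = 0 then 1 - h 1 else 1 - 2 * h 1 + h 2) = (1 - h 1) + real n * (1 - 2 * h 1 + h 2)"
    by simp
  hence "(1 / real n) * (\<Sum>i\<in>{0..n}. if i = 0 then 1 - h 1 else 1 - 2 * h 1 + h 2) * w0 = X_lim" by (simp add: X_lim_def)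
  with lim have lim': "(\<lambda>m. (1 / real n) * (\<Sum>i\<in>{0..n}. U d (ev l i) (m - 1) / s (m - 1)) * (s (m - 1) / s m)) \<longlonglongrightarrow> X_lim" by (simp only:)
  show ?thesis
  proof (rule Lim_transform_eventually[OF lim'])
    show "\<forall>\<^sub>F m in sequentially. (1 / real n) * (\<Sum>i\<in>{0..n}. U d (ev l i) (m - 1) / s (m - 1)) * (s (m - 1) / s m) = X d l m / s m"
      unfolding eventually_at_top_linorder
    proof (intro exI[of _ 2] allI impI)
      fix m :: nat assume "2 \<le> m"
      hence "s (m - 1) > 0" by (intro s_pos) simp
      thus "(1 / real n) * (\<Sum>i\<in>{0..n}. U d (ev l i) (m - 1) / s (m - 1)) * (s (m - 1) / s m) = X d l m / s m"
        unfolding X_def sum_divide_distrib[symmetric] by simp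
    qed
  qed
qed

end

section \<open>The limit and its asymptotics\<close>

lemma polynomial_exponential_bound: "\<exists>C. \<forall>L. (real L + 2) ^ 6 \<le> C * (21/20) ^ L"
proof -
  have "(\<lambda>L. (real L + 2) ^ 6 / (21/20) ^ L) \<longlonglongrightarrow> 0" by real_asymp
  hence "Bseq (\<lambda>L. (real L + 2) ^ 6 / (21/20) ^ L)" by (intro convergent_imp_Bseq convergentI)
  then obtain C where "\<And>L. norm ((real L + 2) ^ 6 / (21/20) ^ L) \<le> C" by (auto simp: Bseq_def)
  hence "(real L + 2) ^ 6 \<le> C * (21/20) ^ L" for L
    by (simp add: divide_le_eq)
  thus ?thesis by blast
qed

lemma finite_assignments: "finite (assignments n)"
  by (simp add: assignments_def finite_PiE)

lemma sum_swap3: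
  "(\<Sum>m\<in>A. \<Sum>i\<in>B. \<Sum>j\<in>C i. f m i j) = (\<Sum>i\<in>B. \<Sum>j\<in>C i. \<Sum>m\<in>A. f m i j)"
proof -
  have "(\<Sum>m\<in>A. \<Sum>i\<in>B. \<Sum>j\<in>C i. f m i j) = (\<Sum>i\<in>B. \<Sum>m\<in>A. \<Sum>j\<in>C i. f m i j)" by (rule sum.swap)
  also have "\<dots> = (\<Sum>i\<in>B. \<Sum>j\<in>C i. \<Sum>m\<in>A. f m i j)" by (intro sum.cong refl sum.swap)
  finally show ?thesis .
qed

context trees
begin

text \<open>Exceptional trees plus the Bonferroni correction. Setting it to 0 below size 3 disposes
  of the tree with two leaves \<open>l\<close>, which none of the exceptional shapes has to
  cover.\<close>

definition err :: "connective \<Rightarrow> literal \<Rightarrow> nat \<Rightarrow> real" where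
  "err c l m = (if m < 3 then 0 else nrm n (computing n c l - main n c l) m
     + (1 / real n) * (\<Sum>i\<in>{0..n}. \<Sum>j\<in>{0..n} - {i}. U (opp c) (\<lambda>ts. ev l i ts \<and> ev l j ts) (m - 1)))"

lemma err_nonneg: "0 \<le> err c l m"
  unfolding err_def by (auto intro!: add_nonneg_nonneg nrm_nonneg divide_nonneg_nonneg sum_nonneg)

lemma computing_assoc: "computing n c l \<subseteq> Collect (assoc_tree n)"
  using cls_assoc by (auto simp: computing_def)

lemma err_dominates:
  assumes l: "l \<in> lits n" and m: "m \<ge> 3"
  shows "\<bar>nrm n (computing n c l) m - X (opp c) l m\<bar> \<le> err c l m"
proof -
  obtain k where k: "m = Suc k" using m by (cases m) auto
  have "{t \<in> computing n c l. leaves t = m} = {t \<in> computing n c l - main n c l. leaves t = m} \<union> {t \<in> main n c l. leaves t = m}"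
    using main_computing[OF l] by blast
  moreover have "computing n c l - main n c l \<subseteq> Collect (assoc_tree n)" "main n c l \<subseteq> Collect (assoc_tree n)"
    using computing_assoc[of c l] main_computing[OF l, of c] by blast+
  from this[THEN finite_num] have "finite {t \<in> computing n c l - main n c l. leaves t = m}" "finite {t \<in> main n c l. leaves t = m}" .
  ultimately have "num (computing n c l) m = num (computing n c l - main n c l) m + num (main n c l) m"
    unfolding num_def by (simp only:) (rule card_Un_disjoint, auto)
  hence "nrm n (computing n c l) m = nrm n (computing n c l - main n c l) m + nrm n (main n c l) m"
    by (simp add: nrm_def add_divide_distrib)
  moreover have "nrm n (main n c l) m = (1 / real n) * U (opp c) (direct l) (m - 1)"
    unfolding nrm_def k num_main using n_pos by simp
  moreover have "\<bar>U (opp c) (direct l) (m - 1) - (\<Sum>i\<in>{0..n}. U (opp c) (ev l i) (m - 1))\<bar>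
     \<le> (\<Sum>i\<in>{0..n}. \<Sum>j\<in>{0..n} - {i}. U (opp c) (\<lambda>ts. ev l i ts \<and> ev l j ts) (m - 1))" (is "\<bar>?a\<bar> \<le> ?b")
  proof -
    have "\<bar>real (ev_lists n (opp c) (direct l) (m - 1)) - (\<Sum>i\<in>{0..n}. real (ev_lists n (opp c) (ev l i) (m - 1)))\<bar> / real (2 * n) ^ (m - 1)
      \<le> (\<Sum>i\<in>{0..n}. \<Sum>j\<in>{0..n} - {i}. real (ev_lists n (opp c) (\<lambda>ts. ev l i ts \<and> ev l j ts) (m - 1))) / real (2 * n) ^ (m - 1)"
      by (intro divide_right_mono ev_lists_bonferroni) auto
    moreover have "?a = (real (ev_lists n (opp c) (direct l) (m - 1)) - (\<Sum>i\<in>{0..n}. real (ev_lists n (opp c) (ev l i) (m - 1)))) / real (2 * n) ^ (m - 1)"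
      by (simp only: diff_divide_distrib sum_divide_distrib)
    moreover have "?b = (\<Sum>i\<in>{0..n}. \<Sum>j\<in>{0..n} - {i}. real (ev_lists n (opp c) (\<lambda>ts. ev l i ts \<and> ev l j ts) (m - 1))) / real (2 * n) ^ (m - 1)"
      by (simp only: sum_divide_distrib)
    moreover have "\<bar>real (2 * n) ^ (m - 1)\<bar> = real (2 * n) ^ (m - 1)" by simp
    ultimately show ?thesis by (simp only: abs_divide)
  qed
  ultimately have "nrm n (computing n c l) m - X (opp c) l m = nrm n (computing n c l - main n c l) m + (1 / real n) * ?a"
    by (simp only: X_def right_diff_distrib)
  moreover have "\<bar>(1 / real n) * ?a\<bar> \<le> (1 / real n) * ?b"
    using \<open>\<bar>?a\<bar> \<le> ?b\<close> unfolding abs_mult by (intro mult_mono) auto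
  moreover have "nrm n (computing n c l - main n c l) m \<ge> 0" by (rule nrm_nonneg)
  moreover have "\<not> m < 3" using m by simp
  hence "err c l m = nrm n (computing n c l - main n c l) m + (1 / real n) * ?b" by (simp only: err_def if_False)
  ultimately show ?thesis by (simp only: abs_le_iff) linarith
qed

text \<open>The weight is chosen anew for every \<open>M\<close>, while the constants of the locale
  \<open>weights\<close>, and with them \<open>error_bound\<close>, are the same for all
  \<open>M\<close>.\<close>

lemma err_bound:
  assumes l: "l \<in> lits n" and Cu: "\<And>L. (real L + 2) ^ 6 \<le> Cu * (21/20) ^ L"
  shows "\<forall>\<^sub>F M in sequentially. (\<Sum>m\<le>M. real m * err c l m * w0^m) \<le> (100000 * Cu^6 / real n ^ 3) * (\<Sum>m\<le>M. real m * s m * w0^m)"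
proof -
  have "\<forall>\<^sub>F M in sequentially. 1 \<le> (\<Sum>m\<le>M. real m * s m * w0^m)"
    using weighted_sum_at_top unfolding filterlim_at_top by blast
  thus ?thesis
  proof eventually_elim
    case (elim M)
    define D where "D = (\<Sum>m\<le>M. real m * s m * w0^m)"
    define \<Lambda> where "\<Lambda> = D * (1000/7)"
    have D: "D \<ge> 1" using elim by (simp add: D_def)
    have \<Lambda>: "\<Lambda> > 0" "1 / \<Lambda> \<le> 7/1000" using D by (auto simp: \<Lambda>_def field_simps)
    \<comment> \<open>\<open>\<nu>\<close> adds to the weight at \<open>w0\<close> its size-biased version, scaled to total mass \<open>7 / 1000\<close>;
      the factor \<open>1 + real m / \<Lambda>\<close> makes the sum submultiplicative.\<close>
    define \<omega> where "\<omega> = w0 / real (2 * n)"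
    have \<omega>: "\<omega> > 0" using w0_pos n_pos by (simp add: \<omega>_def)
    define \<nu> where "\<nu> = (\<lambda>m::nat. \<omega>^m * (1 + real m / \<Lambda>))"
    have nrm_nu: "real k / real (2 * n) ^ m * w0^m * (1 + real m / \<Lambda>) = real k * \<nu> m" for k m
      by (simp add: \<nu>_def \<omega>_def power_divide)
    interpret weights n \<nu> M Cu
    proof
      fix i j :: nat
      show "0 \<le> \<nu> i" using \<omega> \<Lambda> by (simp add: \<nu>_def)
      have "1 + real (i + j) / \<Lambda> \<le> (1 + real i / \<Lambda>) * (1 + real j / \<Lambda>)" using \<Lambda> by (simp add: algebra_simps add_divide_distrib)
      hence "\<omega>^i * \<omega>^j * (1 + real (i + j) / \<Lambda>) \<le> \<omega>^i * \<omega>^j * ((1 + real i / \<Lambda>) * (1 + real j / \<Lambda>))"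
        using \<omega> by (intro mult_left_mono) auto
      thus "\<nu> (i + j) \<le> \<nu> i * \<nu> j" by (simp add: \<nu>_def power_add mult_ac)
    next
      show "\<nu> 0 \<le> 1" by (simp add: \<nu>_def)
      have "2 * real n * \<nu> 1 = w0 * (1 + 1 / \<Lambda>)" using n_pos by (simp add: \<nu>_def \<omega>_def)
      also have "\<dots> \<le> (1716/10000) * (1 + 7/1000)" using w0_upper w0_pos \<Lambda> by (intro mult_mono) auto
      finally show "2 * real n * \<nu> 1 \<le> 175/1000" by simp
    next
      fix c
      have "(\<Sum>t\<in>{t \<in> cls n c. leaves t \<le> M}. \<nu> (leaves t)) = (\<Sum>m\<le>M. real (num (cls n c) m) * \<nu> m)"
        unfolding num_def by (rule sum_by_size) (rule finite_subset[OF _ finite_trees[of n M]], auto simp: cls_def)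
      also have "\<dots> = (\<Sum>m\<le>M. s m * w0^m + (1 / \<Lambda>) * (real m * s m * w0^m))"
      proof (intro sum.cong refl)
        fix m
        have "real (num (cls n c) m) * \<nu> m = nrm n (cls n c) m * w0^m * (1 + real m / \<Lambda>)"
          unfolding nrm_nu[symmetric] nrm_def ..
        thus "real (num (cls n c) m) * \<nu> m = s m * w0^m + (1 / \<Lambda>) * (real m * s m * w0^m)"
          unfolding nrm_cls(1)[of c] by (simp add: algebra_simps)
      qed
      also have "\<dots> = (\<Sum>m\<le>M. s m * w0^m) + (1 / \<Lambda>) * D"
        by (simp only: sum.distrib sum_distrib_left D_def)
      \<comment> \<open>\<open>s0 < 293/1000\<close> leaves \<open>7/1000\<close> below
        \<open>3/10\<close> for the size-biased part, which fixes the scale of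
        \<open>\<Lambda>\<close>.\<close>
      also have "\<dots> \<le> s0 + 7/1000" using partial_sums[of M] D by (simp add: \<Lambda>_def)
      finally show "(\<Sum>t\<in>{t \<in> cls n c. leaves t \<le> M}. \<nu> (leaves t)) \<le> 3/10" using s0_bounds by simp
    qed (use Cu in simp)
    let ?d = "opp c"
    let ?Y = "computing n c l - main n c l"
    have part1: "(\<Sum>m\<in>{3..M}. nrm n ?Y m * w0^m * (1 + real m / \<Lambda>)) \<le> (\<Sum>t\<in>{t \<in> ?Y. leaves t \<noteq> 2 \<and> leaves t \<le> M}. mu t)"
    proof -
      let ?Z = "{t \<in> ?Y. leaves t \<noteq> 2}"
      have "(\<Sum>m\<in>{3..M}. nrm n ?Y m * w0^m * (1 + real m / \<Lambda>)) = (\<Sum>m\<in>{3..M}. real (num ?Y m) * \<nu> m)"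
        unfolding nrm_nu[symmetric] nrm_def ..
      also have "\<dots> = (\<Sum>m\<in>{3..M}. real (card {t \<in> ?Z. leaves t = m}) * \<nu> m)"
        unfolding num_def by (intro sum.cong refl arg_cong2[of _ _ _ _ "(*)"] arg_cong[of _ _ real] arg_cong[of _ _ card]) auto
      also have "\<dots> \<le> (\<Sum>m\<le>M. real (card {t \<in> ?Z. leaves t = m}) * \<nu> m)"
        by (intro sum_mono2) (auto intro!: mult_nonneg_nonneg nu_nonneg)
      also have "\<dots> = (\<Sum>t\<in>{t \<in> ?Z. leaves t \<le> M}. \<nu> (leaves t))"
        by (rule sum_by_size[symmetric]) (rule finite_subset[OF _ finite_trees[of n M]], use computing_assoc in auto)
      also have "{t \<in> ?Z. leaves t \<le> M} = {t \<in> ?Y. leaves t \<noteq> 2 \<and> leaves t \<le> M}" by auto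
      finally show ?thesis by (simp add: mu_def)
    qed
    have part2: "(\<Sum>m\<in>{3..M}. (1 / real n) * U ?d P (m - 1) * w0^m * (1 + real m / \<Lambda>)) \<le> 2 * \<nu> 1 * (\<Sum>ts\<in>LL ?d. mul ts * of_bool (P ts))" for P
    proof -
      have "(\<Sum>m\<in>{3..M}. (1 / real n) * U ?d P (m - 1) * w0^m * (1 + real m / \<Lambda>)) \<le> (\<Sum>m\<in>{3..M}. 2 * \<nu> 1 * (real (ev_lists n ?d P (m - 1)) * \<nu> (m - 1)))"
      proof (intro sum_mono)
        fix m assume "m \<in> {3..M}"
        then obtain k where k: "m = Suc k" by (cases m) auto
        have "(1 / real n) * U ?d P (m - 1) * w0^m * (1 + real m / \<Lambda>) = 2 * real (ev_lists n ?d P (m - 1)) * \<nu> m"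
          using n_pos unfolding k by (simp add: \<nu>_def \<omega>_def power_divide mult_ac)
        also have "\<dots> \<le> 2 * real (ev_lists n ?d P (m - 1)) * (\<nu> 1 * \<nu> (m - 1))"
          using nu_add[of 1 k] unfolding k by (intro mult_left_mono) auto
        finally show "(1 / real n) * U ?d P (m - 1) * w0^m * (1 + real m / \<Lambda>) \<le> 2 * \<nu> 1 * (real (ev_lists n ?d P (m - 1)) * \<nu> (m - 1))"
          by (simp add: mult_ac)
      qed
      also have "\<dots> = 2 * \<nu> 1 * (\<Sum>m\<in>{3..M}. real (ev_lists n ?d P (m - 1)) * \<nu> (m - 1))" by (simp add: sum_distrib_left)
      also have "\<dots> \<le> 2 * \<nu> 1 * (\<Sum>ts\<in>LL ?d. mul ts * of_bool (P ts))"
      proof (intro mult_left_mono)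
        let ?g = "\<lambda>k. real (ev_lists n ?d P k) * \<nu> k"
        let ?A = "{ts. set ts \<subseteq> cls n ?d \<and> 2 \<le> length ts \<and> P ts}"
        have "(\<Sum>m\<in>{3..M}. ?g (m - 1)) = sum ?g ((\<lambda>m. m - 1) ` {3..M})"
          by (subst sum.reindex) (auto simp: inj_on_def)
        also have "\<dots> \<le> (\<Sum>k\<le>M. ?g k)" by (intro sum_mono2) (auto intro!: mult_nonneg_nonneg nu_nonneg)
        also have "\<dots> = (\<Sum>k\<le>M. real (card {ts \<in> ?A. lsize ts = k}) * \<nu> k)"
          unfolding ev_lists_def by (intro sum.cong refl arg_cong2[of _ _ _ _ "(*)"] arg_cong[of _ _ real] arg_cong[of _ _ card]) auto
        also have "\<dots> = (\<Sum>ts\<in>{ts \<in> ?A. lsize ts \<le> M}. \<nu> (lsize ts))"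
          by (rule sum_by_size[symmetric]) (rule finite_subset[OF _ finite_lists[OF cls_assoc, of n ?d M]], auto)
        also have "\<dots> \<le> (\<Sum>ts\<in>{ts \<in> ?A. lsize ts \<le> M}. mul ts)" by (intro sum_mono nu_lsize)
        also have "\<dots> \<le> (\<Sum>ts\<in>{ts \<in> LL ?d. P ts}. mul ts)"
          using finite_LL[of ?d 0] by (intro sum_mono2) (auto intro: LL_I)
        also have "\<dots> = (\<Sum>ts\<in>LL ?d. mul ts * of_bool (P ts))" by (rule sum_filter[OF finite_LL])
        finally show "(\<Sum>m\<in>{3..M}. ?g (m - 1)) \<le> (\<Sum>ts\<in>LL ?d. mul ts * of_bool (P ts))" .
      qed (use nu_nonneg[of 1] in simp)
      finally show ?thesis .
    qed
    define f where "f = (\<lambda>m i j. (1 / real n) * U ?d (\<lambda>ts. ev l i ts \<and> ev l j ts) (m - 1) * w0^m * (1 + real m / \<Lambda>))"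
    define g where "g = (\<lambda>i j. \<Sum>ts\<in>LL ?d. mul ts * of_bool (ev l i ts \<and> ev l j ts))"
    have "(\<Sum>m\<in>{3..M}. \<Sum>i\<in>{0..n}. \<Sum>j\<in>{0..n} - {i}. f m i j) = (\<Sum>i\<in>{0..n}. \<Sum>j\<in>{0..n} - {i}. \<Sum>m\<in>{3..M}. f m i j)"
      by (rule sum_swap3)
    also have "\<dots> \<le> (\<Sum>i\<in>{0..n}. \<Sum>j\<in>{0..n} - {i}. 2 * \<nu> 1 * g i j)"
      unfolding f_def g_def by (intro sum_mono part2)
    also have "\<dots> = 2 * \<nu> 1 * (\<Sum>i\<in>{0..n}. \<Sum>j\<in>{0..n} - {i}. g i j)"
      by (simp only: sum_distrib_left)
    finally have pairs: "(\<Sum>m\<in>{3..M}. \<Sum>i\<in>{0..n}. \<Sum>j\<in>{0..n} - {i}. f m i j) \<le> 2 * \<nu> 1 * (\<Sum>i\<in>{0..n}. \<Sum>j\<in>{0..n} - {i}. g i j)" .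
    have "err c l m * w0^m * (1 + real m / \<Lambda>) = nrm n ?Y m * w0^m * (1 + real m / \<Lambda>)
       + (\<Sum>i\<in>{0..n}. \<Sum>j\<in>{0..n} - {i}. f m i j)" if "m \<in> {3..M}" for m
    proof -
      have "\<not> m < 3" using that by simp
      thus ?thesis unfolding err_def f_def by (simp only: if_False distrib_right sum_distrib_left sum_distrib_right)
    qed
    hence "(\<Sum>m\<in>{3..M}. err c l m * w0^m * (1 + real m / \<Lambda>)) = (\<Sum>m\<in>{3..M}. nrm n ?Y m * w0^m * (1 + real m / \<Lambda>))
       + (\<Sum>m\<in>{3..M}. \<Sum>i\<in>{0..n}. \<Sum>j\<in>{0..n} - {i}. f m i j)"
      unfolding sum.distrib[symmetric] by (rule sum.cong[OF refl])
    hence "(\<Sum>m\<in>{3..M}. err c l m * w0^m * (1 + real m / \<Lambda>)) \<le> 700 * Cu ^ 6 / real n ^ 3"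
      using add_mono[OF part1 pairs] error_bound[OF l, of c ?d] unfolding g_def by (simp only: order_trans)
    \<comment> \<open>Recovers the derivative sum: \<open>m\<close> is at most
      \<open>\<Lambda> * (1 + m / \<Lambda>)\<close>. The cost \<open>\<Lambda>\<close> is
      proportional to \<open>D\<close>, as the claim allows, and
      \<open>700 * 1000 / 7 = 100000\<close>.\<close>
    moreover have "(\<Sum>m\<le>M. real m * err c l m * w0^m) \<le> \<Lambda> * (\<Sum>m\<in>{3..M}. err c l m * w0^m * (1 + real m / \<Lambda>))"
    proof -
      have "(\<Sum>m\<le>M. real m * err c l m * w0^m) = (\<Sum>m\<in>{3..M}. real m * err c l m * w0^m)"
        by (rule sum.mono_neutral_right) (auto simp: err_def)
      also have "\<dots> \<le> (\<Sum>m\<in>{3..M}. \<Lambda> * (err c l m * w0^m * (1 + real m / \<Lambda>)))"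
      proof (intro sum_mono)
        fix m
        have "0 \<le> err c l m * w0^m" using err_nonneg w0_pos by simp
        hence "err c l m * w0^m * real m \<le> err c l m * w0^m * (\<Lambda> * (1 + real m / \<Lambda>))"
          using \<Lambda> by (intro mult_left_mono) (auto simp: distrib_left)
        thus "real m * err c l m * w0^m \<le> \<Lambda> * (err c l m * w0^m * (1 + real m / \<Lambda>))" by (simp only: mult_ac)
      qed
      finally show ?thesis by (simp only: sum_distrib_left)
    qed
    ultimately have "(\<Sum>m\<le>M. real m * err c l m * w0^m) \<le> \<Lambda> * (700 * Cu ^ 6 / real n ^ 3)"
      using \<Lambda>(1) by (elim order_trans) (rule mult_left_mono, auto)
    also have "\<Lambda> * (700 * Cu ^ 6 / real n ^ 3) = (100000 * Cu^6 / real n ^ 3) * D" by (simp add: \<Lambda>_def)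
    finally show ?case unfolding D_def .
  qed
qed

text \<open>Computing \<open>l\<close> means being true on \<open>G1\<close> and false on
  \<open>G0\<close>, so \<open>T_convergent\<close> gives the limit; the two classes can differ only
  in a leaf of size 1. With existence known, \<open>abel_comparison\<close> bounds the distance to
  \<open>X_lim\<close>.\<close>

lemma computing_limit:
  assumes l: "l \<in> lits n" and Cu: "\<And>L. (real L + 2) ^ 6 \<le> Cu * (21/20) ^ L"
  shows "\<exists>L. (\<lambda>m. nrm n (computing n c l) m / s m) \<longlonglongrightarrow> L \<and> \<bar>L - X_lim\<bar> \<le> 100000 * Cu^6 / real n ^ 3"
proof -
  define G1 where "G1 = {a \<in> assignments n. lit_eval a l}"
  define G0 where "G0 = {a \<in> assignments n. \<not> lit_eval a l}"
  have fin: "finite G1" "finite G0" using finite_assignments by (auto simp: G1_def G0_def)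
  have eq: "nrm n (T (opp c) G1 G0) m = nrm n (computing n c l) m" if "m \<ge> 2" for m
  proof -
    have "{t \<in> T (opp c) G1 G0. leaves t = m} = {t \<in> computing n c l. leaves t = m}"
    proof (intro set_eqI iffI)
      fix t assume t: "t \<in> {t \<in> T (opp c) G1 G0. leaves t = m}"
      have "\<exists>ts. t = Node c ts" using t that by (cases t) (auto simp: T_def)
      thus "t \<in> {t \<in> computing n c l. leaves t = m}" using t by (auto simp: T_def computing_def G1_def G0_def)
    qed (auto simp: T_def computing_def G1_def G0_def)
    thus ?thesis by (simp add: nrm_def num_def)
  qed
  have "cv (nrm n (T (opp c) G1 G0))" by (intro T_convergent fin) (auto simp: G1_def G0_def)
  then obtain L where "(\<lambda>m. nrm n (T (opp c) G1 G0) m / s m) \<longlonglongrightarrow> L" by (auto simp: convergent_def)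
  hence L: "(\<lambda>m. nrm n (computing n c l) m / s m) \<longlonglongrightarrow> L"
    by (rule Lim_transform_eventually) (auto simp: eventually_at_top_linorder eq intro!: exI[of _ 2])
  have "(\<lambda>m. (nrm n (computing n c l) m - X (opp c) l m) / s m) \<longlonglongrightarrow> L - X_lim"
    unfolding diff_divide_distrib by (intro tendsto_diff L X_limit l)
  hence "\<bar>L - X_lim\<bar> \<le> 100000 * Cu^6 / real n ^ 3"
    by (rule abel_comparison[OF _ err_dominates[OF l] err_nonneg err_bound[OF l Cu]])
  with L show ?thesis by blast
qed

text \<open>From size 2 on every tree has exactly one root connective, and by duality both are
  equally frequent, so the probability is the mean of the two ratios.\<close>

lemma pmf_var:
  assumes i: "i \<in> {1..n}" and m: "m \<ge> 2"
  shows "pmf (assoc_pmf m n) (var_fun n i) = (nrm n (computing n Conj (Pos i)) m / s m + nrm n (computing n Disj (Pos i)) m / s m) / 2"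
proof -
  let ?A = "\<lambda>c. {t \<in> cls n (opp c). leaves t = m}"
  let ?B = "\<lambda>c. {t \<in> computing n c (Pos i). leaves t = m}"
  have split: "assoc_trees m n = ?A Conj \<union> ?A Disj"
  proof -
    have "root_label t \<noteq> Some Disj \<or> root_label t \<noteq> Some Conj" for t by auto
    thus ?thesis by (auto simp: assoc_trees_def cls_def)
  qed
  have node: "\<exists>ts. t = Node c ts" if "t \<in> ?A c" for t c using that m by (cases t) auto
  have disj: "?A Conj \<inter> ?A Disj = {}" using node[of _ Conj] node[of _ Disj] by fastforce
  have fin: "finite (?A c)" for c by (rule finite_num[OF cls_assoc])
  have finA: "finite (assoc_trees m n)" unfolding split using fin by blast
  have "real (card (assoc_trees m n)) = real (num (cls n Disj) m) + real (num (cls n Conj) m)"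
    unfolding split card_Un_disjoint[OF fin fin disj] by (simp add: num_def)
  hence cA: "real (card (assoc_trees m n)) = 2 * real (num (cls n Conj) m)" using num_cls(1)[of Disj] by simp
  have s: "s m > 0" using s_pos m by simp
  hence pos: "real (num (cls n Conj) m) > 0" using n_pos by (simp add: nrm_def zero_less_divide_iff)
  have ne: "assoc_trees m n \<noteq> {}" using cA pos by auto
  have val: "tree_fun n t = var_fun n i \<longleftrightarrow> (\<forall>a\<in>assignments n. tree_eval a t = lit_eval a (Pos i))" for t
    unfolding tree_fun_def var_fun_def by (auto simp: fun_eq_iff restrict_def split: if_splits)
  have "assoc_trees m n \<inter> tree_fun n -` {var_fun n i} = ?B Conj \<union> ?B Disj"
    unfolding split
  proof (intro set_eqI iffI)
    fix t assume t: "t \<in> (?A Conj \<union> ?A Disj) \<inter> tree_fun n -` {var_fun n i}"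
    hence "\<forall>a\<in>assignments n. tree_eval a t = lit_eval a (Pos i)" using val by auto
    thus "t \<in> ?B Conj \<union> ?B Disj" using t node[of t Conj] node[of t Disj] unfolding computing_def by blast
  next
    fix t assume t: "t \<in> ?B Conj \<union> ?B Disj"
    hence "\<forall>a\<in>assignments n. tree_eval a t = lit_eval a (Pos i)" by (auto simp: computing_def)
    hence "tree_fun n t = var_fun n i" using val by blast
    thus "t \<in> (?A Conj \<union> ?A Disj) \<inter> tree_fun n -` {var_fun n i}" using t unfolding computing_def by blast
  qed
  moreover have "?B Conj \<inter> ?B Disj = {}" by (auto simp: computing_def)
  moreover have "finite (?B c)" for c by (rule finite_num[OF computing_assoc])
  ultimately have cB: "card (assoc_trees m n \<inter> tree_fun n -` {var_fun n i}) = num (computing n Conj (Pos i)) m + num (computing n Disj (Pos i)) m"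
    by (simp add: card_Un_disjoint num_def)
  have "pmf (assoc_pmf m n) (var_fun n i) = measure (pmf_of_set (assoc_trees m n)) (tree_fun n -` {var_fun n i})"
    unfolding assoc_pmf_def by (rule pmf_map)
  also have "\<dots> = real (card (assoc_trees m n \<inter> tree_fun n -` {var_fun n i})) / real (card (assoc_trees m n))"
    by (rule measure_pmf_of_set[OF ne finA])
  also have "\<dots> = (real (num (computing n Conj (Pos i)) m) / real (num (cls n Conj) m) + real (num (computing n Disj (Pos i)) m) / real (num (cls n Conj) m)) / 2"
    unfolding cA cB using pos by (simp add: add_divide_distrib)
  also have "\<dots> = (nrm n (computing n Conj (Pos i)) m / s m + nrm n (computing n Disj (Pos i)) m / s m) / 2"
    unfolding nrm_def using n_pos by simp
  finally show ?thesis .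
qed

lemma var_limit:
  assumes i: "i \<in> {1..n}" and Cu: "\<And>L. (real L + 2) ^ 6 \<le> Cu * (21/20) ^ L"
  shows "\<exists>L. (\<lambda>m. pmf (assoc_pmf m n) (var_fun n i)) \<longlonglongrightarrow> L \<and> \<bar>L - X_lim\<bar> \<le> 100000 * Cu^6 / real n ^ 3"
proof -
  have l: "Pos i \<in> lits n" using i by (simp add: lits_def)
  obtain L1 where L1: "(\<lambda>m. nrm n (computing n Conj (Pos i)) m / s m) \<longlonglongrightarrow> L1" "\<bar>L1 - X_lim\<bar> \<le> 100000 * Cu^6 / real n ^ 3"
    using computing_limit[OF l Cu, of Conj] by auto
  obtain L2 where L2: "(\<lambda>m. nrm n (computing n Disj (Pos i)) m / s m) \<longlonglongrightarrow> L2" "\<bar>L2 - X_lim\<bar> \<le> 100000 * Cu^6 / real n ^ 3"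
    using computing_limit[OF l Cu, of Disj] by auto
  have "(\<lambda>m. (nrm n (computing n Conj (Pos i)) m / s m + nrm n (computing n Disj (Pos i)) m / s m) / 2) \<longlonglongrightarrow> (L1 + L2) / 2"
    by (intro tendsto_intros L1 L2) auto
  hence "(\<lambda>m. pmf (assoc_pmf m n) (var_fun n i)) \<longlonglongrightarrow> (L1 + L2) / 2"
    by (rule Lim_transform_eventually) (auto simp: eventually_at_top_linorder pmf_var[OF i] intro!: exI[of _ 2])
  moreover have "\<bar>(L1 + L2) / 2 - X_lim\<bar> \<le> 100000 * Cu^6 / real n ^ 3"
  proof -
    have "\<bar>a - x\<bar> \<le> B \<Longrightarrow> \<bar>b - x\<bar> \<le> B \<Longrightarrow> \<bar>(a + b) / 2 - x\<bar> \<le> B" for a b x B :: real by (simp add: abs_le_iff field_simps)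
    thus ?thesis using L1(2) L2(2) by blast
  qed
  ultimately show ?thesis by blast
qed

text \<open>With \<open>q = 1 - s0 = sqrt 2 / 2\<close> and \<open>x = w0 / (2 n)\<close>,
  \<open>1 - h 1\<close> is a first difference of the inverse square at \<open>q\<close>, with
  leading term \<open>2 * x / q^3\<close>, and \<open>1 - 2 * h 1 + h 2\<close> a second difference,
  with leading term \<open>6 * x^2 / q^4\<close>. The remainders \<open>d1\<close> and
  \<open>d2\<close> are put over common denominators and bounded directly.\<close>

lemma X_lim_asymptotic: "\<bar>X_lim - (546 - 386 * sqrt 2) / real n ^ 2\<bar> \<le> 3144 / real n ^ 3"
proof -
  define q where "q = 1 - s0"
  define x where "x = w0 / real (2 * n)"
  have q: "q * q = 1/2" "7/10 < q" "q < 1" "q = sqrt 2 / 2" using s0_bounds by (auto simp: q_def s0_def)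
  have x: "0 < x" "x \<le> 1 / real n" "x \<le> 1" using w0_pos w0_less n_pos by (auto simp: x_def field_simps)
  define d1 where "d1 = 1 / q^2 - 1 / (q + x)^2 - 2 * x / q^3"
  define d2 where "d2 = 1 / q^2 - 2 / (q + x)^2 + 1 / (q + 2 * x)^2 - 6 * x^2 / q^4"
  have nz: "q \<noteq> 0" "q + x \<noteq> 0" "q + 2 * x \<noteq> 0" using q x by auto
  have d1: "d1 = - (3 * q * x^2 + 2 * x^3) / (q^3 * (q + x)^2)"
    unfolding d1_def using nz by (simp add: divide_simps) algebra
  have d2: "d2 = - (x^3 * (24 * q^3 + 74 * q^2 * x + 72 * q * x^2 + 24 * x^3)) / (q^4 * (q + x)^2 * (q + 2 * x)^2)"
    unfolding d2_def using nz by (simp add: divide_simps) algebra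
  have q2: "q^2 = 1/2" "q^4 = 1/4" "q^3 = q / 2"
  proof -
    have "q^4 = (q * q) * (q * q)" "q^3 = q * (q * q)" by (simp_all add: power4_eq_xxxx power3_eq_cube)
    thus "q^2 = 1/2" "q^4 = 1/4" "q^3 = q / 2" unfolding power2_eq_square q(1) by simp_all
  qed
  have qx: "(q + x)^2 \<ge> 1/2" "(q + 2 * x)^2 \<ge> 1/2"
    unfolding q2(1)[symmetric] using q(2) x by (intro power_mono; simp)+
  have B1: "\<bar>d1\<bar> \<le> 40 * x^2"
  proof -
    have "\<bar>d1\<bar> = (3 * q * x^2 + 2 * x^3) / (q^3 * (q + x)^2)"
      unfolding d1 abs_minus_cancel abs_divide using q x by (simp add: abs_of_nonneg minus_divide_left[symmetric])
    also have "\<dots> \<le> (5 * x^2) / (1/8)"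
    proof (rule frac_le)
      have "q * x^2 \<le> 1 * x^2" "x * x^2 \<le> 1 * x^2" using q x by (auto intro!: mult_right_mono)
      thus "3 * q * x^2 + 2 * x^3 \<le> 5 * x^2" by (simp add: power3_eq_cube power2_eq_square)
      have "(1/4) * (1/2) \<le> q^3 * (q + x)^2" unfolding q2(3) using q qx by (intro mult_mono) auto
      thus "1/8 \<le> q^3 * (q + x)^2" by simp
    qed (use x in auto)
    finally show ?thesis by simp
  qed
  have B2: "\<bar>d2\<bar> \<le> 3104 * x^3"
  proof -
    have pos: "0 \<le> x^3 * (24 * q^3 + 74 * q^2 * x + 72 * q * x^2 + 24 * x^3)" using q x by (intro mult_nonneg_nonneg add_nonneg_nonneg) auto
    have "\<bar>d2\<bar> = (x^3 * (24 * q^3 + 74 * q^2 * x + 72 * q * x^2 + 24 * x^3)) / (q^4 * (q + x)^2 * (q + 2 * x)^2)"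
      unfolding d2 abs_divide abs_minus_cancel abs_of_nonneg[OF pos] by (simp add: abs_mult)
    also have "\<dots> \<le> (x^3 * 194) / (1/16)"
    proof (rule frac_le)
      have "24 * q^3 + 74 * q^2 * x + 72 * q * x^2 + 24 * x^3 \<le> 24 * 1 + 74 * 1 * 1 + 72 * 1 * 1 + 24 * 1"
        using q x by (intro add_mono mult_mono power_le_one mult_nonneg_nonneg) auto
      thus "x^3 * (24 * q^3 + 74 * q^2 * x + 72 * q * x^2 + 24 * x^3) \<le> x^3 * 194" using x by (intro mult_left_mono) auto
      have "(1/4) * (1/2) * (1/2) \<le> q^4 * (q + x)^2 * (q + 2 * x)^2" unfolding q2(2) using qx by (intro mult_mono) auto
      thus "1/16 \<le> q^4 * (q + x)^2 * (q + 2 * x)^2" by simp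
    qed (use x in auto)
    finally show ?thesis by simp
  qed
  have h: "1 - h 1 = 1 / q^2 - 1 / (q + x)^2" "1 - 2 * h 1 + h 2 = 1 / q^2 - 2 / (q + x)^2 + 1 / (q + 2 * x)^2"
    unfolding h_def q_def[symmetric] x_def[symmetric] by (simp_all add: q2(1))
  have main: "(w0 / real n) * (2 * x / q^3 + real n * (6 * x^2 / q^4)) = (546 - 386 * sqrt 2) / real n ^ 2"
  proof -
    have "1 / q = sqrt 2" unfolding q(4) by (simp add: real_div_sqrt)
    hence e: "2 / q^3 = 4 * sqrt 2" "6 / q^4 = 24" unfolding q2 by simp_all
    have "(w0 / real n) * (2 * x / q^3 + real n * (6 * x^2 / q^4)) = (w0 / real n) * (x * (2 / q^3) + real n * (x^2 * (6 / q^4)))" by (simp add: mult_ac)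
    also have "\<dots> = (w0 * w0 * (2 * sqrt 2 + 6 * w0)) / real n ^ 2"
      unfolding e x_def using n_pos by (simp add: field_simps power2_eq_square)
    also have "w0 * w0 * (2 * sqrt 2 + 6 * w0) = 546 - 386 * sqrt 2"
    proof -
      have "(3 - 2 * y) * (3 - 2 * y) * (2 * y + 6 * (3 - 2 * y)) = 546 - 386 * y" if "y * y = 2" for y :: real
      proof -
        have "(3 - 2 * y) * (3 - 2 * y) = 9 - 12 * y + 4 * (y * y)" by (simp add: algebra_simps)
        also have "\<dots> = 17 - 12 * y" using that by simp
        finally have "(3 - 2 * y) * (3 - 2 * y) * (2 * y + 6 * (3 - 2 * y)) = 306 - 386 * y + 120 * (y * y)" by (simp add: algebra_simps)
        thus ?thesis using that by simp
      qed
      from this[of "sqrt 2"] show ?thesis by (simp add: w0_def)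
    qed
    finally show ?thesis .
  qed
  have "X_lim - (546 - 386 * sqrt 2) / real n ^ 2 = (w0 / real n) * (d1 + real n * d2)"
    unfolding main[symmetric] X_lim_def h d1_def d2_def by (simp add: algebra_simps)
  also have "\<bar>\<dots>\<bar> \<le> (1 / real n) * (40 * x^2 + real n * (3104 * x^3))"
  proof -
    have "\<bar>d1 + real n * d2\<bar> \<le> 40 * x^2 + real n * (3104 * x^3)"
      using B1 mult_left_mono[OF B2, of "real n"] abs_triangle_ineq[of d1 "real n * d2"] by (simp add: abs_mult)
    thus ?thesis unfolding abs_mult using w0_pos w0_less x by (intro mult_mono) (auto intro!: divide_right_mono)
  qed
  also have "\<dots> \<le> (1 / real n) * (40 * (1 / real n)^2 + real n * (3104 * (1 / real n)^3))"
    using x by (intro mult_left_mono add_mono power_mono) auto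
  also have "\<dots> = 3144 / real n ^ 3" using n_pos by (simp add: field_simps power2_eq_square power3_eq_cube)
  finally show ?thesis .
qed

end

theorem theorem11:
  fixes v :: "nat \<Rightarrow> nat"
  assumes "\<And>n. n \<ge> 1 \<Longrightarrow> v n \<in> {1..n}"
  shows "\<exists>L :: nat \<Rightarrow> real.
    (\<forall>n\<ge>1. (\<lambda>m. pmf (assoc_pmf m n) (var_fun n (v n))) \<longlonglongrightarrow> L n) \<and>
    (\<lambda>n. L n - (546 - 386 * sqrt 2) / real n ^ 2) \<in> O(\<lambda>n. 1 / real n ^ 3)"
proof -
  \<comment> \<open>\<open>Cu\<close> is obtained before \<open>n\<close> is fixed, so a single
    constant \<open>K\<close> serves all \<open>n\<close>.\<close>
  obtain Cu :: real where Cu: "\<And>L. (real L + 2) ^ 6 \<le> Cu * (21/20) ^ L"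
    using polynomial_exponential_bound by blast
  define K where "K = 100000 * Cu^6 + 3144"
  have "\<exists>l. (\<lambda>m. pmf (assoc_pmf m n) (var_fun n (v n))) \<longlonglongrightarrow> l \<and> \<bar>l - (546 - 386 * sqrt 2) / real n ^ 2\<bar> \<le> K / real n ^ 3"
    if n: "n \<ge> 1" for n
  proof -
    interpret trees n by unfold_locales (rule n)
    obtain l where l: "(\<lambda>m. pmf (assoc_pmf m n) (var_fun n (v n))) \<longlonglongrightarrow> l" "\<bar>l - X_lim\<bar> \<le> 100000 * Cu^6 / real n ^ 3"
      using var_limit[OF assms[OF n] Cu] by blast
    have "K / real n ^ 3 = 100000 * Cu^6 / real n ^ 3 + 3144 / real n ^ 3" by (simp add: K_def add_divide_distrib)
    hence "\<bar>l - (546 - 386 * sqrt 2) / real n ^ 2\<bar> \<le> K / real n ^ 3" using l(2) X_lim_asymptotic by linarith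
    thus ?thesis using l(1) by blast
  qed
  then obtain L where L: "\<And>n. n \<ge> 1 \<Longrightarrow> (\<lambda>m. pmf (assoc_pmf m n) (var_fun n (v n))) \<longlonglongrightarrow> L n"
     "\<And>n. n \<ge> 1 \<Longrightarrow> \<bar>L n - (546 - 386 * sqrt 2) / real n ^ 2\<bar> \<le> K / real n ^ 3"
    by metis
  have "(\<lambda>n. L n - (546 - 386 * sqrt 2) / real n ^ 2) \<in> O(\<lambda>n. 1 / real n ^ 3)"
  proof (rule bigoI[of _ K])
    show "\<forall>\<^sub>F n in sequentially. norm (L n - (546 - 386 * sqrt 2) / real n ^ 2) \<le> K * norm (1 / real n ^ 3)"
      unfolding eventually_at_top_linorder using L(2) by (intro exI[of _ 1]) auto
  qed
  with L(1) show ?thesis by blast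
qed

end
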